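(* The 4-BGP problem admits an $O(|V|^2|E|)$-time $\frac{24}{13}$-approximation algorithm: there is an algorithm that, given any simple connected graph $G=(V,E)$ with $|V|\ge 4$, computes in $O(|V|^2|E|)$ time a feasible $4$-partition of $V$ whose size is at most $\frac{24}{13}\,\mathrm{OPT}$.
   Context: For a simple connected graph $G=(V,E)$ and an integer $k\ge 2$, a feasible $k$-partition is a partition of $V$ into $k$ non-empty parts $V_1,\dots,V_k$ such that each induced subgraph $G[V_i]$ is connected; its size is $\max_i|V_i|$. The problem $k$-BGP asks for a feasible $k$-partition of minimum size; $\mathrm{OPT}$ denotes this minimum size. *)

theory Defs
  imports Complex_Main "HOL-Library.Disjoint_Sets"
begin

section \<open>Graphs and balanced connected partitions\<close>

definition simple_graph :: "'a set \<Rightarrow> 'a set set \<Rightarrow> bool" where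
  "simple_graph V E \<longleftrightarrow> finite V \<and> E \<subseteq> {{u, v} | u v. u \<in> V \<and> v \<in> V \<and> u \<noteq> v}"

definition induced_adj :: "'a set set \<Rightarrow> 'a set \<Rightarrow> ('a \<times> 'a) set" where
  "induced_adj E S = {(u, v). u \<in> S \<and> v \<in> S \<and> {u, v} \<in> E}"

text \<open>Connectedness of the subgraph induced by \<open>S\<close>; the graph itself is the case \<open>S = V\<close>.\<close>

definition induced_connected :: "'a set set \<Rightarrow> 'a set \<Rightarrow> bool" where
  "induced_connected E S \<longleftrightarrow> S \<noteq> {} \<and> (\<forall>u\<in>S. \<forall>v\<in>S. (u, v) \<in> (induced_adj E S)\<^sup>*)"

definition feasible_partition :: "nat \<Rightarrow> 'a set \<Rightarrow> 'a set set \<Rightarrow> 'a set set \<Rightarrow> bool" where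
  "feasible_partition k V E P \<longleftrightarrow>
     partition_on V P \<and> card P = k \<and> (\<forall>S\<in>P. induced_connected E S)"

definition partition_size :: "'a set set \<Rightarrow> nat" where
  "partition_size P = Max (card ` P)"

text \<open>
  For a finite connected graph and \<open>1 \<le> k \<le> card V\<close> the minimum below ranges over a finite
  non-empty set, since a spanning tree with \<open>k - 1\<close> edges removed is feasible.
\<close>

definition OPT :: "nat \<Rightarrow> 'a set \<Rightarrow> 'a set set \<Rightarrow> nat" where
  "OPT k V E = Min {partition_size P | P. feasible_partition k V E P}"


section \<open>Machine model\<close>

text \<open>
  Running time is measured on a unit-cost random access machine, presented as a while language.
  The memory consists of named arrays of natural numbers; a program mentions only finitely many
  names, and a scalar variable is the cell of an array at index 0. The arithmetic operations are
  addition and truncated subtraction. Multiplication is left out on purpose: at unit cost it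
  would make the machine unreasonably strong.
\<close>

type_synonym state = "string \<Rightarrow> nat \<Rightarrow> nat"

datatype expr =
    Const nat
  | Cell string expr
  | Add expr expr
  | Sub expr expr

datatype cond =
    Less expr expr
  | Neg cond
  | Conj cond cond

datatype prog =
    Skip
  | Store string expr expr
  | Seq prog prog
  | If cond prog prog
  | While cond prog

fun expr_val :: "expr \<Rightarrow> state \<Rightarrow> nat" where
  "expr_val (Const c) s = c"
| "expr_val (Cell a i) s = s a (expr_val i s)"
| "expr_val (Add e f) s = expr_val e s + expr_val f s"
| "expr_val (Sub e f) s = expr_val e s - expr_val f s"

fun cond_val :: "cond \<Rightarrow> state \<Rightarrow> bool" where
  "cond_val (Less e f) s \<longleftrightarrow> expr_val e s < expr_val f s"
| "cond_val (Neg b) s \<longleftrightarrow> \<not> cond_val b s"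
| "cond_val (Conj b c) s \<longleftrightarrow> cond_val b s \<and> cond_val c s"

fun expr_cost :: "expr \<Rightarrow> nat" where
  "expr_cost (Const c) = 1"
| "expr_cost (Cell a i) = 1 + expr_cost i"
| "expr_cost (Add e f) = 1 + expr_cost e + expr_cost f"
| "expr_cost (Sub e f) = 1 + expr_cost e + expr_cost f"

fun cond_cost :: "cond \<Rightarrow> nat" where
  "cond_cost (Less e f) = 1 + expr_cost e + expr_cost f"
| "cond_cost (Neg b) = 1 + cond_cost b"
| "cond_cost (Conj b c) = 1 + cond_cost b + cond_cost c"

text \<open>
  \<open>run p s t s'\<close>: started in memory \<open>s\<close>, the program \<open>p\<close> halts after \<open>t\<close> unit-cost steps with
  memory \<open>s'\<close>.
\<close>

inductive run :: "prog \<Rightarrow> state \<Rightarrow> nat \<Rightarrow> state \<Rightarrow> bool" where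
  Skip: "run Skip s 1 s"
| Store: "run (Store a i e) s (1 + expr_cost i + expr_cost e)
            (s(a := (s a)(expr_val i s := expr_val e s)))"
| Seq: "run p s t s' \<Longrightarrow> run q s' u s'' \<Longrightarrow> run (Seq p q) s (t + u) s''"
| IfTrue: "cond_val b s \<Longrightarrow> run p s t s' \<Longrightarrow> run (If b p q) s (1 + cond_cost b + t) s'"
| IfFalse: "\<not> cond_val b s \<Longrightarrow> run q s t s' \<Longrightarrow> run (If b p q) s (1 + cond_cost b + t) s'"
| WhileFalse: "\<not> cond_val b s \<Longrightarrow> run (While b p) s (1 + cond_cost b) s"
| WhileTrue: "cond_val b s \<Longrightarrow> run p s t s' \<Longrightarrow> run (While b p) s' u s'' \<Longrightarrow>
    run (While b p) s (1 + cond_cost b + t + u) s''"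


lemma run_deterministic:
  "run p s t s' \<Longrightarrow> run p s u s'' \<Longrightarrow> u = t \<and> s'' = s'"
proof (induction arbitrary: u s'' rule: run.induct)
  case (Skip s)
  from Skip.prems show ?case by cases simp
next
  case (Store a i e s)
  from Store.prems show ?case by cases simp
next
  case (Seq p s t s' q v r)
  from Seq.prems show ?case by cases (metis Seq.IH)
next
  case (IfTrue b s p t s' q)
  from IfTrue.prems show ?case by cases (use IfTrue.hyps in simp_all, metis IfTrue.IH)
next
  case (IfFalse b s q t s' p)
  from IfFalse.prems show ?case by cases (use IfFalse.hyps in simp_all, metis IfFalse.IH)
next
  case (WhileFalse b s p)
  from WhileFalse.prems show ?case by cases (use WhileFalse.hyps in simp_all)
next
  case (WhileTrue b s p t s' v r)
  from WhileTrue.prems show ?case by cases (use WhileTrue.hyps in simp_all, metis WhileTrue.IH)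
qed


section \<open>Input and output conventions\<close>

text \<open>
  A graph is presented by a list of its vertices and a list of its edges, in any order and
  without repetition; each edge \<open>{u, v}\<close> is listed once, either as \<open>(u, v)\<close> or as \<open>(v, u)\<close>.
\<close>

definition presents :: "nat list \<Rightarrow> (nat \<times> nat) list \<Rightarrow> nat set \<Rightarrow> nat set set \<Rightarrow> bool" where
  "presents vs es V E \<longleftrightarrow>
     distinct vs \<and> set vs = V \<and>
     distinct (map (\<lambda>(u, v). {u, v}) es) \<and> set (map (\<lambda>(u, v). {u, v}) es) = E"

definition list_array :: "nat list \<Rightarrow> nat \<Rightarrow> nat" where
  "list_array xs i = (if i < length xs then xs ! i else 0)"

definition input_state :: "nat list \<Rightarrow> (nat \<times> nat) list \<Rightarrow> state" where
  "input_state vs es = (\<lambda>_ _. 0)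
     (''n'' := list_array [length vs],
      ''m'' := list_array [length es],
      ''vertex'' := list_array vs,
      ''end1'' := list_array (map fst es),
      ''end2'' := list_array (map snd es))"

text \<open>The program answers by storing the index of the part of each vertex \<open>v\<close> in \<open>part[v]\<close>.\<close>

definition output_parts :: "nat \<Rightarrow> nat set \<Rightarrow> state \<Rightarrow> nat set set" where
  "output_parts k V s = (\<lambda>i. {v \<in> V. s ''part'' v = i}) ` {..<k}"

end

theory Submission
  imports Defs
begin

text \<open>
  Let \<open>T = \<lfloor>6n/13\<rfloor>\<close> and \<open>n = 2T + 1 + g\<close>. The optimum is at least \<open>n/4\<close>, so a partition into
  connected parts of size at most \<open>T\<close> is good enough, and any partition into at most four connected
  parts can be refined to exactly four. The basic step takes a connected set \<open>H\<close> and a threshold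
  \<open>\<theta>\<close>: it shrinks a connected set \<open>K\<close>, always replacing it by the largest component of \<open>K - x\<close>, where
  \<open>x\<close> is a neighbour of the connected rest \<open>H - K\<close>, and stops when that component would drop below
  \<open>|H| + 1 - \<theta>\<close>. The pieces around the last \<open>x\<close> are small and all attached to \<open>x\<close>. Hence either all
  components of \<open>H - x\<close> have fewer than \<open>\<theta>\<close> vertices (\<open>x\<close> is a centre), or gluing adjacent pieces
  together cuts \<open>H\<close> into two connected sets of controlled sizes.

  For \<open>H = V\<close> and \<open>\<theta> = T + 1\<close>, a centre makes the three largest components plus the rest optimal up
  to \<open>T\<close>. Otherwise we get three parts of size at most \<open>T\<close>, or a bisection into \<open>A\<close> and \<open>B\<close> with sizes
  between \<open>T + 1\<close> and \<open>T + g\<close>. If both halves can be cut into parts of size at most \<open>T\<close>, we are done.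
  Otherwise one half, say \<open>A\<close>, has a centre \<open>u\<close> whose branches have fewer than \<open>g\<close> vertices. Branches
  adjacent to \<open>B\<close> are moved over until splitting off one more branch brings \<open>A\<close> down to \<open>T\<close>; if they
  run out first, the remaining branches hang on \<open>u\<close> alone, which forces the optimum up. If the
  enlarged \<open>B\<close> now cannot be cut, it has a centre \<open>w\<close> as well. Either all components of
  \<open>G - {u, w}\<close> are smaller than \<open>g\<close>, which again forces the optimum up, or branches of both sides glue
  together to a connected set \<open>X\<close> with \<open>g \<le> |X| \<le> 2g - 2\<close>, which becomes a part of its own. At most
  one of \<open>A - X\<close> and \<open>B - X\<close> is then larger than \<open>T\<close>, and moving its branches as before finishes.
\<close>

section \<open>Costed execution\<close>

text \<open>The value of T is what averaging alone certifies: the optimum is at least n/4, and 24/13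
  of n/4 is 6n/13. Two parts above T leave each other at most T + g vertices, and 6g \<le> T + 6
  makes g small against T. This slack is spent in three ways. A set of at most 2g - 2 vertices is an
  admissible part; a half of size at most T + g that is cut with threshold |half| - T has two
  admissible sides; and if two parts keep at least g vertices each while the part being shrunk,
  together with the branch split off from it, has at least T + 1, then neither of the two exceeds T.
  A part of size up to T + g is admissible only if every feasible partition has a large part. This
  is what a centre gives: a part of a feasible partition that avoids the centres (and, with one
  centre, meets the exhausted set) is trapped in one branch and has fewer than g vertices, so few
  parts must cover almost everything. The time comes from up to n rounds of cost n(m + 1). All
  constants are read off the program text, and the proofs carry only products of loop bounds;
  connectedness gives n \<le> m + 1, which absorbs the quadratic scans.\<close>

fun writes :: "prog \<Rightarrow> string set" where
  "writes Skip = {}"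
| "writes (Store a i e) = {a}"
| "writes (Seq p q) = writes p \<union> writes q"
| "writes (If b p q) = writes p \<union> writes q"
| "writes (While b p) = writes p"

text \<open>
  If every loop of \<open>p\<close> at nesting depth \<open>i\<close> makes at most \<open>N\<^sub>i\<close> iterations, then \<open>p\<close> takes at most
  \<open>weight p\<close> times the largest product of the \<open>N\<^sub>i\<close> along a branch. This keeps all constants
  of the running time inside \<open>weight\<close>.
\<close>

fun weight :: "prog \<Rightarrow> nat" where
  "weight Skip = 1"
| "weight (Store a i e) = 1 + expr_cost i + expr_cost e"
| "weight (Seq p q) = weight p + weight q"
| "weight (If b p q) = 1 + cond_cost b + weight p + weight q"
| "weight (While b p) = 2 * (1 + cond_cost b) + weight p"

definition agree :: "string set \<Rightarrow> state \<Rightarrow> state \<Rightarrow> bool" where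
  "agree A s s' \<longleftrightarrow> (\<forall>a. a \<notin> A \<longrightarrow> s' a = s a)"

lemma agreeD: "agree A s s' \<Longrightarrow> a \<notin> A \<Longrightarrow> s' a = s a"
  by (simp add: agree_def)

lemma agree_refl [simp]: "agree A s s"
  by (simp add: agree_def)

lemma agree_trans: "agree A s s' \<Longrightarrow> agree B s' s'' \<Longrightarrow> A \<union> B \<subseteq> C \<Longrightarrow> agree C s s''"
  by (fastforce simp: agree_def)

text \<open>The frame rule. \<open>wpE\<close> attaches it to every postcondition, so specifications
  and invariants need to speak only about the arrays that a program writes.\<close>

lemma run_agree: "run p s t s' \<Longrightarrow> agree (writes p) s s'"
  by (induction rule: run.induct) (auto simp: agree_def)

text \<open>Total correctness with a time budget. The constant is always the syntactic
  \<open>weight p\<close>, and only the factor \<open>F\<close> changes from rule to rule, so that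
  composing programs creates no new constants.\<close>

definition wp :: "nat \<Rightarrow> prog \<Rightarrow> (state \<Rightarrow> bool) \<Rightarrow> state \<Rightarrow> bool" where
  "wp F p Q s \<longleftrightarrow> (\<exists>t s'. run p s t s' \<and> t \<le> weight p * F \<and> Q s')"

lemma wpI: "run p s t s' \<Longrightarrow> t \<le> weight p * F \<Longrightarrow> Q s' \<Longrightarrow> wp F p Q s"
  by (auto simp: wp_def)

lemma wpE:
  assumes "wp F p Q s"
  obtains t s' where "run p s t s'" "t \<le> weight p * F" "Q s'" "agree (writes p) s s'"
  using assms run_agree by (auto simp: wp_def)

lemma wp_weaken:
  assumes "wp F p Q s" "F \<le> F'" "\<And>s'. Q s' \<Longrightarrow> agree (writes p) s s' \<Longrightarrow> Q' s'"
  shows "wp F' p Q' s"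
proof -
  obtain t s' where 1: "run p s t s'" "t \<le> weight p * F" "Q s'" "agree (writes p) s s'"
    using assms(1) by (rule wpE)
  have "t \<le> weight p * F'"
    using 1(2) mult_le_mono2[OF assms(2)] by (rule le_trans)
  with 1(1) show ?thesis
    by (rule wpI) (rule assms(3)[OF 1(3,4)])
qed

lemma wp_Skip: "0 < F \<Longrightarrow> Q s \<Longrightarrow> wp F Skip Q s"
  using wpI[OF run.Skip] by simp

lemma wp_Store:
  assumes "0 < F" "Q (s(a := (s a)(expr_val i s := expr_val e s)))"
  shows "wp F (Store a i e) Q s"
  using run.Store
proof (rule wpI)
  show "1 + expr_cost i + expr_cost e \<le> weight (Store a i e) * F"
    using assms(1) by (cases F) auto
qed fact

lemma wp_Seq:
  assumes "wp F p R s" "\<And>s'. R s' \<Longrightarrow> agree (writes p) s s' \<Longrightarrow> wp F q Q s'"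
  shows "wp F (Seq p q) Q s"
proof -
  obtain t s' where 1: "run p s t s'" "t \<le> weight p * F" "R s'" "agree (writes p) s s'"
    using assms(1) by (rule wpE)
  obtain u s'' where 2: "run q s' u s''" "u \<le> weight q * F" "Q s''"
    using assms(2)[OF 1(3,4)] by (rule wpE)
  have "t + u \<le> weight (Seq p q) * F"
    using 1 2 by (simp add: algebra_simps)
  with run.Seq[OF 1(1) 2(1)] show ?thesis
    using 2(3) by (rule wpI)
qed

lemma wp_If:
  assumes "0 < F" "cond_val b s \<Longrightarrow> wp F p Q s" "\<not> cond_val b s \<Longrightarrow> wp F q Q s"
  shows "wp F (If b p q) Q s"
proof -
  have F: "1 + cond_cost b \<le> (1 + cond_cost b) * F"
    using assms(1) by (cases F) auto
  show ?thesis
  proof (cases "cond_val b s")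
    case True
    then obtain t s' where 1: "run p s t s'" "t \<le> weight p * F" "Q s'"
      using assms(2) by (blast elim: wpE)
    have "1 + cond_cost b + t \<le> weight (If b p q) * F"
      using F 1(2) by (simp add: algebra_simps)
    with run.IfTrue[OF True 1(1)] show ?thesis
      using 1(3) by (rule wpI)
  next
    case False
    then obtain t s' where 1: "run q s t s'" "t \<le> weight q * F" "Q s'"
      using assms(3) by (blast elim: wpE)
    have "1 + cond_cost b + t \<le> weight (If b p q) * F"
      using F 1(2) by (simp add: algebra_simps)
    with run.IfFalse[OF False 1(1)] show ?thesis
      using 1(3) by (rule wpI)
  qed
qed

text \<open>The measure allows at most \<open>N\<close> iterations, and one more evaluation of the
  guard ends the loop. The body has to be verified only in states that agree with the initial one
  outside its own writes.\<close>

lemma wp_While: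
  assumes "0 < F" "0 < N" "\<mu> s \<le> N" "I s"
    and step: "\<And>s'. I s' \<Longrightarrow> agree (writes p) s s' \<Longrightarrow> cond_val b s' \<Longrightarrow>
      wp F p (\<lambda>s''. I s'' \<and> \<mu> s'' < (\<mu> s' :: nat)) s'"
  shows "wp (N * F) (While b p) (\<lambda>s'. I s' \<and> \<not> cond_val b s') s"
proof -
  define c where "c = 1 + cond_cost b"
  have "\<exists>t s''. run (While b p) s' t s'' \<and> t \<le> \<mu> s' * (c + weight p * F) + c \<and>
      I s'' \<and> \<not> cond_val b s''" if "I s'" "agree (writes p) s s'" for s'
    using that
  proof (induction "\<mu> s'" arbitrary: s' rule: less_induct)
    case less
    show ?case
    proof (cases "cond_val b s'")
      case False
      then show ?thesis
        using run.WhileFalse[OF False] less.prems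
        by (intro exI[of _ c] exI[of _ s']) (auto simp: c_def)
    next
      case True
      obtain t s1 where 1: "run p s' t s1" "t \<le> weight p * F" "I s1" "\<mu> s1 < \<mu> s'"
        using step[OF less.prems True] by (blast elim: wpE)
      have "agree (writes p) s s1"
        using less.prems(2) run_agree[OF 1(1)] by (rule agree_trans) simp
      then obtain u s2 where 2: "run (While b p) s1 u s2"
        "u \<le> \<mu> s1 * (c + weight p * F) + c" "I s2" "\<not> cond_val b s2"
        using less.hyps 1 by blast
      have "run (While b p) s' (1 + cond_cost b + t + u) s2"
        using run.WhileTrue[OF True 1(1) 2(1)] .
      moreover have "1 + cond_cost b + t + u \<le> \<mu> s' * (c + weight p * F) + c"
      proof -
        have "1 + cond_cost b + t + u \<le> Suc (\<mu> s1) * (c + weight p * F) + c"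
          using 1 2 by (simp add: c_def)
        also have "\<dots> \<le> \<mu> s' * (c + weight p * F) + c"
          using 1(4) by (intro add_right_mono mult_le_mono1) simp
        finally show ?thesis .
      qed
      ultimately show ?thesis using 2 by blast
    qed
  qed
  then obtain t s'' where t: "run (While b p) s t s''" "t \<le> \<mu> s * (c + weight p * F) + c"
    "I s''" "\<not> cond_val b s''"
    using assms(4) by fastforce
  have "t \<le> N * (c + weight p * F) + c"
    using t(2) add_right_mono[OF mult_right_mono[OF assms(3)]] by (rule le_trans) simp
  also have "\<dots> \<le> weight (While b p) * (N * F)"
  proof -
    \<comment> \<open>At most \<open>N\<close> successful guards and one failing guard: both shares
      fit since \<open>N\<close> and \<open>F\<close> are positive, and they account for the factor
      2 in the weight of a loop.\<close>
    have "c * N \<le> c * (N * F)" "c * 1 \<le> c * (N * F)"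
      using assms(1,2) by (intro mult_le_mono2; simp)+
    moreover have wt: "weight (While b p) = 2 * c + weight p"
      by (simp add: c_def)
    have distrib: "N * (c + w * F) + c = c * N + c * 1 + N * (w * F)"
      "(2 * c + w) * (N * F) = c * (N * F) + c * (N * F) + N * (w * F)" for w
      by (simp_all add: algebra_simps)
    ultimately show ?thesis unfolding wt distrib by linarith
  qed
  finally show ?thesis
    using t by (blast intro: wpI)
qed

abbreviation var :: "string \<Rightarrow> expr" where
  "var x \<equiv> Cell x (Const 0)"

definition assign :: "string \<Rightarrow> expr \<Rightarrow> prog" (infix "::=" 60) where
  "x ::= e = Store x (Const 0) e"

abbreviation seq :: "prog \<Rightarrow> prog \<Rightarrow> prog" (infixr ";;" 55) where
  "p ;; q \<equiv> Seq p q"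

definition eq :: "expr \<Rightarrow> expr \<Rightarrow> cond" where
  "eq e f = Conj (Neg (Less e f)) (Neg (Less f e))"

text \<open>The machine has no product; a constant multiple is a repeated sum, whose length goes
  into the cost of the expression.\<close>

fun scale :: "nat \<Rightarrow> expr \<Rightarrow> expr" where
  "scale 0 e = Const 0"
| "scale (Suc k) e = Add e (scale k e)"

lemma cond_val_eq [simp]: "cond_val (eq e f) s \<longleftrightarrow> expr_val e s = expr_val f s"
  by (auto simp: eq_def)

lemma expr_val_scale [simp]: "expr_val (scale k e) s = k * expr_val e s"
  by (induction k) auto

lemma writes_assign [simp]: "writes (x ::= e) = {x}"
  by (simp add: assign_def)

lemma wp_assign:
  assumes "0 < F"
  shows "wp F (x ::= e) (\<lambda>s'. s' x 0 = expr_val e s) s"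
  unfolding assign_def using assms by (intro wp_Store) simp_all

lemma wp_assign':
  "0 < F \<Longrightarrow> Q (s(x := (s x)(0 := expr_val e s))) \<Longrightarrow> wp F (x ::= e) Q s"
  unfolding assign_def by (intro wp_Store) auto

lemma wp_assign_seq:
  assumes "0 < F" "wp F q Q (s(x := (s x)(0 := expr_val e s)))"
  shows "wp F (x ::= e ;; q) Q s"
  using assms by (intro wp_Seq[where R = "\<lambda>s'. s' = s(x := (s x)(0 := expr_val e s))"] wp_assign') auto

lemma wp_Store_seq:
  assumes "0 < F" "wp F q Q (s(a := (s a)(expr_val i s := expr_val e s)))"
  shows "wp F (Store a i e ;; q) Q s"
  using assms by (intro wp_Seq[OF wp_Store[where Q = "\<lambda>s'. s' = s(a := (s a)(expr_val i s := expr_val e s))"]]) auto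

section \<open>Programs scanning a graph\<close>

abbreviation inputs :: "string set" where
  "inputs \<equiv> {''n'', ''m'', ''vertex'', ''end1'', ''end2''}"

definition for_vertices :: "string \<Rightarrow> string \<Rightarrow> prog \<Rightarrow> prog" where
  "for_vertices i x p =
     i ::= Const 0 ;;
     While (Less (var i) (var ''n''))
       (x ::= Cell ''vertex'' (var i) ;; p ;; i ::= Add (var i) (Const 1))"

text \<open>Each edge is stored once but processed in both directions, so the body sees a symmetric
  set of arcs.\<close>

definition for_arcs :: "prog \<Rightarrow> prog" where
  "for_arcs p =
     ''j'' ::= Const 0 ;;
     While (Less (var ''j'') (var ''m''))
       (''p'' ::= Cell ''end1'' (var ''j'') ;; ''q'' ::= Cell ''end2'' (var ''j'') ;; p ;;
        ''p'' ::= Cell ''end2'' (var ''j'') ;; ''q'' ::= Cell ''end1'' (var ''j'') ;; p ;;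
        ''j'' ::= Add (var ''j'') (Const 1))"

lemma writes_for_vertices [simp]: "writes (for_vertices i x p) = {i, x} \<union> writes p"
  by (auto simp: for_vertices_def)

lemma writes_for_arcs [simp]: "writes (for_arcs p) = {''j'', ''p'', ''q''} \<union> writes p"
  by (auto simp: for_arcs_def)

text \<open>In the following programs \<open>b\<close> and \<open>e\<close> may mention \<open>v\<close>, respectively \<open>p\<close> and \<open>q\<close>.\<close>

definition update :: "string \<Rightarrow> cond \<Rightarrow> expr \<Rightarrow> prog" where
  "update a b e = for_vertices ''i'' ''v'' (If b (Store a (var ''v'') e) Skip)"

definition count :: "string \<Rightarrow> cond \<Rightarrow> prog" where
  "count c b = c ::= Const 0 ;;
     for_vertices ''i'' ''v'' (If b (c ::= Add (var c) (Const 1)) Skip)"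

definition find_vertex :: "string \<Rightarrow> cond \<Rightarrow> prog" where
  "find_vertex x b = for_vertices ''i'' ''v'' (If b (x ::= var ''v'') Skip)"

definition find_arc :: "cond \<Rightarrow> prog" where
  "find_arc b = ''f'' ::= Const 0 ;;
     for_arcs (If b (''f'' ::= Const 1 ;; ''x'' ::= var ''p'' ;; ''y'' ::= var ''q'') Skip)"

lemma writes_update [simp]: "writes (update a b e) = {''i'', ''v'', a}"
  by (auto simp: update_def)

lemma writes_count [simp]: "writes (count c b) = {''i'', ''v'', c}"
  by (auto simp: count_def)

lemma writes_find_vertex [simp]: "writes (find_vertex x b) = {''i'', ''v'', x}"
  by (auto simp: find_vertex_def)

lemma writes_find_arc [simp]: "writes (find_arc b) = {''j'', ''p'', ''q'', ''f'', ''x'', ''y''}"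
  by (auto simp: find_arc_def)

section \<open>The input graph and rules for loops over its vertices\<close>

locale graph_input =
  fixes vs :: "nat list" and es :: "(nat \<times> nat) list" and V :: "nat set" and E :: "nat set set"
  assumes simple: "simple_graph V E"
    and connected: "induced_connected E V"
    and card4: "4 \<le> card V"
    and presents: "presents vs es V E"
begin

abbreviation n :: nat where "n \<equiv> card V"
abbreviation m :: nat where "m \<equiv> card E"

definition inp :: "state \<Rightarrow> bool" where
  "inp s \<longleftrightarrow> s ''n'' 0 = n \<and> s ''m'' 0 = m \<and> (\<forall>i<n. s ''vertex'' i = vs ! i) \<and>
     (\<forall>j<m. s ''end1'' j = fst (es ! j) \<and> s ''end2'' j = snd (es ! j))"

lemma finite_V [simp]: "finite V"
  using simple by (simp add: simple_graph_def)

lemma n_pos [simp]: "0 < n"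
  using card4 by simp

lemma length_vs: "length vs = n" and set_vs: "set vs = V" and distinct_vs: "distinct vs"
  using presents by (auto simp: presents_def distinct_card)

lemma length_es: "length es = m"
  using presents distinct_card[of "map (\<lambda>(u, v). {u, v}) es"] by (auto simp: presents_def)

lemma E_eq: "E = {{u, v} | u v. (u, v) \<in> set es}"
  using presents by (auto simp: presents_def)

lemma inp_agree: "agree A s s' \<Longrightarrow> A \<inter> inputs = {} \<Longrightarrow> inp s \<Longrightarrow> inp s'"
  by (auto simp: inp_def agree_def)

definition arcs :: "(nat \<times> nat) set" where
  "arcs = {(u, v). {u, v} \<in> E}"

lemma arcs_eq: "arcs = set es \<union> (set es)\<inverse>"
  by (subst arcs_def, subst E_eq) (auto simp: doubleton_eq_iff)

lemma arcs_sym: "(u, v) \<in> arcs \<Longrightarrow> (v, u) \<in> arcs"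
  by (simp add: arcs_def insert_commute)

lemma arcs_V: "(u, v) \<in> arcs \<Longrightarrow> u \<in> V \<and> v \<in> V \<and> u \<noteq> v"
  using simple unfolding arcs_def simple_graph_def by (fastforce simp: doubleton_eq_iff)

text \<open>The invariant is indexed by the set \<open>D\<close> of vertices seen so far, so that
  its uses do not depend on the order of the vertex list. The \<open>stable\<close> assumptions make
  it insensitive to the counter and to the loop variable.\<close>

lemma wp_for_vertices:
  assumes "inp s" "0 < F" "i \<noteq> x" "i \<notin> writes p" "({i, x} \<union> writes p) \<inter> inputs = {}"
    and init: "I {} s"
    and stable: "\<And>D s a b. I D s \<Longrightarrow> I D (s(i := a))" "\<And>D s a b. I D s \<Longrightarrow> I D (s(x := a))"
    and step: "\<And>D y s'. D \<subseteq> V \<Longrightarrow> y \<in> V \<Longrightarrow> y \<notin> D \<Longrightarrow> I D s' \<Longrightarrow> s' x 0 = y \<Longrightarrow>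
      agree ({i, x} \<union> writes p) s s' \<Longrightarrow> wp F p (I (insert y D)) s'"
  shows "wp (n * F) (for_vertices i x p) (I V) s"
proof -
  define J where "J s' \<longleftrightarrow> inp s' \<and> agree ({i, x} \<union> writes p) s s' \<and> s' i 0 \<le> n \<and>
    I (set (take (s' i 0) vs)) s'" for s'
  let ?body = "x ::= Cell ''vertex'' (var i) ;; p ;; i ::= Add (var i) (Const 1)"
  have "wp (n * F) (While (Less (var i) (var ''n'')) ?body)
      (\<lambda>s'. J s' \<and> \<not> cond_val (Less (var i) (var ''n'')) s') s'"
    if J: "J s'" for s'
  proof (rule wp_While[where \<mu> = "\<lambda>s. n - s i 0"])
    fix s1
    assume J1: "J s1" and b: "cond_val (Less (var i) (var ''n'')) s1"
    define k where "k = s1 i 0"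
    have k: "k < n" and inp1: "inp s1"
      using J1 b by (auto simp: J_def inp_def k_def)
    have y: "vs ! k \<in> V" "vs ! k \<notin> set (take k vs)" "set (take k vs) \<subseteq> V"
      "set (take (Suc k) vs) = insert (vs ! k) (set (take k vs))"
    proof -
      have kl: "k < length vs" using k length_vs by simp
      then show "vs ! k \<in> V" using set_vs nth_mem by blast
      have "distinct (take (Suc k) vs)" using distinct_vs by (rule distinct_take)
      then show "vs ! k \<notin> set (take k vs)"
        using kl by (simp add: take_Suc_conv_app_nth)
      show "set (take k vs) \<subseteq> V"
        using set_take_subset[of k vs] set_vs by simp
      show "set (take (Suc k) vs) = insert (vs ! k) (set (take k vs))"
        using kl by (simp add: take_Suc_conv_app_nth)
    qed
    define s2 where "s2 = s1(x := (s1 x)(0 := vs ! k))"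
    have I2: "I (set (take k vs)) s2"
      using J1 stable unfolding s2_def J_def k_def by blast
    have a2: "agree ({i, x} \<union> writes p) s s2"
      using J1 by (auto simp: J_def s2_def agree_def)
    have "wp F ?body (\<lambda>s''. J s'' \<and> n - s'' i 0 < n - s1 i 0) s1"
    proof (rule wp_Seq[where R = "\<lambda>s'. s' = s2"])
      show "wp F (x ::= Cell ''vertex'' (var i)) (\<lambda>s'. s' = s2) s1"
        unfolding assign_def using inp1 k \<open>0 < F\<close> by (intro wp_Store) (auto simp: s2_def k_def inp_def)
      fix s' assume "s' = s2"
      moreover have "wp F (p ;; i ::= Add (var i) (Const 1))
          (\<lambda>s''. J s'' \<and> n - s'' i 0 < n - s1 i 0) s2"
      proof (rule wp_Seq[where R = "I (insert (vs ! k) (set (take k vs)))"])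
        show "wp F p (I (insert (vs ! k) (set (take k vs)))) s2"
          using y(3,1,2) I2 _ a2 by (rule step) (simp add: s2_def)
        fix s3 assume I3: "I (insert (vs ! k) (set (take k vs))) s3" and a3: "agree (writes p) s2 s3"
        have i3: "s3 i 0 = k"
          using a3 \<open>i \<notin> writes p\<close> \<open>i \<noteq> x\<close> by (auto simp: agree_def s2_def k_def)
        define s4 where "s4 = s3(i := (s3 i)(0 := Suc k))"
        have a4: "agree ({i, x} \<union> writes p) s s4"
          using a2 a3 by (auto simp: agree_def s4_def)
        moreover have "I (set (take (Suc k) vs)) s4"
          unfolding y(4) s4_def using I3 by (rule stable)
        moreover have "s4 i 0 = Suc k"
          by (simp add: s4_def)
        ultimately have "J s4"
          using inp_agree[OF a4 assms(5,1)] k by (simp add: J_def)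
        then show "wp F (i ::= Add (var i) (Const 1))
            (\<lambda>s''. J s'' \<and> n - s'' i 0 < n - s1 i 0) s3"
          unfolding assign_def using k \<open>0 < F\<close> i3
          by (intro wp_Store) (auto simp: s4_def k_def)
      qed
      ultimately show "wp F (p ;; i ::= Add (var i) (Const 1))
          (\<lambda>s''. J s'' \<and> n - s'' i 0 < n - s1 i 0) s'" by simp
    qed
    then show "wp F ?body (\<lambda>s''. J s'' \<and> n - s'' i 0 < n - s1 i 0) s1" .
  qed (use J \<open>0 < F\<close> in auto)
  note * = this
  have "J (s(i := (s i)(0 := 0)))"
  proof -
    have a: "agree ({i, x} \<union> writes p) s (s(i := (s i)(0 := 0)))"
      by (auto simp: agree_def)
    moreover have "I {} (s(i := (s i)(0 := 0)))"
      using init by (rule stable)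
    ultimately show ?thesis
      using inp_agree[OF a assms(5,1)] by (simp add: J_def)
  qed
  show ?thesis
    unfolding for_vertices_def
  proof (rule wp_Seq[where R = J])
    show "wp (n * F) (i ::= Const 0) J s"
      unfolding assign_def using \<open>0 < F\<close> \<open>J (s(i := (s i)(0 := 0)))\<close> by (intro wp_Store) auto
    fix s' assume "J s'"
    from *[OF this] show "wp (n * F) (While (Less (var i) (var ''n'')) ?body) (I V) s'"
    proof (rule wp_weaken)
      fix s'' assume "J s'' \<and> \<not> cond_val (Less (var i) (var ''n'')) s''"
      then show "I V s''"
        using length_vs set_vs by (auto simp: J_def inp_def)
    qed simp
  qed
qed

section \<open>Connected sets\<close>

abbreviation conn :: "nat set \<Rightarrow> bool" where
  "conn \<equiv> induced_connected E"

lemma conn_nonempty: "conn S \<Longrightarrow> S \<noteq> {}"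
  by (simp add: induced_connected_def)

lemma conn_path: "conn S \<Longrightarrow> u \<in> S \<Longrightarrow> v \<in> S \<Longrightarrow> S \<subseteq> T \<Longrightarrow> (u, v) \<in> (induced_adj E T)\<^sup>*"
proof -
  assume "conn S" "u \<in> S" "v \<in> S" "S \<subseteq> T"
  moreover have "induced_adj E S \<subseteq> induced_adj E T"
    using \<open>S \<subseteq> T\<close> by (auto simp: induced_adj_def)
  ultimately show ?thesis
    using rtrancl_mono unfolding induced_connected_def by blast
qed

lemma adj_sym: "(u, v) \<in> (induced_adj E S)\<^sup>* \<Longrightarrow> (v, u) \<in> (induced_adj E S)\<^sup>*"
proof -
  have "sym (induced_adj E S)"
    by (auto simp: sym_def induced_adj_def insert_commute)
  then show "(u, v) \<in> (induced_adj E S)\<^sup>* \<Longrightarrow> (v, u) \<in> (induced_adj E S)\<^sup>*"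
    using sym_rtrancl symD by metis
qed

text \<open>One hub suffices: adjacency is symmetric, so any two vertices are joined through
  \<open>x\<close>. The gluing and removal arguments for branches rest on this criterion.\<close>

lemma conn_star:
  assumes "x \<in> Z" "\<And>v. v \<in> Z \<Longrightarrow> \<exists>C\<subseteq>Z. conn C \<and> x \<in> C \<and> v \<in> C"
  shows "conn Z"
proof -
  have "(x, v) \<in> (induced_adj E Z)\<^sup>*" if "v \<in> Z" for v
    using assms(2)[OF that] conn_path by blast
  then have "(u, v) \<in> (induced_adj E Z)\<^sup>*" if "u \<in> Z" "v \<in> Z" for u v
    using that adj_sym by (blast intro: rtrancl_trans)
  then show ?thesis
    using assms(1) unfolding induced_connected_def by blast
qed

lemma conn_single [simp]: "conn {v}"
  by (simp add: induced_connected_def)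

lemma conn_Un: "conn S \<Longrightarrow> conn T \<Longrightarrow> S \<inter> T \<noteq> {} \<Longrightarrow> conn (S \<union> T)"
proof -
  assume *: "conn S" "conn T" "S \<inter> T \<noteq> {}"
  then obtain x where "x \<in> S" "x \<in> T" by blast
  with * show ?thesis
    by (intro conn_star[of x]) auto
qed

lemma conn_arc: "(u, v) \<in> arcs \<Longrightarrow> conn {u, v}"
proof -
  assume "(u, v) \<in> arcs"
  then have "(u, v) \<in> (induced_adj E {u, v})\<^sup>*"
    by (auto simp: induced_adj_def arcs_def)
  then show ?thesis
    using adj_sym unfolding induced_connected_def by blast
qed

lemma conn_Un_arc:
  assumes "conn S" "conn T" "(u, v) \<in> arcs" "u \<in> S" "v \<in> T"
  shows "conn (S \<union> T)"
proof -
  have "conn (S \<union> {u, v})"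
    using assms(1,4) conn_arc[OF assms(3)] by (intro conn_Un) auto
  from conn_Un[OF this assms(2)] have "conn (S \<union> {u, v} \<union> T)"
    using assms(5) by auto
  moreover have "S \<union> {u, v} \<union> T = S \<union> T"
    using assms by auto
  ultimately show ?thesis by simp
qed

text \<open>A path from inside \<open>X\<close> to outside it has a first step that leaves
  \<open>X\<close>. Later arguments use this crossing arc instead of paths.\<close>

lemma conn_cut:
  assumes "conn S" "X \<subseteq> S" "X \<noteq> {}" "X \<noteq> S"
  obtains p q where "(p, q) \<in> arcs" "p \<in> X" "q \<in> S - X"
proof -
  obtain a b where a: "a \<in> X" and b: "b \<in> S" "b \<notin> X"
    using assms by blast
  have "(a, b) \<in> (induced_adj E S)\<^sup>*"
    using assms a b conn_path by blast
  then have "b \<notin> X \<Longrightarrow> \<exists>p q. (p, q) \<in> arcs \<and> p \<in> X \<and> q \<in> S - X"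
  proof (induction rule: rtrancl_induct)
    case base
    then show ?case using a by simp
  next
    case (step y z)
    then show ?case by (cases "y \<in> X") (auto simp: induced_adj_def arcs_def)
  qed
  with b that show ?thesis by blast
qed

text \<open>A vertex set is enlarged one vertex at a time along a crossing arc, and each arc is a
  new edge inside the set. This lets a cost of n * n be charged to the edges.\<close>

lemma n_le_m: "n \<le> m + 1" and m_pos [simp]: "0 < m"
proof -
  have fE: "finite E"
    using presents List.finite_set unfolding presents_def by metis
  have "\<exists>S\<subseteq>V. card S = Suc k \<and> k \<le> card {e \<in> E. e \<subseteq> S}" if "k < n" for k
    using that
  proof (induction k)
    case 0
    obtain r where "r \<in> V" using connected conn_nonempty by blast
    then show ?case by (intro exI[of _ "{r}"]) auto
  next
    case (Suc k)
    then obtain S where S: "S \<subseteq> V" "card S = Suc k" "k \<le> card {e \<in> E. e \<subseteq> S}" by auto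
    then have "S \<noteq> {}" "S \<noteq> V" using Suc.prems by auto
    then obtain p q where pq: "(p, q) \<in> arcs" "p \<in> S" "q \<in> V - S"
      using conn_cut[OF connected S(1)] by metis
    have fin: "finite S" using S(1) finite_V by (rule finite_subset)
    have "{p, q} \<notin> {e \<in> E. e \<subseteq> S}" using pq by auto
    moreover have "insert {p, q} {e \<in> E. e \<subseteq> S} \<subseteq> {e \<in> E. e \<subseteq> insert q S}"
      using pq by (auto simp: arcs_def)
    moreover have "finite {e \<in> E. e \<subseteq> T}" for T
      using fE by simp
    ultimately have "Suc (card {e \<in> E. e \<subseteq> S}) \<le> card {e \<in> E. e \<subseteq> insert q S}"
      using card_mono card_insert_disjoint by metis
    with S(3) have "Suc k \<le> card {e \<in> E. e \<subseteq> insert q S}"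
      by simp
    then show ?case
      using pq S fin by (intro exI[of _ "insert q S"]) auto
  qed
  from this[of "n - 1"] obtain S where "n - 1 \<le> card {e \<in> E. e \<subseteq> S}"
    by auto
  also have "\<dots> \<le> m"
    using fE by (intro card_mono) auto
  finally show "n \<le> m + 1" "0 < m" using card4 by auto
qed

text \<open>As for vertices, the invariant is indexed by what has been seen. One iteration runs the
  body once per orientation; \<open>visit\<close> verifies a single run in front of an arbitrary
  continuation \<open>r\<close>.\<close>

lemma wp_for_arcs:
  assumes "inp s" "0 < F" "writes p \<inter> ({''j'', ''p'', ''q''} \<union> inputs) = {}"
    and init: "I {} s"
    and stable: "\<And>D s a b. I D s \<Longrightarrow> b \<in> {''j'', ''p'', ''q''} \<Longrightarrow> I D (s(b := a))"
    and step: "\<And>D u v s'. D \<subseteq> arcs \<Longrightarrow> (u, v) \<in> arcs \<Longrightarrow> I D s' \<Longrightarrow>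
      s' ''p'' 0 = u \<Longrightarrow> s' ''q'' 0 = v \<Longrightarrow>
      agree ({''j'', ''p'', ''q''} \<union> writes p) s s' \<Longrightarrow> wp F p (I (insert (u, v) D)) s'"
  shows "wp (m * F) (for_arcs p) (I arcs) s"
proof -
  define W where "W = {''j'', ''p'', ''q''} \<union> writes p"
  define J where "J k D s' \<longleftrightarrow> inp s' \<and> agree W s s' \<and> s' ''j'' 0 = k \<and> I D s'" for k D s'
  have inpW: "inp s'" if "agree W s s'" for s'
    using inp_agree[OF that _ assms(1)] assms(3) by (auto simp: W_def)
  \<comment> \<open>The arcs contributed by the first \<open>k\<close> edges, in both directions;
    for \<open>k = m\<close> these are all arcs.\<close>
  define A where "A k = set (take k es) \<union> (set (take k es))\<inverse>" for k
  have visit: "wp F (''p'' ::= Cell a (var ''j'') ;; ''q'' ::= Cell b (var ''j'') ;; p ;; r) Q s1"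
    if J1: "J k D s1" and uv: "(u, v) \<in> arcs" "D \<subseteq> arcs"
      and ab: "\<And>s'. inp s' \<Longrightarrow> s' a k = u \<and> s' b k = v"
      and r: "\<And>s'. J k (insert (u, v) D) s' \<Longrightarrow> wp F r Q s'"
    for k D s1 u v a b r Q
  proof -
    define s2 where "s2 = s1(''p'' := (s1 ''p'')(0 := u))"
    define s3 where "s3 = s2(''q'' := (s2 ''q'')(0 := v))"
    have a2: "agree W s s2" and a3: "agree W s s3"
      using J1 by (auto simp: J_def agree_def s2_def s3_def W_def)
    have "I D s2"
      using J1 stable unfolding J_def s2_def by blast
    then have "I D s3"
      using stable unfolding s3_def by blast
    have j: "s2 ''j'' 0 = k" "s3 ''j'' 0 = k" "s3 ''p'' 0 = u" "s3 ''q'' 0 = v"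
      using J1 by (auto simp: J_def s2_def s3_def)
    have "wp F p (\<lambda>s'. I (insert (u, v) D) s') s3"
      using uv(2,1) \<open>I D s3\<close> j(3,4) a3[unfolded W_def] by (rule step)
    then have 3: "wp F (p ;; r) Q s3"
    proof (rule wp_Seq)
      fix s' assume *: "I (insert (u, v) D) s'" "agree (writes p) s3 s'"
      have "agree W s s'"
        using a3 *(2) by (rule agree_trans) (simp add: W_def)
      moreover have "s' ''j'' 0 = k"
        using j(2) agreeD[OF *(2), of "''j''"] assms(3) by auto
      ultimately show "wp F r Q s'"
        using * inpW by (intro r) (auto simp: J_def)
    qed
    have 2: "wp F (''q'' ::= Cell b (var ''j'') ;; p ;; r) Q s2"
    proof (rule wp_Seq[where R = "\<lambda>s'. s' = s3"])
      show "wp F (''q'' ::= Cell b (var ''j'')) (\<lambda>s'. s' = s3) s2"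
        unfolding assign_def using \<open>0 < F\<close> ab[OF inpW[OF a2]] j
        by (intro wp_Store) (auto simp: s3_def)
    qed (use 3 in simp)
    show ?thesis
    proof (rule wp_Seq[where R = "\<lambda>s'. s' = s2"])
      show "wp F (''p'' ::= Cell a (var ''j'')) (\<lambda>s'. s' = s2) s1"
        unfolding assign_def using \<open>0 < F\<close> ab[of s1] J1
        by (intro wp_Store) (auto simp: s2_def J_def)
    qed (use 2 in simp)
  qed
  have incr: "wp F (''j'' ::= Add (var ''j'') (Const 1)) (J (Suc k) D) s'" if "J k D s'" for k D s'
  proof -
    define s4 where "s4 = s'(''j'' := (s' ''j'')(0 := Suc k))"
    have "agree W s s4" "s4 ''j'' 0 = Suc k"
      using that by (auto simp: J_def agree_def s4_def W_def)
    moreover have "I D s4"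
      using that stable unfolding J_def s4_def by blast
    ultimately have "J (Suc k) D s4"
      using inpW by (simp add: J_def)
    then show ?thesis
      unfolding assign_def using \<open>0 < F\<close> that by (intro wp_Store) (auto simp: s4_def J_def)
  qed
  define K where "K s' \<longleftrightarrow> s' ''j'' 0 \<le> m \<and> J (s' ''j'' 0) (A (s' ''j'' 0)) s'" for s'
  let ?body = "''p'' ::= Cell ''end1'' (var ''j'') ;; ''q'' ::= Cell ''end2'' (var ''j'') ;; p ;;
        ''p'' ::= Cell ''end2'' (var ''j'') ;; ''q'' ::= Cell ''end1'' (var ''j'') ;; p ;;
        ''j'' ::= Add (var ''j'') (Const 1)"
  have loop: "wp (m * F) (While (Less (var ''j'') (var ''m'')) ?body)
      (\<lambda>s'. K s' \<and> \<not> cond_val (Less (var ''j'') (var ''m'')) s') s'"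
    if K: "K s'" for s'
  proof (rule wp_While[where \<mu> = "\<lambda>s. m - s ''j'' 0"])
    fix s1
    assume K1: "K s1" and b: "cond_val (Less (var ''j'') (var ''m'')) s1"
    define k where "k = s1 ''j'' 0"
    have k: "k < m" and J1: "J k (A k) s1"
      using K1 b by (auto simp: K_def J_def inp_def k_def)
    obtain u v where uv: "es ! k = (u, v)"
      by fastforce
    have "(u, v) \<in> set es"
      using k uv length_es by (metis nth_mem)
    then have arc: "(u, v) \<in> arcs" "(v, u) \<in> arcs"
      by (auto simp: arcs_eq)
    have sub: "A k \<subseteq> arcs"
      unfolding arcs_eq A_def by (auto dest: in_set_takeD)
    have Suc: "insert (v, u) (insert (u, v) (A k)) = A (Suc k)"
      using k uv length_es by (auto simp: A_def take_Suc_conv_app_nth)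
    show "wp F ?body (\<lambda>s''. K s'' \<and> m - s'' ''j'' 0 < m - s1 ''j'' 0) s1"
    proof (rule visit[OF J1 arc(1) sub])
      fix s' assume J2: "J k (insert (u, v) (A k)) s'"
      show "wp F (''p'' ::= Cell ''end2'' (var ''j'') ;; ''q'' ::= Cell ''end1'' (var ''j'') ;; p ;;
        ''j'' ::= Add (var ''j'') (Const 1)) (\<lambda>s''. K s'' \<and> m - s'' ''j'' 0 < m - s1 ''j'' 0) s'"
      proof (rule visit[OF J2 arc(2)])
        show "insert (u, v) (A k) \<subseteq> arcs" using sub arc by blast
        fix s' assume "J k (insert (v, u) (insert (u, v) (A k))) s'"
        then have "wp F (''j'' ::= Add (var ''j'') (Const 1)) (J (Suc k) (A (Suc k))) s'"
          unfolding Suc by (rule incr)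
        then show "wp F (''j'' ::= Add (var ''j'') (Const 1))
            (\<lambda>s''. K s'' \<and> m - s'' ''j'' 0 < m - s1 ''j'' 0) s'"
          by (rule wp_weaken[OF _ order_refl]) (use k in \<open>auto simp: K_def J_def k_def[symmetric]\<close>)
      qed (use k uv in \<open>auto simp: inp_def\<close>)
    qed (use k uv in \<open>auto simp: inp_def\<close>)
  qed (use K \<open>0 < F\<close> in auto)
  have "K (s(''j'' := (s ''j'')(0 := 0)))"
  proof -
    have a: "agree W s (s(''j'' := (s ''j'')(0 := 0)))"
      by (auto simp: agree_def W_def)
    then show ?thesis
      using inpW[OF a] init stable by (simp add: K_def J_def A_def)
  qed
  show ?thesis
    unfolding for_arcs_def
  proof (rule wp_Seq[where R = K])
    show "wp (m * F) (''j'' ::= Const 0) K s"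
      unfolding assign_def using \<open>0 < F\<close> \<open>K (s(''j'' := (s ''j'')(0 := 0)))\<close>
      by (intro wp_Store) auto
    fix s' assume "K s'"
    from loop[OF this] show "wp (m * F) (While (Less (var ''j'') (var ''m'')) ?body) (I arcs) s'"
    proof (rule wp_weaken)
      fix s'' assume "K s'' \<and> \<not> cond_val (Less (var ''j'') (var ''m'')) s''"
      then show "I arcs s''"
        using length_es by (auto simp: K_def J_def inp_def A_def arcs_eq)
    qed simp
  qed
qed

text \<open>The guard and the new value may read the updated array at the current vertex: that
  vertex was not visited before, so its entry is still the old one.\<close>

lemma wp_update:
  assumes "inp s" "a \<notin> {''i'', ''v''} \<union> inputs"
    and b: "\<And>y s'. y \<in> V \<Longrightarrow> agree {''i'', ''v'', a} s s' \<Longrightarrow> s' ''v'' 0 = y \<Longrightarrow> s' a y = s a y \<Longrightarrow>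
      cond_val b s' \<longleftrightarrow> B y"
    and e: "\<And>y s'. y \<in> V \<Longrightarrow> agree {''i'', ''v'', a} s s' \<Longrightarrow> s' ''v'' 0 = y \<Longrightarrow> s' a y = s a y \<Longrightarrow>
      B y \<Longrightarrow> expr_val e s' = X y"
  shows "wp n (update a b e) (\<lambda>s'. s' a = (\<lambda>y. if y \<in> V \<and> B y then X y else s a y)) s"
proof -
  let ?I = "\<lambda>D s'. s' a = (\<lambda>y. if y \<in> D \<and> B y then X y else s a y)"
  have "wp (n * 1) (for_vertices ''i'' ''v'' (If b (Store a (var ''v'') e) Skip)) (?I V) s"
  proof (rule wp_for_vertices[where I = ?I])
    fix D y s'
    assume *: "D \<subseteq> V" "y \<in> V" "y \<notin> D" "?I D s'" "s' ''v'' 0 = y"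
      and "agree ({''i'', ''v''} \<union> writes (If b (Store a (var ''v'') e) Skip)) s s'"
    then have ag: "agree {''i'', ''v'', a} s s'" by (simp add: insert_commute)
    have same: "s' a y = s a y" using * by simp
    show "wp 1 (If b (Store a (var ''v'') e) Skip) (?I (insert y D)) s'"
    proof (rule wp_If)
      assume "cond_val b s'"
      then have "B y" using b[OF *(2) ag *(5) same] by simp
      then show "wp 1 (Store a (var ''v'') e) (?I (insert y D)) s'"
        using e[OF *(2) ag *(5) same] * by (intro wp_Store) (auto simp: fun_eq_iff)
    next
      assume "\<not> cond_val b s'"
      then have "\<not> B y" using b[OF *(2) ag *(5) same] by simp
      then show "wp 1 Skip (?I (insert y D)) s'"
        using * by (intro wp_Skip) (auto simp: fun_eq_iff)
    qed simp
  qed (use assms(1,2) in auto)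
  then show ?thesis by (simp add: update_def)
qed

lemma wp_count:
  assumes "inp s" "c \<notin> {''i'', ''v''} \<union> inputs"
    and b: "\<And>y s'. y \<in> V \<Longrightarrow> agree {''i'', ''v'', c} s s' \<Longrightarrow> s' ''v'' 0 = y \<Longrightarrow>
      cond_val b s' \<longleftrightarrow> B y"
  shows "wp n (count c b) (\<lambda>s'. s' c 0 = card {y \<in> V. B y}) s"
  unfolding count_def
proof (rule wp_Seq[OF wp_assign])
  fix s1 assume 1: "s1 c 0 = expr_val (Const 0) s" and ag1: "agree (writes (c ::= Const 0)) s s1"
  have inp1: "inp s1" using inp_agree[OF ag1 _ assms(1)] assms(2) by auto
  let ?I = "\<lambda>D s'. s' c 0 = card {y \<in> D. B y}"
  let ?p = "If b (c ::= Add (var c) (Const 1)) Skip"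
  have "wp (n * 1) (for_vertices ''i'' ''v'' ?p) (?I V) s1"
  proof (rule wp_for_vertices[where I = ?I, OF inp1])
    fix D y s'
    assume *: "D \<subseteq> V" "y \<in> V" "y \<notin> D" "?I D s'" "s' ''v'' 0 = y"
      and ag: "agree ({''i'', ''v''} \<union> writes ?p) s1 s'"
    have ag': "agree {''i'', ''v'', c} s s'"
      by (rule agree_trans[OF ag1 ag]) auto
    have fin: "finite {y \<in> D. B y}"
      using *(1) finite_subset by fastforce
    show "wp 1 ?p (?I (insert y D)) s'"
    proof (rule wp_If)
      assume "cond_val b s'"
      then have "B y" using b[OF *(2) ag' *(5)] by simp
      then have "{z \<in> insert y D. B z} = insert y {z \<in> D. B z}" by auto
      then have "card {z \<in> insert y D. B z} = Suc (card {z \<in> D. B z})"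
        using fin *(3) by simp
      then show "wp 1 (c ::= Add (var c) (Const 1)) (?I (insert y D)) s'"
        using *(4) unfolding assign_def by (intro wp_Store) auto
    next
      assume "\<not> cond_val b s'"
      then have "\<not> B y" using b[OF *(2) ag' *(5)] by simp
      then have "{z \<in> insert y D. B z} = {z \<in> D. B z}" by auto
      then show "wp 1 Skip (?I (insert y D)) s'"
        using *(4) by (intro wp_Skip) auto
    qed simp
  qed (use assms(2) 1 in auto)
  then show "wp n (for_vertices ''i'' ''v'' ?p) (?I V) s1" by simp
qed simp

lemma wp_find_vertex:
  assumes "inp s" "x \<notin> {''i'', ''v''} \<union> inputs"
    and b: "\<And>y s'. y \<in> V \<Longrightarrow> agree {''i'', ''v'', x} s s' \<Longrightarrow> s' ''v'' 0 = y \<Longrightarrow>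
      cond_val b s' \<longleftrightarrow> B y"
    and ex: "\<exists>y\<in>V. B y"
  shows "wp n (find_vertex x b) (\<lambda>s'. s' x 0 \<in> V \<and> B (s' x 0)) s"
proof -
  let ?I = "\<lambda>D s'. (\<exists>y\<in>D. B y) \<longrightarrow> s' x 0 \<in> V \<and> B (s' x 0)"
  let ?p = "If b (x ::= var ''v'') Skip"
  have "wp (n * 1) (for_vertices ''i'' ''v'' ?p) (?I V) s"
  proof (rule wp_for_vertices[where I = ?I])
    fix D y s'
    assume *: "D \<subseteq> V" "y \<in> V" "y \<notin> D" "?I D s'" "s' ''v'' 0 = y"
      and "agree ({''i'', ''v''} \<union> writes ?p) s s'"
    then have ag: "agree {''i'', ''v'', x} s s'" by (simp add: insert_commute)
    show "wp 1 ?p (?I (insert y D)) s'"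
      using b[OF *(2) ag *(5)] * unfolding assign_def
      by (intro wp_If wp_Store wp_Skip) auto
  qed (use assms(1,2) in auto)
  then have "wp n (for_vertices ''i'' ''v'' ?p) (?I V) s" by simp
  then show ?thesis
    unfolding find_vertex_def by (rule wp_weaken) (use ex in auto)
qed

lemma wp_find_arc:
  assumes "inp s"
    and b: "\<And>u v s'. (u, v) \<in> arcs \<Longrightarrow> agree {''j'', ''p'', ''q'', ''f'', ''x'', ''y''} s s' \<Longrightarrow>
      s' ''p'' 0 = u \<Longrightarrow> s' ''q'' 0 = v \<Longrightarrow> cond_val b s' \<longleftrightarrow> B u v"
  shows "wp m (find_arc b) (\<lambda>s'.
    if s' ''f'' 0 = 1 then (s' ''x'' 0, s' ''y'' 0) \<in> arcs \<and> B (s' ''x'' 0) (s' ''y'' 0)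
    else s' ''f'' 0 = 0 \<and> (\<forall>u v. (u, v) \<in> arcs \<longrightarrow> \<not> B u v)) s"
  unfolding find_arc_def
proof (rule wp_Seq[OF wp_assign])
  fix s1 assume 1: "s1 ''f'' 0 = expr_val (Const 0) s" and ag1: "agree (writes (''f'' ::= Const 0)) s s1"
  have inp1: "inp s1" using inp_agree[OF ag1 _ assms(1)] by simp
  let ?I = "\<lambda>D s'. if s' ''f'' 0 = 1 then (s' ''x'' 0, s' ''y'' 0) \<in> arcs \<and> B (s' ''x'' 0) (s' ''y'' 0)
    else s' ''f'' 0 = 0 \<and> (\<forall>u v. (u, v) \<in> D \<longrightarrow> \<not> B u v)"
  let ?p = "If b (''f'' ::= Const 1 ;; ''x'' ::= var ''p'' ;; ''y'' ::= var ''q'') Skip"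
  have "wp (m * 1) (for_arcs ?p) (?I arcs) s1"
  proof (rule wp_for_arcs[where I = ?I, OF inp1])
    fix D u v s'
    assume *: "(u, v) \<in> arcs" "?I D s'" "s' ''p'' 0 = u" "s' ''q'' 0 = v"
      and ag: "agree ({''j'', ''p'', ''q''} \<union> writes ?p) s1 s'"
    have ag': "agree {''j'', ''p'', ''q'', ''f'', ''x'', ''y''} s s'"
      by (rule agree_trans[OF ag1 ag]) auto
    show "wp 1 ?p (?I (insert (u, v) D)) s'"
    proof (rule wp_If)
      assume "cond_val b s'"
      then have B: "B u v" using b[OF *(1) ag' *(3,4)] by simp
      show "wp 1 (''f'' ::= Const 1 ;; ''x'' ::= var ''p'' ;; ''y'' ::= var ''q'')
          (?I (insert (u, v) D)) s'"
      proof (rule wp_Seq[OF wp_assign])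
        fix s2 assume 2: "s2 ''f'' 0 = expr_val (Const 1) s'" "agree (writes (''f'' ::= Const 1)) s' s2"
        show "wp 1 (''x'' ::= var ''p'' ;; ''y'' ::= var ''q'') (?I (insert (u, v) D)) s2"
        proof (rule wp_Seq[OF wp_assign])
          fix s3 assume 3: "s3 ''x'' 0 = expr_val (var ''p'') s2" "agree (writes (''x'' ::= var ''p'')) s2 s3"
          show "wp 1 (''y'' ::= var ''q'') (?I (insert (u, v) D)) s3"
            unfolding assign_def using 2 3 * B
            by (intro wp_Store) (auto simp: agree_def)
        qed simp
      qed simp
    next
      assume "\<not> cond_val b s'"
      then have "\<not> B u v" using b[OF *(1) ag' *(3,4)] by simp
      then show "wp 1 Skip (?I (insert (u, v) D)) s'"
        using *(2) by (intro wp_Skip) auto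
    qed simp
  qed (use 1 in auto)
  then show "wp m (for_arcs ?p) (?I arcs) s1" by simp
qed simp

end

text \<open>Components by relabelling: every vertex starts with its own label, and an arc inside a
  positive class renames the label of \<open>q\<close> to that of \<open>p\<close> everywhere. Both
  labels are saved first because the renaming overwrites \<open>pc\<close>. The guard comparing 0
  with 1 is the constant truth.\<close>

definition comps :: prog where
  "comps = update ''pc'' (Less (Const 0) (Const 1)) (var ''v'') ;;
     for_arcs (If (Conj (Less (Const 0) (Cell ''cls'' (var ''p'')))
         (eq (Cell ''cls'' (var ''p'')) (Cell ''cls'' (var ''q''))))
       (''a'' ::= Cell ''pc'' (var ''p'') ;; ''b'' ::= Cell ''pc'' (var ''q'') ;;
        update ''pc'' (eq (Cell ''pc'' (var ''v'')) (var ''b'')) (var ''a'')) Skip)"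

lemma writes_comps [simp]:
  "writes comps = {''i'', ''v'', ''j'', ''p'', ''q'', ''a'', ''b'', ''pc''}"
  by (auto simp: comps_def)

text \<open>An undirected edge added to a symmetric relation merges exactly the classes of its two
  ends. This is the effect of one renaming in \<open>comps\<close>.\<close>

lemma rtrancl_insert_sym:
  assumes "sym R"
  shows "(u, v) \<in> (insert (p, q) (insert (q, p) R))\<^sup>* \<longleftrightarrow> (u, v) \<in> R\<^sup>* \<or>
    ((u, p) \<in> R\<^sup>* \<or> (u, q) \<in> R\<^sup>*) \<and> ((v, p) \<in> R\<^sup>* \<or> (v, q) \<in> R\<^sup>*)"
    (is "_ \<in> ?S\<^sup>* \<longleftrightarrow> ?rhs u v")
proof
  have sym: "(y, x) \<in> R\<^sup>*" if "(x, y) \<in> R\<^sup>*" for x y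
    using that assms sym_rtrancl symD by metis
  show "?rhs u v" if "(u, v) \<in> ?S\<^sup>*"
    using that
  proof (induction rule: rtrancl_induct)
    case (step y z)
    consider "(y, z) = (p, q)" | "(y, z) = (q, p)" | "(y, z) \<in> R"
      using step.hyps(2) by blast
    then show ?case
    proof cases
      case 3
      then have "(y, z) \<in> R\<^sup>*" "(z, y) \<in> R\<^sup>*" using sym by blast+
      then show ?thesis using step.IH by (meson rtrancl_trans)
    qed (use step.IH sym in auto)
  qed simp
  have "R\<^sup>* \<subseteq> ?S\<^sup>*" by (rule rtrancl_mono) auto
  moreover have "sym ?S" using assms by (auto simp: sym_def)
  then have "(y, x) \<in> ?S\<^sup>*" if "(x, y) \<in> ?S\<^sup>*" for x y
    using that sym_rtrancl symD by metis
  moreover have "(p, q) \<in> ?S\<^sup>*" "(q, p) \<in> ?S\<^sup>*" by auto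
  ultimately show "(u, v) \<in> ?S\<^sup>*" if "?rhs u v"
    using that by (meson rtrancl_trans subsetD)
qed

context graph_input begin

section \<open>Monochromatic components\<close>

definition same_class :: "(nat \<Rightarrow> nat) \<Rightarrow> (nat \<times> nat) set" where
  "same_class f = {(u, v). (u, v) \<in> arcs \<and> f u = f v \<and> 0 < f u}"

text \<open>A vertex of class 0 is a piece of its own.\<close>

definition is_pieces :: "(nat \<Rightarrow> nat) \<Rightarrow> (nat \<Rightarrow> nat) \<Rightarrow> bool" where
  "is_pieces f c \<longleftrightarrow> (\<forall>u\<in>V. \<forall>v\<in>V. c u = c v \<longleftrightarrow> (u, v) \<in> (same_class f)\<^sup>*)"

definition piece :: "(nat \<Rightarrow> nat) \<Rightarrow> nat \<Rightarrow> nat set" where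
  "piece c y = {v \<in> V. c v = c y}"

lemma piece_subset: "piece c y \<subseteq> V"
  by (auto simp: piece_def)

lemma finite_piece [simp]: "finite (piece c y)"
  by (simp add: piece_def)

lemma piece_refl: "y \<in> V \<Longrightarrow> y \<in> piece c y"
  by (simp add: piece_def)

lemma piece_eq: "z \<in> piece c y \<Longrightarrow> piece c z = piece c y"
  by (auto simp: piece_def)

lemma piece_path:
  assumes "is_pieces f c" "u \<in> piece c y" "v \<in> piece c y"
  shows "(u, v) \<in> (same_class f)\<^sup>*"
proof -
  have "c u = c v" "u \<in> V" "v \<in> V" using assms(2,3) by (auto simp: piece_def)
  then show ?thesis using assms(1) unfolding is_pieces_def by blast
qed

lemma piece_class:
  assumes "is_pieces f c" "y \<in> V" "v \<in> piece c y"
  shows "f v = f y"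
proof -
  have "(y, v) \<in> (same_class f)\<^sup>*"
    using assms(1) piece_refl[OF assms(2)] assms(3) by (rule piece_path)
  then show ?thesis
    by (induction rule: rtrancl_induct) (auto simp: same_class_def)
qed

lemma piece_step:
  assumes "is_pieces f c" "u \<in> piece c y" "(u, w) \<in> arcs" "f w = f u" "0 < f u"
  shows "w \<in> piece c y"
proof -
  have "w \<in> V" "u \<in> V" using arcs_V assms(3) by auto
  moreover have "(u, w) \<in> (same_class f)\<^sup>*"
    using assms by (auto simp: same_class_def)
  ultimately have "c u = c w" using assms(1) unfolding is_pieces_def by blast
  then show ?thesis using \<open>w \<in> V\<close> assms(2) by (simp add: piece_def)
qed

lemma piece_conn:
  assumes "is_pieces f c" "y \<in> V"
  shows "conn (piece c y)"
proof -
  have "(u, v) \<in> (induced_adj E (piece c y))\<^sup>*" if "u \<in> piece c y" "v \<in> piece c y" for u v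
  proof -
    have "(u, v) \<in> (same_class f)\<^sup>*"
      using assms(1) that by (rule piece_path)
    then have "(u, v) \<in> (induced_adj E (piece c y))\<^sup>* \<and> v \<in> piece c y"
    proof (induction rule: rtrancl_induct)
      case (step v w)
      then have "w \<in> piece c y"
        using piece_step[OF assms(1)] by (auto simp: same_class_def)
      moreover from this step have "(v, w) \<in> induced_adj E (piece c y)"
        by (auto simp: same_class_def arcs_def induced_adj_def)
      ultimately show ?case
        using step.IH by (meson rtrancl.rtrancl_into_rtrancl)
    qed (use that in simp)
    then show ?thesis ..
  qed
  then show ?thesis
    using piece_refl[OF assms(2)] by (auto simp: induced_connected_def)
qed

text \<open>Otherwise an arc leads from \<open>Z \<inter> piece c y\<close> to the rest of
  \<open>Z\<close>. Both ends have the positive class \<open>k\<close>, so \<open>piece_step\<close>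
  puts the second one into the piece as well.\<close>

lemma piece_max:
  assumes "is_pieces f c" "conn Z" "Z \<subseteq> V" "y \<in> Z" "\<And>z. z \<in> Z \<Longrightarrow> f z = k" "0 < k"
  shows "Z \<subseteq> piece c y"
proof (rule ccontr)
  assume "\<not> Z \<subseteq> piece c y"
  moreover have "y \<in> piece c y" using assms piece_refl by blast
  ultimately obtain p q where "(p, q) \<in> arcs" "p \<in> Z \<inter> piece c y" "q \<in> Z - Z \<inter> piece c y"
    using conn_cut[OF assms(2), of "Z \<inter> piece c y"] assms(4) by blast
  then show False
    using piece_step[OF assms(1), of p y q] assms(5,6) by auto
qed

lemma piece_zero:
  assumes "is_pieces f c" "y \<in> V" "f y = 0"
  shows "piece c y = {y}"
proof -
  have "v = y" if "v \<in> piece c y" for v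
  proof -
    have "(y, v) \<in> (same_class f)\<^sup>*"
      using assms(1) piece_refl[OF assms(2)] that by (rule piece_path)
    then show ?thesis
      using assms(3) by (induction rule: rtrancl_induct) (auto simp: same_class_def)
  qed
  then show ?thesis using piece_refl[OF assms(2)] by blast
qed

lemma wp_comps:
  assumes "inp s"
  shows "wp (n * m) comps (\<lambda>s'. is_pieces (s ''cls'') (s' ''pc'')) s"
proof -
  define f where "f = s ''cls''"
  \<comment> \<open>Symmetrised, so that an edge counts as soon as one of its orientations was
    processed; the merging lemma needs a symmetric relation.\<close>
  define R where "R D = same_class f \<inter> (D \<union> D\<inverse>)" for D
  have sym_R: "sym (R D)" for D
    using arcs_sym by (auto simp: R_def sym_def same_class_def)
  let ?I = "\<lambda>D s'. \<forall>u\<in>V. \<forall>v\<in>V. s' ''pc'' u = s' ''pc'' v \<longleftrightarrow> (u, v) \<in> (R D)\<^sup>*"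
  let ?b = "Conj (Less (Const 0) (Cell ''cls'' (var ''p'')))
         (eq (Cell ''cls'' (var ''p'')) (Cell ''cls'' (var ''q'')))"
  let ?p = "''a'' ::= Cell ''pc'' (var ''p'') ;; ''b'' ::= Cell ''pc'' (var ''q'') ;;
        update ''pc'' (eq (Cell ''pc'' (var ''v'')) (var ''b'')) (var ''a'')"
  show ?thesis
    unfolding comps_def
  proof (rule wp_Seq[OF wp_weaken])
    show "wp n (update ''pc'' (Less (Const 0) (Const 1)) (var ''v''))
       (\<lambda>s'. s' ''pc'' = (\<lambda>y. if y \<in> V \<and> True then y else s ''pc'' y)) s"
      by (rule wp_update[OF assms(1)]) auto
    show "n \<le> n * m" by (simp add: Suc_leI)
    fix s1
    assume pc1: "s1 ''pc'' = (\<lambda>y. if y \<in> V \<and> True then y else s ''pc'' y)"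
      and ag1: "agree (writes (update ''pc'' (Less (Const 0) (Const 1)) (var ''v''))) s s1"
    have inp1: "inp s1" using inp_agree[OF ag1 _ assms(1)] by simp
    have "wp (m * n) (for_arcs (If ?b ?p Skip)) (?I arcs) s1"
    proof (rule wp_for_arcs[where I = ?I, OF inp1])
      fix D u v s2
      assume D: "D \<subseteq> arcs" and uv: "(u, v) \<in> arcs" and I2: "?I D s2"
        and p: "s2 ''p'' 0 = u" "s2 ''q'' 0 = v"
        and ag2: "agree ({''j'', ''p'', ''q''} \<union> writes (If ?b ?p Skip)) s1 s2"
      have V: "u \<in> V" "v \<in> V" using arcs_V uv by auto
      have cls: "s2 ''cls'' = f"
        using agreeD[OF ag1, of "''cls''"] agreeD[OF ag2, of "''cls''"] by (simp add: f_def)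
      have inp2: "inp s2" using inp_agree[OF ag2 _ inp1] by simp
      show "wp n (If ?b ?p Skip) (?I (insert (u, v) D)) s2"
      proof (rule wp_If)
        assume "cond_val ?b s2"
        then have "f u = f v" "0 < f u" using p cls by simp_all
        then have "(u, v) \<in> same_class f" "(v, u) \<in> same_class f"
          using uv arcs_sym by (auto simp: same_class_def)
        then have R: "R (insert (u, v) D) = insert (u, v) (insert (v, u) (R D))"
          by (auto simp: R_def)
        show "wp n ?p (?I (insert (u, v) D)) s2"
        proof (rule wp_Seq[OF wp_assign])
          fix s3
          assume 3: "s3 ''a'' 0 = expr_val (Cell ''pc'' (var ''p'')) s2"
            "agree (writes (''a'' ::= Cell ''pc'' (var ''p''))) s2 s3"
          have inp3: "inp s3" using inp_agree[OF 3(2) _ inp2] by simp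
          show "wp n (''b'' ::= Cell ''pc'' (var ''q'') ;;
              update ''pc'' (eq (Cell ''pc'' (var ''v'')) (var ''b'')) (var ''a''))
              (?I (insert (u, v) D)) s3"
          proof (rule wp_Seq[OF wp_assign])
            fix s4
            assume 4: "s4 ''b'' 0 = expr_val (Cell ''pc'' (var ''q'')) s3"
              "agree (writes (''b'' ::= Cell ''pc'' (var ''q''))) s3 s4"
            have inp4: "inp s4" using inp_agree[OF 4(2) _ inp3] by simp
            have vals: "s4 ''pc'' = s2 ''pc''" "s4 ''a'' 0 = s2 ''pc'' u" "s4 ''b'' 0 = s2 ''pc'' v"
              using 3 4 p by (auto simp: agree_def)
            have "wp n (update ''pc'' (eq (Cell ''pc'' (var ''v'')) (var ''b'')) (var ''a''))
               (\<lambda>s'. s' ''pc'' = (\<lambda>y. if y \<in> V \<and> s2 ''pc'' y = s2 ''pc'' v then s2 ''pc'' u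
                 else s4 ''pc'' y)) s4"
              by (rule wp_update[OF inp4]) (auto simp: agree_def vals)
            then show "wp n (update ''pc'' (eq (Cell ''pc'' (var ''v'')) (var ''b'')) (var ''a''))
               (?I (insert (u, v) D)) s4"
            proof (rule wp_weaken[OF _ order_refl], intro ballI)
              fix s5 x y
              assume pc: "s5 ''pc'' = (\<lambda>y. if y \<in> V \<and> s2 ''pc'' y = s2 ''pc'' v then s2 ''pc'' u
                 else s4 ''pc'' y)" and xy: "x \<in> V" "y \<in> V"
              show "s5 ''pc'' x = s5 ''pc'' y \<longleftrightarrow> (x, y) \<in> (R (insert (u, v) D))\<^sup>*"
              proof -
                have "(a, b) \<in> (R D)\<^sup>* \<longleftrightarrow> s2 ''pc'' a = s2 ''pc'' b" if "a \<in> V" "b \<in> V" for a b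
                  using I2 that by blast
                then show ?thesis
                  unfolding R rtrancl_insert_sym[OF sym_R] using xy V by (auto simp: pc vals)
              qed
            qed
          qed simp
        qed simp
      next
        assume "\<not> cond_val ?b s2"
        then have "(u, v) \<notin> same_class f" "(v, u) \<notin> same_class f"
          using p cls by (auto simp: same_class_def)
        then have "R (insert (u, v) D) = R D" by (auto simp: R_def)
        then show "wp n Skip (?I (insert (u, v) D)) s2"
          using I2 by (intro wp_Skip) auto
      qed simp
    qed (use pc1 in \<open>auto simp: R_def\<close>)
    then have "wp (n * m) (for_arcs (If ?b ?p Skip)) (?I arcs) s1"
      by (simp add: mult.commute)
    moreover have "R arcs = same_class f"
      by (auto simp: R_def same_class_def)
    ultimately show "wp (n * m) (for_arcs (If ?b ?p Skip))
        (\<lambda>s'. is_pieces (s ''cls'') (s' ''pc'')) s1"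
      by (simp add: is_pieces_def f_def)
  qed
qed

end

section \<open>Growing unions of pieces\<close>

text \<open>Only pieces of class 1 compete, and \<open>bs = 0\<close> reports that there is none.
  Counting anew for every vertex costs n * n, which is affordable because n \<le> m + 1.\<close>

definition best :: prog where
  "best = ''bs'' ::= Const 0 ;;
     for_vertices ''i2'' ''v2'' (If (eq (Cell ''cls'' (var ''v2'')) (Const 1))
       (count ''c'' (eq (Cell ''pc'' (var ''v'')) (Cell ''pc'' (var ''v2''))) ;;
        If (Less (var ''bs'') (var ''c'')) (''bs'' ::= var ''c'' ;; ''by'' ::= var ''v2'') Skip) Skip)"

lemma writes_best [simp]:
  "writes best = {''i'', ''v'', ''c'', ''i2'', ''v2'', ''bs'', ''by''}"
  by (auto simp: best_def)

text \<open>The set \<open>X\<close> is always a union of whole pieces, and \<open>e\<close>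
  remembers a vertex of the piece added last. The vertex loop bounds the number of extensions: each
  one enlarges \<open>X\<close>, so n rounds end with \<open>th\<close> reached or with no neighbour
  of positive class left.\<close>

definition grow :: prog where
  "grow = update ''X'' (Less (Const 0) (Const 1)) (Const 0) ;;
     update ''X'' (eq (Cell ''pc'' (var ''v'')) (Cell ''pc'' (var ''v3''))) (Const 1) ;;
     ''e'' ::= var ''v3'' ;;
     count ''c'' (eq (Cell ''X'' (var ''v'')) (Const 1)) ;;
     for_vertices ''i2'' ''v2'' (If (Less (var ''c'') (var ''th''))
       (find_arc (Conj (eq (Cell ''X'' (var ''p'')) (Const 1))
          (Conj (eq (Cell ''X'' (var ''q'')) (Const 0)) (Less (Const 0) (Cell ''cls'' (var ''q''))))) ;;
        If (eq (var ''f'') (Const 1))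
          (''e'' ::= var ''y'' ;;
           update ''X'' (eq (Cell ''pc'' (var ''v'')) (Cell ''pc'' (var ''y''))) (Const 1) ;;
           count ''c'' (eq (Cell ''X'' (var ''v'')) (Const 1))) Skip) Skip)"

lemma writes_grow [simp]:
  "writes grow = {''i'', ''v'', ''i2'', ''v2'', ''j'', ''p'', ''q'', ''f'', ''x'', ''y'',
     ''X'', ''e'', ''c''}"
  by (auto simp: grow_def)

context graph_input begin

lemma wp_best:
  assumes "inp s"
  shows "wp (n * n) best (\<lambda>s'.
    (\<forall>y\<in>V. s ''cls'' y = 1 \<longrightarrow> card (piece (s ''pc'') y) \<le> s' ''bs'' 0) \<and>
    (s' ''bs'' 0 = 0 \<or> s' ''by'' 0 \<in> V \<and> s ''cls'' (s' ''by'' 0) = 1 \<and>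
      s' ''bs'' 0 = card (piece (s ''pc'') (s' ''by'' 0)))) s"
proof -
  define w where "w y = card (piece (s ''pc'') y)" for y
  let ?s1 = "s(''bs'' := (s ''bs'')(0 := expr_val (Const 0) s))"
  have ag1: "agree {''bs''} s ?s1" by (simp add: agree_def)
  have inp1: "inp ?s1" using inp_agree[OF ag1 _ assms] by simp
  let ?I = "\<lambda>D s'. (\<forall>y\<in>D. s ''cls'' y = 1 \<longrightarrow> card (piece (s ''pc'') y) \<le> s' ''bs'' 0) \<and>
    (s' ''bs'' 0 = 0 \<or> s' ''by'' 0 \<in> V \<and> s ''cls'' (s' ''by'' 0) = 1 \<and>
      s' ''bs'' 0 = card (piece (s ''pc'') (s' ''by'' 0)))"
  let ?q = "If (Less (var ''bs'') (var ''c'')) (''bs'' ::= var ''c'' ;; ''by'' ::= var ''v2'') Skip"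
  let ?p = "If (eq (Cell ''cls'' (var ''v2'')) (Const 1))
       (count ''c'' (eq (Cell ''pc'' (var ''v'')) (Cell ''pc'' (var ''v2''))) ;; ?q) Skip"
  have "wp (n * n) (for_vertices ''i2'' ''v2'' ?p) (?I V) ?s1"
  proof (rule wp_for_vertices[where I = ?I, OF inp1])
    fix D y s'
    assume y: "y \<in> V" and I: "?I D s'" and v2: "s' ''v2'' 0 = y"
      and ag2: "agree ({''i2'', ''v2''} \<union> writes ?p) ?s1 s'"
    have inp2: "inp s'" using inp_agree[OF ag2 _ inp1] by simp
    have cls: "s' ''cls'' = s ''cls''" "s' ''pc'' = s ''pc''"
      using ag2 by (auto simp: agree_def)
    show "wp n ?p (?I (insert y D)) s'"
    proof (rule wp_If)
      assume "cond_val (eq (Cell ''cls'' (var ''v2'')) (Const 1)) s'"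
      then have "s ''cls'' y = 1" using v2 cls by simp
      have "wp n (count ''c'' (eq (Cell ''pc'' (var ''v'')) (Cell ''pc'' (var ''v2''))))
          (\<lambda>s''. s'' ''c'' 0 = card {v \<in> V. s ''pc'' v = s ''pc'' y}) s'"
        by (rule wp_count[OF inp2]) (auto simp: agree_def cls v2)
      then show "wp n (count ''c'' (eq (Cell ''pc'' (var ''v'')) (Cell ''pc'' (var ''v2''))) ;; ?q)
          (?I (insert y D)) s'"
      proof (rule wp_Seq)
        fix s3
        assume c: "s3 ''c'' 0 = card {v \<in> V. s ''pc'' v = s ''pc'' y}"
          and ag3: "agree (writes (count ''c'' (eq (Cell ''pc'' (var ''v'')) (Cell ''pc'' (var ''v2''))))) s' s3"
        have "s3 ''bs'' = s' ''bs''" "s3 ''by'' = s' ''by''" "s3 ''v2'' = s' ''v2''"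
          using ag3 by (auto simp: agree_def)
        moreover have "s3 ''c'' 0 = w y" using c by (simp add: w_def piece_def)
        ultimately show "wp n ?q (?I (insert y D)) s3"
          using I v2 y \<open>s ''cls'' y = 1\<close> unfolding w_def[symmetric]
          by (intro wp_If wp_assign_seq wp_assign' wp_Skip) auto
      qed
    next
      assume "\<not> cond_val (eq (Cell ''cls'' (var ''v2'')) (Const 1)) s'"
      then show "wp n Skip (?I (insert y D)) s'"
        using I v2 cls by (intro wp_Skip) auto
    qed simp
  qed auto
  then show ?thesis
    unfolding best_def by (intro wp_assign_seq) auto
qed

definition closed_in :: "(nat \<Rightarrow> nat) \<Rightarrow> nat set \<Rightarrow> bool" where
  "closed_in f X \<longleftrightarrow> (\<forall>p q. (p, q) \<in> arcs \<longrightarrow> p \<in> X \<longrightarrow> q \<notin> X \<longrightarrow> f q = 0)"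

text \<open>Dropping the piece added last leaves the previous stage, which is connected and still
  below \<theta>. This controls how far the final set can overshoot.\<close>

definition growth :: "(nat \<Rightarrow> nat) \<Rightarrow> (nat \<Rightarrow> nat) \<Rightarrow> nat \<Rightarrow> nat set \<Rightarrow> nat \<Rightarrow> bool" where
  "growth f c \<theta> X e \<longleftrightarrow> X \<subseteq> {v \<in> V. 0 < f v} \<and> conn X \<and> (\<forall>x\<in>X. piece c x \<subseteq> X) \<and> e \<in> X \<and>
     card (X - piece c e) < \<theta> \<and> (X - piece c e = {} \<or> conn (X - piece c e))"

lemma growth_start:
  assumes "is_pieces f c" "y \<in> V" "0 < f y" "0 < \<theta>"
  shows "growth f c \<theta> (piece c y) y"
proof -
  have "piece c y \<subseteq> {v \<in> V. 0 < f v}"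
    using piece_class[OF assms(1,2)] assms(3) piece_subset by auto
  then show ?thesis
    using piece_conn[OF assms(1,2)] piece_refl[OF assms(2)] piece_eq assms(4)
    unfolding growth_def by auto
qed

text \<open>Since \<open>X\<close> consists of whole pieces, the piece of a vertex outside is
  disjoint from \<open>X\<close>; removing it again gives back exactly \<open>X\<close>.\<close>

lemma growth_step:
  assumes "is_pieces f c" "growth f c \<theta> X e" "card X < \<theta>" "(p, q) \<in> arcs" "p \<in> X" "q \<notin> X" "0 < f q"
  shows "growth f c \<theta> (X \<union> piece c q) q" "card X < card (X \<union> piece c q)"
proof -
  have X: "X \<subseteq> {v \<in> V. 0 < f v}" "conn X" "\<And>x. x \<in> X \<Longrightarrow> piece c x \<subseteq> X"
    using assms(2) by (auto simp: growth_def)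
  have q: "q \<in> V" using arcs_V assms(4) by blast
  note Q = piece_refl[OF q, of c] piece_conn[OF assms(1) q]
  have "x \<notin> X" if "x \<in> piece c q" for x
    using X(3)[of x] piece_eq[OF that] Q(1) assms(6) by blast
  then have diff: "X \<union> piece c q - piece c q = X" by blast
  have "conn (X \<union> piece c q)"
    using X(2) Q(2) assms(4,5) Q(1) by (rule conn_Un_arc)
  moreover have "piece c q \<subseteq> {v \<in> V. 0 < f v}"
    using piece_class[OF assms(1) q] assms(7) piece_subset by auto
  moreover have "piece c x \<subseteq> X \<union> piece c q" if "x \<in> X \<union> piece c q" for x
    using that X(3) piece_eq by blast
  ultimately show "growth f c \<theta> (X \<union> piece c q) q"
    unfolding growth_def diff using X Q(1) assms(3) by simp
  have "finite X"
    using X(1) by (auto intro: finite_subset[of _ V])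
  then show "card X < card (X \<union> piece c q)"
    using assms(6) Q(1) by (intro psubset_card_mono) auto
qed

text \<open>A growth that gets stuck has swallowed everything of positive class reachable from
  \<open>y\<close>. Its size therefore bounds every connected set of positive class through
  \<open>y\<close>.\<close>

lemma closed_in_bound:
  assumes "closed_in f X" "X \<subseteq> V" "card X < \<theta>" "y \<in> X" "conn Z" "y \<in> Z" "\<And>z. z \<in> Z \<Longrightarrow> 0 < f z"
  shows "card Z < \<theta>"
proof -
  have "Z \<inter> X = Z"
  proof (rule ccontr)
    assume "Z \<inter> X \<noteq> Z"
    then obtain p q where "(p, q) \<in> arcs" "p \<in> Z \<inter> X" "q \<in> Z - Z \<inter> X"
      using conn_cut[OF assms(5), of "Z \<inter> X"] assms(4,6) by blast
    then show False using assms(1,7) by (fastforce simp: closed_in_def)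
  qed
  then have "card Z \<le> card X"
    using finite_subset[OF assms(2)] by (intro card_mono) auto
  then show ?thesis using assms(3) by simp
qed

definition indicates :: "(nat \<Rightarrow> nat) \<Rightarrow> nat set \<Rightarrow> bool" where
  "indicates h X \<longleftrightarrow> (\<forall>v\<in>V. h v = (if v \<in> X then 1 else 0))"

lemma indicatesD: "indicates h X \<Longrightarrow> v \<in> V \<Longrightarrow> h v = (if v \<in> X then 1 else 0)"
  by (simp add: indicates_def)

lemma card_indicates: "indicates h X \<Longrightarrow> X \<subseteq> V \<Longrightarrow> card {v \<in> V. h v = 1} = card X"
  by (rule arg_cong[of _ _ card]) (auto simp: indicates_def split: if_splits)

text \<open>Progress is measured by size: as long as \<open>X\<close> is neither large nor closed,
  it has more vertices than rounds were spent, and this is impossible after n rounds.\<close>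

lemma wp_grow:
  assumes "inp s" and pieces: "is_pieces (s ''cls'') (s ''pc'')"
    and y0: "s ''v3'' 0 = y0" "y0 \<in> V" "0 < s ''cls'' y0" and th: "s ''th'' 0 = \<theta>" "0 < \<theta>"
  shows "wp (n * (m + 1)) grow (\<lambda>s'. \<exists>X. growth (s ''cls'') (s ''pc'') \<theta> X (s' ''e'' 0) \<and>
    indicates (s' ''X'') X \<and> s' ''c'' 0 = card X \<and> y0 \<in> X \<and>
    (card X < \<theta> \<longrightarrow> closed_in (s ''cls'') X)) s"
    (is "wp _ _ ?R s")
proof -
  define f c where "f = s ''cls''" "c = s ''pc''"
  have pcs: "is_pieces f c" using pieces by (simp add: f_c_def)
  let ?J = "\<lambda>X s'. growth f c \<theta> X (s' ''e'' 0) \<and> indicates (s' ''X'') X \<and>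
    s' ''c'' 0 = card X \<and> y0 \<in> X"
  let ?I = "\<lambda>D s'. \<exists>X. ?J X s' \<and> (card X < \<theta> \<longrightarrow> closed_in f X \<or> card D < card X)"
  let ?cnt = "count ''c'' (eq (Cell ''X'' (var ''v'')) (Const 1))"
  let ?b = "Conj (eq (Cell ''X'' (var ''p'')) (Const 1))
          (Conj (eq (Cell ''X'' (var ''q'')) (Const 0)) (Less (Const 0) (Cell ''cls'' (var ''q''))))"
  let ?up = "update ''X'' (eq (Cell ''pc'' (var ''v'')) (Cell ''pc'' (var ''y''))) (Const 1)"
  let ?add = "''e'' ::= var ''y'' ;; ?up ;; ?cnt"
  let ?p = "If (Less (var ''c'') (var ''th'')) (find_arc ?b ;; If (eq (var ''f'') (Const 1)) ?add Skip) Skip"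
  have nF: "n \<le> n * (m + 1)" by simp
  have cnt: "wp n ?cnt (?J X) s'"
    if "inp s'" "growth f c \<theta> X (s' ''e'' 0)" "indicates (s' ''X'') X" "y0 \<in> X" for X s'
  proof -
    have "wp n ?cnt (\<lambda>s''. s'' ''c'' 0 = card {v \<in> V. s' ''X'' v = 1}) s'"
      by (rule wp_count[OF that(1)]) (auto simp: agree_def)
    then show ?thesis
    proof (rule wp_weaken[OF _ order_refl])
      fix s'' assume "s'' ''c'' 0 = card {v \<in> V. s' ''X'' v = 1}" "agree (writes ?cnt) s' s''"
      moreover have "X \<subseteq> V" using that by (auto simp: growth_def)
      ultimately show "?J X s''"
        using that card_indicates[OF that(3)] by (auto simp: agree_def)
    qed
  qed
  have body: "wp (m + 1) ?p (?I (insert x D)) s'"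
    if h: "inp s'" "D \<subseteq> V" "x \<notin> D" "?I D s'" and same: "s' ''cls'' = f" "s' ''pc'' = c" "s' ''th'' 0 = \<theta>"
    for x D s'
  proof -
    obtain X where X: "?J X s'" "card X < \<theta> \<longrightarrow> closed_in f X \<or> card D < card X"
      using h(4) by blast
    have XV: "X \<subseteq> V" using X(1) by (auto simp: growth_def)
    have card_D: "card (insert x D) = Suc (card D)"
      using h(2,3) finite_subset[OF h(2)] by simp
    show ?thesis
    proof (rule wp_If)
      assume "cond_val (Less (var ''c'') (var ''th'')) s'"
      then have small: "card X < \<theta>" using X same by simp
      have "wp m (find_arc ?b) (\<lambda>s''. if s'' ''f'' 0 = 1
          then (s'' ''x'' 0, s'' ''y'' 0) \<in> arcs \<and> s'' ''x'' 0 \<in> X \<and> s'' ''y'' 0 \<notin> X \<and> 0 < f (s'' ''y'' 0)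
          else s'' ''f'' 0 = 0 \<and> (\<forall>u v. (u, v) \<in> arcs \<longrightarrow> \<not> (u \<in> X \<and> v \<notin> X \<and> 0 < f v))) s'"
        using X(1) arcs_V by (intro wp_find_arc[OF h(1)]) (auto simp: agree_def indicates_def same)
      then show "wp (m + 1) (find_arc ?b ;; If (eq (var ''f'') (Const 1)) ?add Skip) (?I (insert x D)) s'"
      proof (rule wp_Seq[OF wp_weaken])
        fix s2
        assume 2: "if s2 ''f'' 0 = 1
          then (s2 ''x'' 0, s2 ''y'' 0) \<in> arcs \<and> s2 ''x'' 0 \<in> X \<and> s2 ''y'' 0 \<notin> X \<and> 0 < f (s2 ''y'' 0)
          else s2 ''f'' 0 = 0 \<and> (\<forall>u v. (u, v) \<in> arcs \<longrightarrow> \<not> (u \<in> X \<and> v \<notin> X \<and> 0 < f v))"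
          and ag2: "agree (writes (find_arc ?b)) s' s2"
        have inp2: "inp s2" using inp_agree[OF ag2 _ h(1)] by simp
        have same2: "s2 ''pc'' = c" "s2 ''X'' = s' ''X''" "s2 ''e'' = s' ''e''" "s2 ''c'' = s' ''c''"
          using ag2 same by (auto simp: agree_def)
        show "wp (m + 1) (If (eq (var ''f'') (Const 1)) ?add Skip) (?I (insert x D)) s2"
        proof (rule wp_If)
          assume "cond_val (eq (var ''f'') (Const 1)) s2"
          then have arc: "(s2 ''x'' 0, s2 ''y'' 0) \<in> arcs" "s2 ''x'' 0 \<in> X" "s2 ''y'' 0 \<notin> X"
            "0 < f (s2 ''y'' 0)" using 2 by auto
          define q where "q = s2 ''y'' 0"
          let ?s3 = "s2(''e'' := (s2 ''e'')(0 := expr_val (var ''y'') s2))"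
          note step = growth_step[OF pcs conjunct1[OF X(1)] small arc, folded q_def]
          have inp3: "inp ?s3"
            using inp_agree[of "{''e''}" s2 ?s3] inp2 by (simp add: agree_def)
          have "wp n (?up ;; ?cnt) (?J (X \<union> piece c q)) ?s3"
          proof (rule wp_Seq)
            show "wp n ?up (\<lambda>s4. s4 ''X'' = (\<lambda>y. if y \<in> V \<and> c y = c q then 1 else ?s3 ''X'' y)) ?s3"
              by (rule wp_update[OF inp3]) (auto simp: agree_def same2 q_def)
            fix s4
            assume 4: "s4 ''X'' = (\<lambda>y. if y \<in> V \<and> c y = c q then 1 else ?s3 ''X'' y)"
              and ag4: "agree (writes ?up) ?s3 s4"
            show "wp n ?cnt (?J (X \<union> piece c q)) s4"
            proof (rule cnt)
              show "inp s4" using inp_agree[OF ag4 _ inp3] by simp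
              show "growth f c \<theta> (X \<union> piece c q) (s4 ''e'' 0)"
                using step(1) ag4 by (simp add: agree_def q_def)
              show "indicates (s4 ''X'') (X \<union> piece c q)"
                using 4 X(1) same2 by (auto simp: indicates_def piece_def)
            qed (use X in simp)
          qed
          then have "wp (m + 1) (?up ;; ?cnt) (?I (insert x D)) ?s3"
            by (rule wp_weaken[OF _ n_le_m]) (use step(2) X(2) small card_D 2 arc in \<open>fastforce simp: closed_in_def\<close>)
          then show "wp (m + 1) ?add (?I (insert x D)) s2"
            by (intro wp_assign_seq) auto
        next
          assume "\<not> cond_val (eq (var ''f'') (Const 1)) s2"
          then have "closed_in f X" using 2 by (auto simp: closed_in_def split: if_splits)
          then show "wp (m + 1) Skip (?I (insert x D)) s2"
            using X same2 by (intro wp_Skip) auto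
        qed simp
      qed simp
    next
      assume "\<not> cond_val (Less (var ''c'') (var ''th'')) s'"
      then show "wp (m + 1) Skip (?I (insert x D)) s'"
        using X same by (intro wp_Skip) auto
    qed simp
  qed
  show ?thesis
    unfolding grow_def
  proof (rule wp_Seq[OF wp_weaken[OF _ nF]])
    show "wp n (update ''X'' (Less (Const 0) (Const 1)) (Const 0))
        (\<lambda>s1. s1 ''X'' = (\<lambda>y. if y \<in> V \<and> True then 0 else s ''X'' y)) s"
      by (rule wp_update[OF assms(1)]) auto
    fix s1
    assume 1: "s1 ''X'' = (\<lambda>y. if y \<in> V \<and> True then 0 else s ''X'' y)"
      and ag1: "agree (writes (update ''X'' (Less (Const 0) (Const 1)) (Const 0))) s s1"
    have inp1: "inp s1" using inp_agree[OF ag1 _ assms(1)] by simp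
    let ?u2 = "update ''X'' (eq (Cell ''pc'' (var ''v'')) (Cell ''pc'' (var ''v3''))) (Const 1)"
    let ?for = "for_vertices ''i2'' ''v2'' ?p"
    show "wp (n * (m + 1)) (?u2 ;; ''e'' ::= var ''v3'' ;; ?cnt ;; ?for)
        ?R s1"
    proof (rule wp_Seq[OF wp_weaken[OF _ nF]])
      show "wp n ?u2 (\<lambda>s2. s2 ''X'' = (\<lambda>y. if y \<in> V \<and> c y = c y0 then 1 else s1 ''X'' y)) s1"
        using ag1 by (intro wp_update[OF inp1]) (auto simp: agree_def f_c_def y0)
      fix s2
      assume 2: "s2 ''X'' = (\<lambda>y. if y \<in> V \<and> c y = c y0 then 1 else s1 ''X'' y)"
        and ag2: "agree (writes ?u2) s1 s2"
      have inp2: "inp s2" using inp_agree[OF ag2 _ inp1] by simp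
      let ?s3 = "s2(''e'' := (s2 ''e'')(0 := expr_val (var ''v3'') s2))"
      have v3: "s2 ''v3'' 0 = y0" using ag1 ag2 y0(1) by (simp add: agree_def)
      have ag3: "agree {''i'', ''v'', ''X'', ''e''} s ?s3"
        using ag1 ag2 by (auto simp: agree_def)
      have inp3: "inp ?s3" using inp_agree[OF ag3 _ assms(1)] by simp
      have "wp n ?cnt (?J (piece c y0)) ?s3"
        using growth_start[OF pcs y0(2) _ th(2)] y0(2,3) 1 2 v3 piece_refl
        by (intro cnt[OF inp3]) (auto simp: indicates_def piece_def f_c_def)
      then have "wp (n * (m + 1)) (?cnt ;; ?for) ?R ?s3"
      proof (rule wp_Seq[OF wp_weaken[OF _ nF]])
        fix s4
        assume 4: "?J (piece c y0) s4" and ag4: "agree (writes ?cnt) ?s3 s4"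
        have ag04: "agree {''i'', ''v'', ''X'', ''e'', ''c''} s s4"
          by (rule agree_trans[OF ag3 ag4]) auto
        have inp4: "inp s4" using inp_agree[OF ag04 _ assms(1)] by simp
        have "0 < card (piece c y0)"
          using piece_refl[OF y0(2)] by (auto simp: card_gt_0_iff)
        then have I4: "?I {} s4" using 4 by auto
        have "wp (n * (m + 1)) ?for (?I V) s4"
        proof (rule wp_for_vertices[where I = ?I, OF inp4])
          fix D y s'
          assume *: "D \<subseteq> V" "y \<in> V" "y \<notin> D" "?I D s'"
            and ag: "agree ({''i2'', ''v2''} \<union> writes ?p) s4 s'"
          have "inp s'" using inp_agree[OF ag _ inp4] by simp
          then show "wp (m + 1) ?p (?I (insert y D)) s'"
            using * ag ag04 th(1) by (intro body) (auto simp: agree_def f_c_def)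
        qed (use I4 in auto)
        then show "wp (n * (m + 1)) ?for ?R s4"
        proof (rule wp_weaken[OF _ order_refl])
          fix s' assume "?I V s'"
          then obtain X where X: "?J X s'" "card X < \<theta> \<longrightarrow> closed_in f X \<or> n < card X" by blast
          then have "card X \<le> n" by (intro card_mono) (auto simp: growth_def)
          with X show "\<exists>X. growth (s ''cls'') (s ''pc'') \<theta> X (s' ''e'' 0) \<and>
            indicates (s' ''X'') X \<and> s' ''c'' 0 = card X \<and> y0 \<in> X \<and>
            (card X < \<theta> \<longrightarrow> closed_in (s ''cls'') X)"
            by (auto simp: f_c_def)
        qed
      qed
      then show "wp (n * (m + 1)) (''e'' ::= var ''v3'' ;; ?cnt ;; ?for)
        ?R s2"
        by (intro wp_assign_seq) auto
    qed
  qed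
qed

end

text \<open>The array is cleared before \<open>b\<close> is evaluated, so \<open>b\<close> should
  not depend on it.\<close>

definition indicator :: "string \<Rightarrow> cond \<Rightarrow> prog" where
  "indicator a b = update a (Less (Const 0) (Const 1)) (Const 0) ;; update a b (Const 1)"

lemma writes_indicator [simp]: "writes (indicator a b) = {''i'', ''v'', a}"
  by (auto simp: indicator_def)

text \<open>Growth is tried from every vertex of positive class until one attempt reaches
  \<open>th\<close>. If the piece added last is already large by itself, it replaces the whole
  union; the two outcomes are recorded in \<open>segment\<close>.\<close>

definition find :: prog where
  "find = ''fl'' ::= Const 0 ;;
     for_vertices ''i3'' ''v3''
       (If (Conj (eq (var ''fl'') (Const 0)) (Less (Const 0) (Cell ''cls'' (var ''v3''))))
         (grow ;; If (Less (var ''c'') (var ''th'')) Skip (''fl'' ::= Const 1)) Skip) ;;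
     If (eq (var ''fl'') (Const 1))
       (count ''c'' (eq (Cell ''pc'' (var ''v'')) (Cell ''pc'' (var ''e''))) ;;
        If (Less (var ''c'') (var ''th'')) Skip
          (indicator ''X'' (eq (Cell ''pc'' (var ''v'')) (Cell ''pc'' (var ''e''))))) Skip"

lemma writes_find [simp]:
  "writes find = {''i'', ''v'', ''i2'', ''v2'', ''i3'', ''v3'', ''j'', ''p'', ''q'', ''f'', ''x'', ''y'',
     ''X'', ''e'', ''c'', ''fl''}"
  by (auto simp: find_def)

text \<open>
  \<open>H\<close> and \<open>K\<close> are indicator arrays of nested sets, so \<open>2H - K\<close> has class 1 on \<open>K\<close> and class 2 on \<open>H - K\<close>.
\<close>

definition walk_step :: prog where
  "walk_step =
     find_vertex ''z'' (eq (Cell ''K'' (var ''v'')) (Const 1)) ;;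
     find_arc (Conj (eq (Cell ''H'' (var ''p'')) (Const 1))
       (Conj (eq (Cell ''K'' (var ''p'')) (Const 0)) (eq (Cell ''K'' (var ''q'')) (Const 1)))) ;;
     If (eq (var ''f'') (Const 1)) (''z'' ::= var ''y'') Skip ;;
     update ''cls'' (Less (Const 0) (Const 1))
       (Sub (Add (Cell ''H'' (var ''v'')) (Cell ''H'' (var ''v''))) (Cell ''K'' (var ''v''))) ;;
     Store ''cls'' (var ''z'') (Const 0) ;;
     comps ;; best ;;
     If (Less (var ''h'') (Add (var ''bs'') (var ''th'')))
       (indicator ''K'' (eq (Cell ''pc'' (var ''v'')) (Cell ''pc'' (var ''by''))))
       (''st'' ::= Const 1)"

definition walk :: prog where
  "walk = indicator ''K'' (eq (Cell ''H'' (var ''v'')) (Const 1)) ;;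
     ''st'' ::= Const 0 ;; While (eq (var ''st'') (Const 0)) walk_step"

lemma writes_walk_step [simp]:
  "writes walk_step = {''i'', ''v'', ''i2'', ''v2'', ''j'', ''p'', ''q'', ''f'', ''x'', ''y'',
     ''a'', ''b'', ''c'', ''z'', ''cls'', ''pc'', ''bs'', ''by'', ''K'', ''st''}"
  by (auto simp: walk_step_def)

lemma writes_walk [simp]: "writes walk = writes walk_step"
  by (auto simp: walk_def)

section \<open>Search for a large union of pieces, stars, and the walk\<close>

context graph_input begin

text \<open>Each basic scan fits into n(m + 1); for n * n this is where \<open>n_le_m\<close>
  enters.\<close>

lemma time_bounds:
  "n \<le> n * (m + 1)" "m \<le> n * (m + 1)" "n * m \<le> n * (m + 1)" "n * n \<le> n * (m + 1)"
  "n * (m + 1) \<le> n * (n * (m + 1))" "n \<le> n * (n * (m + 1))" "m \<le> n * (n * (m + 1))"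
  "0 < n * (m + 1)" "0 < n * (n * (m + 1))"
proof -
  have 1: "1 \<le> n" by (simp add: Suc_leI)
  show a: "n \<le> n * (m + 1)" by simp
  show b: "m \<le> n * (m + 1)" using mult_le_mono1[OF 1, of "m + 1"] by simp
  show "n * m \<le> n * (m + 1)" by simp
  show "n * n \<le> n * (m + 1)" using n_le_m by (intro mult_le_mono2)
  show c: "n * (m + 1) \<le> n * (n * (m + 1))" using mult_le_mono1[OF 1, of "n * (m + 1)"] by simp
  show "n \<le> n * (n * (m + 1))" "m \<le> n * (n * (m + 1))" using a b c le_trans by blast+
  show "0 < n * (m + 1)" "0 < n * (n * (m + 1))" by simp_all
qed

lemma wp_indicator:
  assumes "inp s" "a \<notin> {''i'', ''v''} \<union> inputs"
    and b: "\<And>y s'. y \<in> V \<Longrightarrow> agree {''i'', ''v'', a} s s' \<Longrightarrow> s' ''v'' 0 = y \<Longrightarrow>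
      cond_val b s' \<longleftrightarrow> B y"
  shows "wp n (indicator a b) (\<lambda>s'. indicates (s' a) {v \<in> V. B v}) s"
  unfolding indicator_def
proof (rule wp_Seq)
  let ?u = "update a (Less (Const 0) (Const 1)) (Const 0)"
  show "wp n ?u (\<lambda>s'. s' a = (\<lambda>y. if y \<in> V \<and> True then 0 else s a y)) s"
    by (rule wp_update[OF assms(1,2)]) auto
  fix s1 assume 1: "s1 a = (\<lambda>y. if y \<in> V \<and> True then 0 else s a y)"
    and "agree (writes ?u) s s1"
  then have ag1: "agree {''i'', ''v'', a} s s1" by simp
  have inp1: "inp s1" using inp_agree[OF ag1 _ assms(1)] assms(2) by auto
  have "wp n (update a b (Const 1)) (\<lambda>s'. s' a = (\<lambda>y. if y \<in> V \<and> B y then 1 else s1 a y)) s1"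
    using assms(2) by (intro wp_update[OF inp1] b) (auto intro: agree_trans[OF ag1])
  then show "wp n (update a b (Const 1)) (\<lambda>s'. indicates (s' a) {v \<in> V. B v}) s1"
    by (rule wp_weaken[OF _ order_refl]) (auto simp: indicates_def 1)
qed

text \<open>Either a single large piece, whose size must be controlled separately, or two connected
  sets below \<theta> glued together, which gives \<theta> \<le> card X \<le> 2\<theta> - 2.\<close>

definition segment :: "(nat \<Rightarrow> nat) \<Rightarrow> (nat \<Rightarrow> nat) \<Rightarrow> nat \<Rightarrow> nat set \<Rightarrow> nat \<Rightarrow> bool" where
  "segment f c \<theta> X e \<longleftrightarrow> X \<subseteq> {v \<in> V. 0 < f v} \<and> conn X \<and> (\<forall>x\<in>X. piece c x \<subseteq> X) \<and> e \<in> X \<and>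
     \<theta> \<le> card X \<and> (X = piece c e \<or>
       card (piece c e) < \<theta> \<and> card (X - piece c e) < \<theta> \<and> conn (X - piece c e))"

definition bounded :: "(nat \<Rightarrow> nat) \<Rightarrow> nat \<Rightarrow> bool" where
  "bounded f \<theta> \<longleftrightarrow> (\<forall>Z. conn Z \<longrightarrow> Z \<subseteq> {v \<in> V. 0 < f v} \<longrightarrow> card Z < \<theta>)"

text \<open>A growth stuck below \<theta> bounds all connected sets of positive class through its
  start. Every such start is tried, so failure everywhere bounds all of them.\<close>

lemma wp_find:
  assumes "inp s" and pieces: "is_pieces (s ''cls'') (s ''pc'')" and th: "s ''th'' 0 = \<theta>" "0 < \<theta>"
  shows "wp (n * (n * (m + 1))) find (\<lambda>s'. if s' ''fl'' 0 = 1
    then \<exists>X. segment (s ''cls'') (s ''pc'') \<theta> X (s' ''e'' 0) \<and> indicates (s' ''X'') X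
    else s' ''fl'' 0 = 0 \<and> bounded (s ''cls'') \<theta>) s"
proof -
  define f c where "f = s ''cls''" "c = s ''pc''"
  have pcs: "is_pieces f c" using pieces by (simp add: f_c_def)
  let ?I = "\<lambda>D s'. if s' ''fl'' 0 = 1
    then \<exists>X. growth f c \<theta> X (s' ''e'' 0) \<and> \<theta> \<le> card X \<and> indicates (s' ''X'') X
    else s' ''fl'' 0 = 0 \<and> (\<forall>y\<in>D. \<forall>Z. conn Z \<longrightarrow> Z \<subseteq> {v \<in> V. 0 < f v} \<longrightarrow> y \<in> Z \<longrightarrow> card Z < \<theta>)"
  let ?b = "Conj (eq (var ''fl'') (Const 0)) (Less (Const 0) (Cell ''cls'' (var ''v3'')))"
  let ?q = "If (Less (var ''c'') (var ''th'')) Skip (''fl'' ::= Const 1)"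
  let ?p = "If ?b (grow ;; ?q) Skip"
  let ?cnt = "count ''c'' (eq (Cell ''pc'' (var ''v'')) (Cell ''pc'' (var ''e'')))"
  let ?ind = "indicator ''X'' (eq (Cell ''pc'' (var ''v'')) (Cell ''pc'' (var ''e'')))"
  let ?fin = "If (eq (var ''fl'') (Const 1))
       (?cnt ;; If (Less (var ''c'') (var ''th'')) Skip ?ind) Skip"
  let ?Q = "\<lambda>s'. if s' ''fl'' 0 = 1
    then \<exists>X. segment f c \<theta> X (s' ''e'' 0) \<and> indicates (s' ''X'') X
    else s' ''fl'' 0 = 0 \<and> bounded f \<theta>"
  let ?s1 = "s(''fl'' := (s ''fl'')(0 := expr_val (Const 0) s))"
  have ag1: "agree {''fl''} s ?s1" by (simp add: agree_def)
  have inp1: "inp ?s1" using inp_agree[OF ag1 _ assms(1)] by simp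
  have "wp (n * (n * (m + 1))) (for_vertices ''i3'' ''v3'' ?p) (?I V) ?s1"
  proof (rule wp_for_vertices[where I = ?I, OF inp1])
    fix D y s'
    assume y: "y \<in> V" and I: "?I D s'" and v3: "s' ''v3'' 0 = y"
      and ag2: "agree ({''i3'', ''v3''} \<union> writes ?p) ?s1 s'"
    have inp2: "inp s'" using inp_agree[OF ag2 _ inp1] by simp
    have same: "s' ''cls'' = f" "s' ''pc'' = c" "s' ''th'' 0 = \<theta>"
      using ag2 th by (auto simp: agree_def f_c_def)
    show "wp (n * (m + 1)) ?p (?I (insert y D)) s'"
    proof (rule wp_If)
      assume "cond_val ?b s'"
      then have fl: "s' ''fl'' 0 = 0" "0 < f y" using same v3 by auto
      have "wp (n * (m + 1)) grow (\<lambda>s''. \<exists>X. growth (s' ''cls'') (s' ''pc'') \<theta> X (s'' ''e'' 0) \<and>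
        indicates (s'' ''X'') X \<and> s'' ''c'' 0 = card X \<and> y \<in> X \<and>
        (card X < \<theta> \<longrightarrow> closed_in (s' ''cls'') X)) s'"
        using inp2 pcs v3 y fl(2) same th(2) by (intro wp_grow) auto
      then show "wp (n * (m + 1)) (grow ;; ?q) (?I (insert y D)) s'"
      proof (rule wp_Seq)
        fix s3
        assume "\<exists>X. growth (s' ''cls'') (s' ''pc'') \<theta> X (s3 ''e'' 0) \<and>
          indicates (s3 ''X'') X \<and> s3 ''c'' 0 = card X \<and> y \<in> X \<and>
          (card X < \<theta> \<longrightarrow> closed_in (s' ''cls'') X)" and ag3: "agree (writes grow) s' s3"
        then obtain X where X: "growth f c \<theta> X (s3 ''e'' 0)" "indicates (s3 ''X'') X"
          "s3 ''c'' 0 = card X" "y \<in> X" "card X < \<theta> \<longrightarrow> closed_in f X"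
          unfolding same by blast
        have same3: "s3 ''fl'' = s' ''fl''" "s3 ''th'' 0 = \<theta>"
          using ag3 same by (auto simp: agree_def)
        show "wp (n * (m + 1)) ?q (?I (insert y D)) s3"
        proof (rule wp_If)
          assume "cond_val (Less (var ''c'') (var ''th'')) s3"
          then have "card X < \<theta>" "closed_in f X" using X same3 by auto
          moreover have "X \<subseteq> V" using X(1) by (auto simp: growth_def)
          ultimately have "card Z < \<theta>" if "conn Z" "Z \<subseteq> {v \<in> V. 0 < f v}" "y \<in> Z" for Z
            using closed_in_bound[of f X \<theta> y Z] X(4) that by blast
          then show "wp (n * (m + 1)) Skip (?I (insert y D)) s3"
            using I fl same3 by (intro wp_Skip) auto
        next
          assume "\<not> cond_val (Less (var ''c'') (var ''th'')) s3"
          then have "\<theta> \<le> card X" using X same3 by auto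
          then show "wp (n * (m + 1)) (''fl'' ::= Const 1) (?I (insert y D)) s3"
            using X by (intro wp_assign') auto
        qed simp
      qed
    next
      assume "\<not> cond_val ?b s'"
      then show "wp (n * (m + 1)) Skip (?I (insert y D)) s'"
        using I same v3 by (intro wp_Skip) (auto split: if_splits)
    qed simp
  qed auto
  then have "wp (n * (n * (m + 1))) (for_vertices ''i3'' ''v3'' ?p ;; ?fin) ?Q ?s1"
  proof (rule wp_Seq)
    fix s2
    assume I: "?I V s2" and ag2: "agree (writes (for_vertices ''i3'' ''v3'' ?p)) ?s1 s2"
    have inp2: "inp s2" using inp_agree[OF ag2 _ inp1] by simp
    have same: "s2 ''pc'' = c" "s2 ''th'' 0 = \<theta>"
      using ag2 th by (auto simp: agree_def f_c_def)
    show "wp (n * (n * (m + 1))) ?fin ?Q s2"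
    proof (rule wp_If)
      assume "cond_val (eq (var ''fl'') (Const 1)) s2"
      then have fl: "s2 ''fl'' 0 = 1" by simp
      then obtain X where X: "growth f c \<theta> X (s2 ''e'' 0)" "\<theta> \<le> card X" "indicates (s2 ''X'') X"
        using I by auto
      define e where "e = s2 ''e'' 0"
      have eV: "e \<in> V" using X(1) by (auto simp: growth_def e_def)
      have cnt: "wp n ?cnt (\<lambda>s'. s' ''c'' 0 = card {v \<in> V. c v = c e}) s2"
        by (rule wp_count[OF inp2]) (auto simp: agree_def same e_def)
      show "wp (n * (n * (m + 1))) (?cnt ;; If (Less (var ''c'') (var ''th'')) Skip ?ind) ?Q s2"
      proof (rule wp_Seq[OF wp_weaken[OF cnt]])
        fix s3
        assume 3: "s3 ''c'' 0 = card {v \<in> V. c v = c e}" and ag3: "agree (writes ?cnt) s2 s3"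
        have inp3: "inp s3" using inp_agree[OF ag3 _ inp2] by simp
        have same3: "s3 ''pc'' = c" "s3 ''th'' 0 = \<theta>" "s3 ''e'' 0 = e" "s3 ''X'' = s2 ''X''"
          "s3 ''fl'' 0 = 1" "s3 ''c'' 0 = card (piece c e)"
          using ag3 same 3 fl by (auto simp: agree_def e_def piece_def)
        show "wp (n * (n * (m + 1))) (If (Less (var ''c'') (var ''th'')) Skip ?ind) ?Q s3"
        proof (rule wp_If)
          assume "cond_val (Less (var ''c'') (var ''th'')) s3"
          then have lt: "card (piece c e) < \<theta>" using same3 by simp
          have "X - piece c e \<noteq> {}"
          proof
            assume "X - piece c e = {}"
            then have "card X \<le> card (piece c e)" by (intro card_mono) auto
            then show False using lt X(2) by simp
          qed
          then have "segment f c \<theta> X e"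
            using X lt unfolding segment_def growth_def e_def by blast
          then show "wp (n * (n * (m + 1))) Skip ?Q s3"
            using X(3) same3 by (intro wp_Skip) auto
        next
          assume "\<not> cond_val (Less (var ''c'') (var ''th'')) s3"
          then have ge: "\<theta> \<le> card (piece c e)" using same3 by simp
          have "piece c e \<subseteq> X" "X \<subseteq> {v \<in> V. 0 < f v}" using X(1) by (auto simp: growth_def e_def)
          then have seg: "segment f c \<theta> (piece c e) e"
            using ge piece_conn[OF pcs eV] piece_refl[OF eV] piece_eq by (auto simp: segment_def)
          have ind: "wp n ?ind (\<lambda>s'. indicates (s' ''X'') {v \<in> V. c v = c e}) s3"
            by (rule wp_indicator[OF inp3]) (auto simp: agree_def same3)
          show "wp (n * (n * (m + 1))) ?ind ?Q s3"
          proof (rule wp_weaken[OF ind])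
            fix s4 assume "indicates (s4 ''X'') {v \<in> V. c v = c e}" "agree (writes ?ind) s3 s4"
            then show "?Q s4" using seg same3 by (auto simp: agree_def piece_def)
          qed (rule time_bounds)
        qed simp
      qed (rule time_bounds)
    next
      assume "\<not> cond_val (eq (var ''fl'') (Const 1)) s2"
      then have "s2 ''fl'' 0 = 0" "bounded f \<theta>"
        using I conn_nonempty by (auto simp: bounded_def split: if_splits)
      then show "wp (n * (n * (m + 1))) Skip ?Q s2"
        by (intro wp_Skip) auto
    qed simp
  qed
  then show ?thesis
    unfolding find_def f_c_def by (intro wp_assign_seq) auto
qed

text \<open>The pieces in \<open>H - {z}\<close> are branches at \<open>z\<close>: each one stays
  inside and is attached to \<open>z\<close>. Nothing forbids arcs between different pieces, so a
  component of \<open>H - {z}\<close> may consist of several branches.\<close>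

definition star :: "nat set \<Rightarrow> nat \<Rightarrow> (nat \<Rightarrow> nat) \<Rightarrow> bool" where
  "star H z c \<longleftrightarrow> H \<subseteq> V \<and> z \<in> H \<and>
     (\<forall>y\<in>H - {z}. piece c y \<subseteq> H - {z} \<and> conn (insert z (piece c y)))"

text \<open>Whatever is left still hangs on \<open>z\<close> branch by branch.\<close>

lemma star_remove:
  assumes "star H z c" "X \<subseteq> H - {z}" "\<And>x. x \<in> X \<Longrightarrow> piece c x \<subseteq> X"
  shows "conn (H - X)"
proof (rule conn_star[of z])
  show "z \<in> H - X" using assms by (auto simp: star_def)
  fix v assume v: "v \<in> H - X"
  show "\<exists>C\<subseteq>H - X. conn C \<and> z \<in> C \<and> v \<in> C"
  proof (cases "v = z")
    case True
    then show ?thesis using v by (intro exI[of _ "{z}"]) simp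
  next
    case False
    then have vH: "v \<in> H - {z}" "v \<in> V" using v assms(1) by (auto simp: star_def)
    have "x \<notin> X" if "x \<in> piece c v" for x
      using assms(3)[of x] piece_eq[OF that] piece_refl[OF vH(2)] v by blast
    then have "insert z (piece c v) \<subseteq> H - X"
      using assms(1) vH \<open>z \<in> H - X\<close> unfolding star_def by blast
    moreover have "conn (insert z (piece c v))"
      using assms(1) vH(1) unfolding star_def by blast
    ultimately show ?thesis
      using piece_refl[OF vH(2)] by (intro exI[of _ "insert z (piece c v)"]) simp
  qed
qed

lemma conn_insert_arc: "conn S \<Longrightarrow> (p, z) \<in> arcs \<Longrightarrow> p \<in> S \<Longrightarrow> conn (insert z S)"
  using conn_Un_arc[of S "{z}" p z] by simp

text \<open>If the class \<open>k\<close> is exactly \<open>H - {z}\<close>, an arc leaving a piece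
  inside \<open>H\<close> can only end in \<open>z\<close>: any other end would have the same class
  and belong to the piece.\<close>

lemma star_class:
  assumes "conn H" "H \<subseteq> V" "z \<in> H" "is_pieces f c" "f z = 0"
    and "\<And>y. y \<in> H - {z} \<Longrightarrow> f y = k" "0 < k" "\<And>y. y \<in> V - H \<Longrightarrow> f y \<noteq> k"
  shows "star H z c"
  unfolding star_def
proof (intro conjI ballI assms(2,3))
  fix y assume y: "y \<in> H - {z}"
  then have yV: "y \<in> V" and fy: "f y = k" using assms by auto
  show sub: "piece c y \<subseteq> H - {z}"
  proof
    fix v assume v: "v \<in> piece c y"
    have "f v = k" using piece_class[OF assms(4) yV v] fy by simp
    moreover have "v \<in> V" using v by (simp add: piece_def)
    ultimately show "v \<in> H - {z}" using assms(5,7) assms(8)[of v] by auto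
  qed
  have "piece c y \<noteq> {}" "piece c y \<noteq> H" "piece c y \<subseteq> H"
    using piece_refl[OF yV, of c] sub assms(3) by blast+
  then obtain p q where pq: "(p, q) \<in> arcs" "p \<in> piece c y" "q \<in> H - piece c y"
    using conn_cut[OF assms(1)] by metis
  have "q = z"
  proof (rule ccontr)
    assume "q \<noteq> z"
    then have "f q = k" using pq(3) assms(6) by blast
    moreover have "f p = k" using piece_class[OF assms(4) yV pq(2)] fy by simp
    ultimately show False using piece_step[OF assms(4) pq(2,1)] pq(3) assms(7) by simp
  qed
  then show "conn (insert z (piece c y))"
    using conn_insert_arc[OF piece_conn[OF assms(4) yV] pq(1,2)] by simp
qed

text \<open>The colouring separates \<open>K - {z}\<close> from \<open>H - K\<close>. The latter is
  connected and touches \<open>z\<close>, so it forms one branch, while the branches in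
  \<open>K\<close> are the components of \<open>K - {z}\<close>.\<close>

lemma walk_pieces:
  assumes "conn K" "K \<subseteq> H" "H \<subseteq> V" "z \<in> K" and pcs: "is_pieces f c"
    and rest: "H - K = {} \<or> conn (H - K) \<and> (\<exists>a\<in>H - K. (a, z) \<in> arcs)"
    and "\<forall>y\<in>V. f y = (if y = z \<or> y \<notin> H then 0 else if y \<in> K then 1 else 2)"
  shows "star H z c" "\<And>y. y \<in> K - {z} \<Longrightarrow> piece c y \<subseteq> K - {z}"
    "\<And>y. y \<in> H - K \<Longrightarrow> piece c y = H - K"
proof -
  note f = bspec[OF assms(7)]
  have zV: "z \<in> V" using assms(2-4) by blast
  have "star K z c"
  proof (rule star_class[OF assms(1) _ assms(4) pcs, of 1])
    show "K \<subseteq> V" using assms(2,3) by blast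
    show "f z = 0" using f[OF zV] by simp
    show "f y = 1" if y: "y \<in> K - {z}" for y
    proof -
      have "y \<in> V" "y \<in> H" using y assms(2,3) by blast+
      then show ?thesis using f[of y] y by simp
    qed
    show "f y \<noteq> 1" if "y \<in> V - K" for y
      using that f[of y] by auto
  qed simp
  then have inK: "piece c y \<subseteq> K - {z} \<and> conn (insert z (piece c y))" if "y \<in> K - {z}" for y
    using that unfolding star_def by blast
  then show "\<And>y. y \<in> K - {z} \<Longrightarrow> piece c y \<subseteq> K - {z}" by blast
  have inS: "piece c y = H - K" if y: "y \<in> H - K" for y
  proof
    have yV: "y \<in> V" using y assms by auto
    have fy: "f y = 2" using f[OF yV] y assms(4) by auto
    show "piece c y \<subseteq> H - K"
    proof
      fix v assume v: "v \<in> piece c y"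
      then have vV: "v \<in> V" using piece_subset by blast
      have "f v = 2" using piece_class[OF pcs yV v] fy by simp
      then show "v \<in> H - K"
        using f[OF vV] by (cases "v = z"; cases "v \<in> K"; cases "v \<in> H") simp_all
    qed
    show "H - K \<subseteq> piece c y"
    proof (rule piece_max[OF pcs _ _ y, of 2])
      show "conn (H - K)" using rest y by blast
      show "f v = 2" if "v \<in> H - K" for v
      proof -
        have "v \<in> V" "v \<in> H" "v \<notin> K" "v \<noteq> z" using that assms(3,4) by blast+
        then show ?thesis using f[of v] by simp
      qed
    qed (use assms(3) in auto)
  qed
  then show "\<And>y. y \<in> H - K \<Longrightarrow> piece c y = H - K" by blast
  have "piece c y \<subseteq> H - {z} \<and> conn (insert z (piece c y))" if "y \<in> H - {z}" for y
  proof (cases "y \<in> K")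
    case True
    then show ?thesis using inK[of y] that assms(2) by blast
  next
    case False
    then have y: "y \<in> H - K" using that by simp
    then obtain a where "conn (H - K)" "a \<in> H - K" "(a, z) \<in> arcs"
      using rest by blast
    then show ?thesis
      using inS[OF y] conn_insert_arc[of "H - K" a z] assms(4) by auto
  qed
  then show "star H z c"
    using assms unfolding star_def by blast
qed

text \<open>A branch may have \<theta> or more vertices, but then it leaves at least \<theta>
  vertices of \<open>H\<close> outside. So a single large branch is a balanced cut.\<close>

definition walked :: "nat set \<Rightarrow> nat \<Rightarrow> nat \<Rightarrow> (nat \<Rightarrow> nat) \<Rightarrow> (nat \<Rightarrow> nat) \<Rightarrow> bool" where
  "walked H \<theta> z f c \<longleftrightarrow> is_pieces f c \<and> star H z c \<and> (\<forall>y\<in>V. 0 < f y \<longleftrightarrow> y \<in> H - {z}) \<and>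
     (\<forall>y\<in>H - {z}. card (piece c y) < \<theta> \<or> card (piece c y) + \<theta> \<le> card H)"

text \<open>The last condition says that the connected rest \<open>H - K\<close> has fewer than
  \<theta> vertices.\<close>

definition core :: "nat set \<Rightarrow> nat \<Rightarrow> nat set \<Rightarrow> bool" where
  "core H \<theta> K \<longleftrightarrow> K \<subseteq> H \<and> conn K \<and> (H - K = {} \<or> conn (H - K)) \<and> card H < card K + \<theta>"

text \<open>If the largest piece of \<open>K - {z}\<close> has more than card H - \<theta> vertices,
  fewer than \<theta> remain outside it, and they are connected through \<open>z\<close>; this piece
  is the next \<open>K\<close>. Otherwise all pieces in \<open>K\<close> are at most card H -
  \<theta>, the branch \<open>H - K\<close> is below \<theta>, and the walk may stop.\<close>

lemma wp_walk_step:
  assumes inp: "inp s" and H: "H \<subseteq> V" "conn H" "indicates (s ''H'') H" "s ''h'' 0 = card H"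
    and th: "s ''th'' 0 = \<theta>" "\<theta> \<le> card H" and K: "core H \<theta> K" "indicates (s ''K'') K"
    and st: "s ''st'' 0 = 0"
  shows "wp (n * (m + 1)) walk_step (\<lambda>s'.
    s' ''st'' 0 = 1 \<and> walked H \<theta> (s' ''z'' 0) (s' ''cls'') (s' ''pc'') \<or>
    s' ''st'' 0 = 0 \<and> (\<exists>K'. core H \<theta> K' \<and> indicates (s' ''K'') K' \<and> card K' < card K)) s"
proof -
  let ?F = "n * (m + 1)"
  let ?Q = "\<lambda>s'. s' ''st'' 0 = 1 \<and> walked H \<theta> (s' ''z'' 0) (s' ''cls'') (s' ''pc'') \<or>
    s' ''st'' 0 = 0 \<and> (\<exists>K'. core H \<theta> K' \<and> indicates (s' ''K'') K' \<and> card K' < card K)"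
  have KH: "K \<subseteq> H" "conn K" "K \<subseteq> V" "H - K = {} \<or> conn (H - K)" "card H < card K + \<theta>"
    using K H by (auto simp: core_def)
  have fin: "finite H" "finite K" using finite_subset finite_V H(1) KH(3) by blast+
  have ind: "s ''H'' y = (if y \<in> H then 1 else 0)" "s ''K'' y = (if y \<in> K then 1 else 0)"
    if "y \<in> V" for y using H(3) K(2) that by (auto simp: indicates_def)
  let ?p1 = "find_vertex ''z'' (eq (Cell ''K'' (var ''v'')) (Const 1))"
  let ?p2 = "find_arc (Conj (eq (Cell ''H'' (var ''p'')) (Const 1))
       (Conj (eq (Cell ''K'' (var ''p'')) (Const 0)) (eq (Cell ''K'' (var ''q'')) (Const 1))))"
  let ?p3 = "If (eq (var ''f'') (Const 1)) (''z'' ::= var ''y'') Skip"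
  let ?p4 = "update ''cls'' (Less (Const 0) (Const 1))
       (Sub (Add (Cell ''H'' (var ''v'')) (Cell ''H'' (var ''v''))) (Cell ''K'' (var ''v'')))"
  let ?p5 = "Store ''cls'' (var ''z'') (Const 0)"
  let ?ind = "indicator ''K'' (eq (Cell ''pc'' (var ''v'')) (Cell ''pc'' (var ''by'')))"
  let ?p8 = "If (Less (var ''h'') (Add (var ''bs'') (var ''th''))) ?ind (''st'' ::= Const 1)"
  have 1: "wp n ?p1 (\<lambda>s'. s' ''z'' 0 \<in> V \<and> s' ''z'' 0 \<in> K) s"
  proof (rule wp_find_vertex[OF inp])
    show "\<exists>y\<in>V. y \<in> K" using conn_nonempty[OF KH(2)] KH(3) by blast
  qed (auto simp: agree_def ind)
  have 2: "wp m ?p2 (\<lambda>s'. if s' ''f'' 0 = 1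
      then (s' ''x'' 0, s' ''y'' 0) \<in> arcs \<and> s' ''x'' 0 \<in> H - K \<and> s' ''y'' 0 \<in> K
      else s' ''f'' 0 = 0 \<and> (\<forall>u v. (u, v) \<in> arcs \<longrightarrow> \<not> (u \<in> H - K \<and> v \<in> K))) s1"
    if "agree {''i'', ''v'', ''z''} s s1" "inp s1" for s1
    using that(1) arcs_V by (intro wp_find_arc[OF that(2)]) (auto simp: agree_def ind)
  have 8: "wp ?F ?p8 ?Q s7"
    if inp7: "inp s7" and pcs: "is_pieces f c" and same: "s7 ''cls'' = f" "s7 ''pc'' = c"
      "s7 ''th'' 0 = \<theta>" "s7 ''h'' 0 = card H" "s7 ''st'' 0 = 0" "s7 ''z'' 0 = z"
      and z: "z \<in> K" "H - K = {} \<or> (\<exists>a\<in>H - K. (a, z) \<in> arcs)"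
      and f: "\<And>y. y \<in> V \<Longrightarrow> f y = (if y = z \<or> y \<notin> H then 0 else if y \<in> K then 1 else 2)"
      and bs: "\<forall>y\<in>V. f y = 1 \<longrightarrow> card (piece c y) \<le> s7 ''bs'' 0"
        "s7 ''bs'' 0 = 0 \<or> s7 ''by'' 0 \<in> V \<and> f (s7 ''by'' 0) = 1 \<and>
          s7 ''bs'' 0 = card (piece c (s7 ''by'' 0))" for s7 f c z
  proof -
    have rest: "H - K = {} \<or> conn (H - K) \<and> (\<exists>a\<in>H - K. (a, z) \<in> arcs)"
      using KH(4) z(2) by blast
    have f': "\<forall>y\<in>V. f y = (if y = z \<or> y \<notin> H then 0 else if y \<in> K then 1 else 2)"
      using f by blast
    note wpcs = walk_pieces[OF KH(2,1) H(1) z(1) pcs rest f']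
    show ?thesis
    proof (rule wp_If)
      assume "cond_val (Less (var ''h'') (Add (var ''bs'') (var ''th''))) s7"
      then have big: "card H < s7 ''bs'' 0 + \<theta>" using same by simp
      define y where "y = s7 ''by'' 0"
      \<comment> \<open>By \<open>big\<close> and \<theta> \<le> card H, the value \<open>bs\<close>
        is positive, so \<open>by\<close> does name a vertex of class 1.\<close>
      have y: "y \<in> V" "f y = 1" "s7 ''bs'' 0 = card (piece c y)"
        using bs(2) big th(2) by (auto simp: y_def)
      have yK: "y \<in> K - {z}"
        using f[OF y(1)] y(2) by (cases "y = z"; cases "y \<in> K"; cases "y \<in> H") simp_all
      note sub = wpcs(2)[OF yK]
      have "conn (H - piece c y)"
        using star_remove[OF wpcs(1), of "piece c y"] sub KH(1) piece_eq by blast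
      then have "core H \<theta> (piece c y)"
        using sub KH(1) piece_conn[OF pcs y(1)] big y(3) by (auto simp: core_def)
      moreover have "card (piece c y) < card K"
        using sub z(1) fin by (intro psubset_card_mono) auto
      moreover have i: "wp n ?ind (\<lambda>s'. indicates (s' ''K'') {v \<in> V. c v = c y}) s7"
        by (rule wp_indicator[OF inp7]) (auto simp: agree_def same y_def)
      ultimately show "wp ?F ?ind ?Q s7"
        by (intro wp_weaken[OF i time_bounds(1)]) (auto simp: agree_def same piece_def)
    next
      assume "\<not> cond_val (Less (var ''h'') (Add (var ''bs'') (var ''th''))) s7"
      then have small: "s7 ''bs'' 0 + \<theta> \<le> card H" using same by simp
      have "card (piece c y) < \<theta> \<or> card (piece c y) + \<theta> \<le> card H" if y: "y \<in> H - {z}" for y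
      proof (cases "y \<in> K")
        case True
        then have "f y = 1" "y \<in> V" using f[of y] y KH by auto
        then show ?thesis using bs(1) small by fastforce
      next
        case False
        then have "piece c y = H - K" using wpcs(3) y by blast
        then have "card (piece c y) = card H - card K"
          using KH(1) fin by (simp add: card_Diff_subset)
        then show ?thesis using KH(5) by linarith
      qed
      then have "walked H \<theta> z f c"
        using pcs wpcs(1) f z(1) KH by (auto simp: walked_def)
      then show "wp ?F (''st'' ::= Const 1) ?Q s7"
        using same by (intro wp_assign') auto
    qed simp
  qed
  have 4: "wp ?F (?p4 ;; ?p5 ;; comps ;; best ;; ?p8) ?Q s3"
    if ag3: "agree {''i'', ''v'', ''j'', ''p'', ''q'', ''f'', ''x'', ''y'', ''z''} s s3"
      and z: "s3 ''z'' 0 = z" "z \<in> K" "H - K = {} \<or> (\<exists>a\<in>H - K. (a, z) \<in> arcs)" for s3 z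
  proof -
    have inp3: "inp s3" using inp_agree[OF ag3 _ inp] by simp
    have same3: "s3 ''H'' = s ''H''" "s3 ''K'' = s ''K''" using ag3 by (auto simp: agree_def)
    have u: "wp n ?p4 (\<lambda>s'. s' ''cls'' = (\<lambda>y. if y \<in> V \<and> True then 2 * s ''H'' y - s ''K'' y
        else s3 ''cls'' y)) s3"
      by (rule wp_update[OF inp3]) (auto simp: agree_def same3)
    show ?thesis
    proof (rule wp_Seq[OF wp_weaken[OF u time_bounds(1)]])
      fix s4
      assume 4: "s4 ''cls'' = (\<lambda>y. if y \<in> V \<and> True then 2 * s ''H'' y - s ''K'' y else s3 ''cls'' y)"
        and ag4: "agree (writes ?p4) s3 s4"
      let ?s5 = "s4(''cls'' := (s4 ''cls'')(z := 0))"
      define f where "f = ?s5 ''cls''"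
      have f: "f y = (if y = z \<or> y \<notin> H then 0 else if y \<in> K then 1 else 2)" if "y \<in> V" for y
        using that 4 KH(1) by (auto simp: f_def ind)
      have z4: "s4 ''z'' 0 = z" using ag4 z(1) by (simp add: agree_def)
      have ag5: "agree {''i'', ''v'', ''j'', ''p'', ''q'', ''f'', ''x'', ''y'', ''z'', ''cls''} s ?s5"
        using ag3 ag4 by (auto simp: agree_def)
      have inp5: "inp ?s5" using inp_agree[OF ag5 _ inp] by simp
      have "wp ?F (comps ;; best ;; ?p8) ?Q ?s5"
      proof (rule wp_Seq[OF wp_weaken[OF wp_comps[OF inp5] time_bounds(3)]])
        fix s6
        assume 6: "is_pieces (?s5 ''cls'') (s6 ''pc'')" and ag6: "agree (writes comps) ?s5 s6"
        have inp6: "inp s6" using inp_agree[OF ag6 _ inp5] by simp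
        define c where "c = s6 ''pc''"
        have f6: "s6 ''cls'' = f" using ag6 by (auto simp: agree_def f_def)
        show "wp ?F (best ;; ?p8) ?Q s6"
        proof (rule wp_Seq[OF wp_weaken[OF wp_best[OF inp6] time_bounds(4)]])
          fix s7
          assume 7: "(\<forall>y\<in>V. s6 ''cls'' y = 1 \<longrightarrow> card (piece (s6 ''pc'') y) \<le> s7 ''bs'' 0) \<and>
            (s7 ''bs'' 0 = 0 \<or> s7 ''by'' 0 \<in> V \<and> s6 ''cls'' (s7 ''by'' 0) = 1 \<and>
              s7 ''bs'' 0 = card (piece (s6 ''pc'') (s7 ''by'' 0)))"
            and ag7: "agree (writes best) s6 s7"
          have inp7: "inp s7" using inp_agree[OF ag7 _ inp6] by simp
          have same7: "s7 ''cls'' = f" "s7 ''pc'' = c" "s7 ''th'' 0 = \<theta>" "s7 ''h'' 0 = card H"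
            "s7 ''st'' 0 = 0" "s7 ''z'' 0 = z"
            using ag7 ag6 ag5 f6 z4 H(4) th(1) st by (simp_all add: agree_def c_def)
          have pcs: "is_pieces f c" using 6 by (simp only: f_def c_def)
          show "wp ?F ?p8 ?Q s7"
            by (rule 8[OF inp7 pcs same7 z(2,3)]) (use f 7[unfolded f6, folded c_def] in blast)+
        qed
      qed
      then show "wp ?F (?p5 ;; comps ;; best ;; ?p8) ?Q s4"
        by (intro wp_Store_seq) (simp_all add: z4)
    qed
  qed
  show ?thesis
    unfolding walk_step_def
  proof (rule wp_Seq[OF wp_weaken[OF 1 time_bounds(1)]])
    fix s1 assume z1: "s1 ''z'' 0 \<in> V \<and> s1 ''z'' 0 \<in> K" and "agree (writes ?p1) s s1"
    then have ag1: "agree {''i'', ''v'', ''z''} s s1" by simp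
    have inp1: "inp s1" using inp_agree[OF ag1 _ inp] by simp
    show "wp ?F (?p2 ;; ?p3 ;; ?p4 ;; ?p5 ;; comps ;; best ;; ?p8) ?Q s1"
    proof (rule wp_Seq[OF wp_weaken[OF 2[OF ag1 inp1] time_bounds(2)]])
      fix s2
      assume 2: "if s2 ''f'' 0 = 1
        then (s2 ''x'' 0, s2 ''y'' 0) \<in> arcs \<and> s2 ''x'' 0 \<in> H - K \<and> s2 ''y'' 0 \<in> K
        else s2 ''f'' 0 = 0 \<and> (\<forall>u v. (u, v) \<in> arcs \<longrightarrow> \<not> (u \<in> H - K \<and> v \<in> K))"
        and ag2: "agree (writes ?p2) s1 s2"
      have ag2': "agree {''i'', ''v'', ''j'', ''p'', ''q'', ''f'', ''x'', ''y'', ''z''} s s2"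
        by (rule agree_trans[OF ag1 ag2]) auto
      have z2: "s2 ''z'' 0 \<in> K" using z1 ag2 by (simp add: agree_def)
      \<comment> \<open>Connectedness of \<open>H\<close> provides an arc into \<open>K\<close>
        unless \<open>K = H\<close>; in that case the arbitrary vertex found before is an admissible
        \<open>z\<close>.\<close>
      have empty: "H - K = {}" if "\<And>u v. (u, v) \<in> arcs \<Longrightarrow> \<not> (u \<in> H - K \<and> v \<in> K)"
      proof (rule ccontr)
        assume "H - K \<noteq> {}"
        moreover have "K \<noteq> {}" using KH(2) conn_nonempty by blast
        ultimately obtain p q where "(p, q) \<in> arcs" "p \<in> H - K" "q \<in> H - (H - K)"
          using conn_cut[OF H(2), of "H - K"] KH(1) by blast
        then show False using that by blast
      qed
      have "wp ?F ?p3 (\<lambda>s3. s3 ''z'' 0 \<in> K \<and> (H - K = {} \<or> (\<exists>a\<in>H - K. (a, s3 ''z'' 0) \<in> arcs))) s2"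
        using 2 z2 empty by (intro wp_If wp_assign' wp_Skip) (auto split: if_splits)
      then show "wp ?F (?p3 ;; ?p4 ;; ?p5 ;; comps ;; best ;; ?p8) ?Q s2"
      proof (rule wp_Seq)
        fix s3
        assume z3: "s3 ''z'' 0 \<in> K \<and> (H - K = {} \<or> (\<exists>a\<in>H - K. (a, s3 ''z'' 0) \<in> arcs))"
          and ag3: "agree (writes ?p3) s2 s3"
        have "agree {''i'', ''v'', ''j'', ''p'', ''q'', ''f'', ''x'', ''y'', ''z''} s s3"
          by (rule agree_trans[OF ag2' ag3]) auto
        then show "wp ?F (?p4 ;; ?p5 ;; comps ;; best ;; ?p8) ?Q s3"
          using z3 by (intro 4[OF _ refl]) auto
      qed
    qed
  qed
qed

lemma wp_walk:
  assumes inp: "inp s" and H: "H \<subseteq> V" "conn H" "indicates (s ''H'') H" "s ''h'' 0 = card H"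
    and th: "s ''th'' 0 = \<theta>" "0 < \<theta>" "\<theta> \<le> card H"
  shows "wp (n * (n * (m + 1))) walk (\<lambda>s'. walked H \<theta> (s' ''z'' 0) (s' ''cls'') (s' ''pc'')) s"
proof -
  let ?u = "indicator ''K'' (eq (Cell ''H'' (var ''v'')) (Const 1))"
  let ?I = "\<lambda>s'. s' ''st'' 0 = 1 \<and> walked H \<theta> (s' ''z'' 0) (s' ''cls'') (s' ''pc'') \<or>
    s' ''st'' 0 = 0 \<and> (\<exists>K. core H \<theta> K \<and> indicates (s' ''K'') K)"
  \<comment> \<open>The set \<open>K\<close> shrinks in every round; as it is never empty, the value
    0 is free for the stopped state.\<close>
  let ?\<mu> = "\<lambda>s'. if s' ''st'' 0 = 1 then 0 else card {v \<in> V. s' ''K'' v = 1}"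
  have HV: "{v \<in> V. s ''H'' v = 1} = H"
    using H by (auto simp: indicates_def split: if_splits)
  have u: "wp n ?u (\<lambda>s'. indicates (s' ''K'') {v \<in> V. s ''H'' v = 1}) s"
    by (rule wp_indicator[OF inp]) (auto simp: agree_def)
  show ?thesis
    unfolding walk_def
  proof (rule wp_Seq[OF wp_weaken[OF u time_bounds(6)]])
    fix s1
    assume 1: "indicates (s1 ''K'') {v \<in> V. s ''H'' v = 1}" and ag1: "agree (writes ?u) s s1"
    let ?s2 = "s1(''st'' := (s1 ''st'')(0 := expr_val (Const 0) s1))"
    have ag2: "agree {''i'', ''v'', ''K'', ''st''} s ?s2"
      using ag1 by (auto simp: agree_def)
    have "core H \<theta> H" using H th by (simp add: core_def)
    then have I2: "?I ?s2" using 1 HV by auto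
    have "wp (n * (n * (m + 1))) (While (eq (var ''st'') (Const 0)) walk_step)
      (\<lambda>s'. ?I s' \<and> \<not> cond_val (eq (var ''st'') (Const 0)) s') ?s2"
    proof (rule wp_While[where \<mu> = ?\<mu>])
      show "?\<mu> ?s2 \<le> n" by (auto intro: card_mono)
      show "?I ?s2" by (rule I2)
      fix s'
      assume I: "?I s'" and ag3: "agree (writes walk_step) ?s2 s'"
        and b: "cond_val (eq (var ''st'') (Const 0)) s'"
      then obtain K where K: "core H \<theta> K" "indicates (s' ''K'') K" and st: "s' ''st'' 0 = 0"
        by auto
      have ag: "agree (writes walk) s s'"
        by (rule agree_trans[OF ag2 ag3]) auto
      have inp': "inp s'" using inp_agree[OF ag _ inp] by simp
      have card: "card {v \<in> V. h v = 1} = card L" if "core H \<theta> L" "indicates h L" for h L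
        using that H(1) by (intro card_indicates) (auto simp: core_def)
      have "wp (n * (m + 1)) walk_step (\<lambda>s''.
        s'' ''st'' 0 = 1 \<and> walked H \<theta> (s'' ''z'' 0) (s'' ''cls'') (s'' ''pc'') \<or>
        s'' ''st'' 0 = 0 \<and> (\<exists>K'. core H \<theta> K' \<and> indicates (s'' ''K'') K' \<and> card K' < card K)) s'"
        using ag H th K st by (intro wp_walk_step[OF inp']) (auto simp: agree_def)
      then show "wp (n * (m + 1)) walk_step (\<lambda>s''. ?I s'' \<and> ?\<mu> s'' < ?\<mu> s') s'"
      proof (rule wp_weaken[OF _ order_refl])
        fix s''
        have "0 < card K" using K(1) H(1) conn_nonempty
          by (auto simp: core_def card_gt_0_iff intro: finite_subset[OF _ finite_V])
        moreover assume "s'' ''st'' 0 = 1 \<and> walked H \<theta> (s'' ''z'' 0) (s'' ''cls'') (s'' ''pc'') \<or>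
          s'' ''st'' 0 = 0 \<and> (\<exists>K'. core H \<theta> K' \<and> indicates (s'' ''K'') K' \<and> card K' < card K)"
        ultimately show "?I s'' \<and> ?\<mu> s'' < ?\<mu> s'"
          using card[OF K] st card by auto
      qed
    qed simp_all
    then have "wp (n * (n * (m + 1))) (While (eq (var ''st'') (Const 0)) walk_step)
        (\<lambda>s'. walked H \<theta> (s' ''z'' 0) (s' ''cls'') (s' ''pc'')) ?s2"
      by (rule wp_weaken[OF _ order_refl]) auto
    then show "wp (n * (n * (m + 1))) (''st'' ::= Const 0 ;; While (eq (var ''st'') (Const 0)) walk_step)
        (\<lambda>s'. walked H \<theta> (s' ''z'' 0) (s' ''cls'') (s' ''pc'')) s1"
      by (intro wp_assign_seq) simp_all
  qed
qed

end

section \<open>Cutting a set and moving branches\<close>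

text \<open>
  A cut of \<open>H\<close> is reported by \<open>fl = 1\<close>: one side is stored in \<open>X\<close>, and the piece that was glued last
  is the piece of \<open>e\<close>. Otherwise \<open>fl = 0\<close> and \<open>z\<close> is a centre.
\<close>

definition splitter :: "nat \<Rightarrow> expr \<Rightarrow> prog" where
  "splitter l e =
     indicator ''H'' (eq (Cell ''part'' (var ''v'')) (Const l)) ;;
     count ''h'' (eq (Cell ''part'' (var ''v'')) (Const l)) ;;
     ''th'' ::= e ;; walk ;; find"

lemma writes_splitter [simp]:
  "writes (splitter l e) = {''H'', ''h'', ''th''} \<union> writes walk \<union> writes find"
  by (auto simp: splitter_def)

text \<open>
  Shrinks part 0 around its centre \<open>u\<close>. A branch that would bring it down to \<open>T\<close> gets the free label 3
  instead of joining its neighbour, which is recorded by \<open>dn = 1\<close>.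
\<close>

definition move :: prog where
  "move =
     indicator ''cls'' (eq (Cell ''part'' (var ''v'')) (Const 0)) ;;
     Store ''cls'' (var ''u'') (Const 0) ;; comps ;;
     count ''k'' (eq (Cell ''part'' (var ''v'')) (Const 0)) ;; ''dn'' ::= Const 0 ;;
     for_arcs (If (Conj (eq (var ''dn'') (Const 0)) (Conj (eq (Cell ''part'' (var ''p'')) (Const 0))
         (Conj (Neg (eq (var ''p'') (var ''u''))) (Less (Const 0) (Cell ''part'' (var ''q''))))))
       (count ''c'' (eq (Cell ''pc'' (var ''v'')) (Cell ''pc'' (var ''p''))) ;;
        If (Less (Add (var ''T'') (var ''c'')) (var ''k''))
          (''k'' ::= Sub (var ''k'') (var ''c'') ;; ''a'' ::= Cell ''part'' (var ''q''))
          (''dn'' ::= Const 1 ;; ''k'' ::= Sub (var ''k'') (var ''c'') ;; ''a'' ::= Const 3) ;;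
        update ''part'' (eq (Cell ''pc'' (var ''v'')) (Cell ''pc'' (var ''p''))) (var ''a'')) Skip)"

lemma writes_move [simp]:
  "writes move = {''i'', ''v'', ''j'', ''p'', ''q'', ''a'', ''b'', ''c'', ''cls'', ''pc'', ''k'', ''dn'',
     ''part''}"
  by (auto simp: move_def)

context graph_input begin

section \<open>Blocks of a labelling, cuts and centres\<close>

definition block :: "(nat \<Rightarrow> nat) \<Rightarrow> nat \<Rightarrow> nat set" where
  "block P l = {v \<in> V. P v = l}"

lemma block_subset: "block P l \<subseteq> V"
  by (auto simp: block_def)

lemma finite_block [simp]: "finite (block P l)"
  by (simp add: block_def)

definition center :: "nat set \<Rightarrow> nat \<Rightarrow> nat \<Rightarrow> bool" where
  "center H \<theta> z \<longleftrightarrow> z \<in> H \<and> (\<forall>Z. conn Z \<longrightarrow> Z \<subseteq> H - {z} \<longrightarrow> card Z < \<theta>)"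

text \<open>The two alternatives are those of \<open>segment\<close>. A single large piece leaves at
  least \<theta> vertices on the other side; in the glued case card X \<le> 2\<theta> - 2, and
  \<open>X\<close> can be divided further into \<open>Y\<close> and \<open>X - Y\<close>.\<close>

definition cut :: "nat set \<Rightarrow> nat \<Rightarrow> nat set \<Rightarrow> nat set \<Rightarrow> bool" where
  "cut H \<theta> X Y \<longleftrightarrow> X \<subset> H \<and> conn X \<and> conn (H - X) \<and> \<theta> \<le> card X \<and> Y \<subseteq> X \<and>
     (card X + \<theta> \<le> card H \<or> card Y < \<theta> \<and> card (X - Y) < \<theta> \<and> conn Y \<and> conn (X - Y))"

lemma walked_support: "walked H \<theta> z f c \<Longrightarrow> {v \<in> V. 0 < f v} = H - {z}"
  by (auto simp: walked_def star_def)

lemma walked_bounded: "walked H \<theta> z f c \<Longrightarrow> bounded f \<theta> \<Longrightarrow> center H \<theta> z"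
  using walked_support[of H \<theta> z f c] by (auto simp: bounded_def center_def walked_def star_def)

text \<open>A union of branches can be removed without disconnecting \<open>H\<close>. If
  \<open>X\<close> is one branch, it is not below \<theta>, so \<open>walked\<close> provides the
  bound for the other side.\<close>

lemma walked_segment:
  assumes w: "walked H \<theta> z f c" and s: "segment f c \<theta> X e"
  shows "cut H \<theta> X (piece c e)"
proof -
  have X: "X \<subseteq> H - {z}" "conn X" "\<And>x. x \<in> X \<Longrightarrow> piece c x \<subseteq> X" "e \<in> X" "\<theta> \<le> card X"
    using s walked_support[OF w] by (auto simp: segment_def)
  have "conn (H - X)" "z \<in> H"
    using w star_remove[OF _ X(1,3)] by (auto simp: walked_def star_def)
  moreover have "conn (piece c e)"
  proof (rule piece_conn)
    show "is_pieces f c" using w by (simp add: walked_def)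
    show "e \<in> V" using s by (auto simp: segment_def)
  qed
  moreover have "card X + \<theta> \<le> card H" if "X = piece c e"
  proof -
    have "e \<in> H - {z}" using X by blast
    then have "card (piece c e) < \<theta> \<or> card (piece c e) + \<theta> \<le> card H"
      using w by (auto simp: walked_def)
    then show ?thesis using X(5) that by auto
  qed
  ultimately show ?thesis
    using X s unfolding cut_def segment_def by blast
qed

text \<open>The threshold is an expression because it may refer to \<open>h\<close>, the size of the
  part, which is only known after the count.\<close>

lemma wp_splitter:
  assumes inp: "inp s" and H: "block (s ''part'') l = H" "conn H"
    and e: "\<And>s'. agree {''i'', ''v'', ''H'', ''h''} s s' \<Longrightarrow> s' ''h'' 0 = card H \<Longrightarrow> expr_val e s' = \<theta>"
    and th: "0 < \<theta>" "\<theta> \<le> card H"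
  shows "wp (n * (n * (m + 1))) (splitter l e) (\<lambda>s'. if s' ''fl'' 0 = 1
    then \<exists>X. indicates (s' ''X'') X \<and> cut H \<theta> X (piece (s' ''pc'') (s' ''e'' 0))
    else s' ''fl'' 0 = 0 \<and> center H \<theta> (s' ''z'' 0)) s"
    (is "wp ?F _ ?Q s")
  unfolding splitter_def
proof (rule wp_Seq[OF wp_weaken[OF _ time_bounds(6)]])
  let ?b = "eq (Cell ''part'' (var ''v'')) (Const l)"
  show "wp n (indicator ''H'' ?b) (\<lambda>s'. indicates (s' ''H'') {v \<in> V. s ''part'' v = l}) s"
    by (rule wp_indicator[OF inp]) (auto simp: agree_def)
  fix s1
  assume 1: "indicates (s1 ''H'') {v \<in> V. s ''part'' v = l}" and ag1: "agree (writes (indicator ''H'' ?b)) s s1"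
  have inp1: "inp s1" using inp_agree[OF ag1 _ inp] by simp
  show "wp ?F (count ''h'' ?b ;; ''th'' ::= e ;; walk ;; find) ?Q s1"
  proof (rule wp_Seq[OF wp_weaken[OF _ time_bounds(6)]])
    show "wp n (count ''h'' ?b) (\<lambda>s'. s' ''h'' 0 = card {v \<in> V. s ''part'' v = l}) s1"
      using ag1 by (intro wp_count[OF inp1]) (auto simp: agree_def)
    fix s2
    assume 2: "s2 ''h'' 0 = card {v \<in> V. s ''part'' v = l}" and ag2: "agree (writes (count ''h'' ?b)) s1 s2"
    have ag: "agree {''i'', ''v'', ''H'', ''h''} s s2"
      by (rule agree_trans[OF ag1 ag2]) auto
    have h: "s2 ''h'' 0 = card H" "indicates (s2 ''H'') H"
      using 1 2 H ag2 by (auto simp: block_def agree_def)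
    show "wp ?F (''th'' ::= e ;; walk ;; find) ?Q s2"
    proof (rule wp_Seq[OF wp_assign[OF time_bounds(9)]])
      fix s3
      assume 3: "s3 ''th'' 0 = expr_val e s2" and ag3: "agree (writes (''th'' ::= e)) s2 s3"
      have th3: "s3 ''th'' 0 = \<theta>" using 3 e[OF ag h(1)] by simp
      have ag': "agree {''i'', ''v'', ''H'', ''h'', ''th''} s s3"
        by (rule agree_trans[OF ag ag3]) auto
      have inp3: "inp s3" using inp_agree[OF ag' _ inp] by simp
      have h3: "s3 ''h'' 0 = card H" "indicates (s3 ''H'') H"
        using h ag3 by (auto simp: agree_def)
      have HV: "H \<subseteq> V" using H block_subset by blast
      show "wp ?F (walk ;; find) ?Q s3"
      proof (rule wp_Seq[OF wp_walk[OF inp3 HV H(2) h3(2,1) th3 th]])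
        fix s4
        assume w: "walked H \<theta> (s4 ''z'' 0) (s4 ''cls'') (s4 ''pc'')" and ag4: "agree (writes walk) s3 s4"
        have inp4: "inp s4" using inp_agree[OF ag4 _ inp3] by simp
        have th4: "s4 ''th'' 0 = \<theta>" using ag4 th3 by (simp add: agree_def)
        have pcs: "is_pieces (s4 ''cls'') (s4 ''pc'')" using w by (simp add: walked_def)
        show "wp ?F find ?Q s4"
        proof (rule wp_weaken[OF wp_find[OF inp4 pcs th4 th(1)] order_refl])
          fix s5
          assume 5: "if s5 ''fl'' 0 = 1
            then \<exists>X. segment (s4 ''cls'') (s4 ''pc'') \<theta> X (s5 ''e'' 0) \<and> indicates (s5 ''X'') X
            else s5 ''fl'' 0 = 0 \<and> bounded (s4 ''cls'') \<theta>" and ag5: "agree (writes find) s4 s5"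
          have "s5 ''pc'' = s4 ''pc''" "s5 ''z'' = s4 ''z''" using ag5 by (auto simp: agree_def)
          then show "?Q s5"
            using 5 walked_bounded[OF w] walked_segment[OF w] by (auto split: if_splits)
        qed
      qed
    qed
  qed
qed

section \<open>Moving branches from part 0 to its neighbours\<close>

definition labelled :: "(nat \<Rightarrow> nat) \<Rightarrow> bool" where
  "labelled P \<longleftrightarrow> (\<forall>v\<in>V. P v < 4) \<and> (\<forall>l. block P l = {} \<or> conn (block P l))"

text \<open>Connectedness is demanded for positive labels only. As \<open>P'\<close> is constant on
  pieces, block 0 is always a star without some whole branches, and \<open>moving_final\<close>
  recovers its connectedness. The last conjunct keeps label 2 free for later cuts.\<close>

definition moving :: "(nat \<Rightarrow> nat) \<Rightarrow> nat \<Rightarrow> (nat \<Rightarrow> nat) \<Rightarrow> (nat \<Rightarrow> nat) \<Rightarrow> bool" where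
  "moving P u c P' \<longleftrightarrow> (\<forall>v\<in>V. P' v < 4) \<and> (\<forall>v\<in>V. P v \<noteq> 0 \<longrightarrow> P' v = P v) \<and> P' u = 0 \<and>
     (\<forall>v\<in>V. \<forall>x\<in>V. c v = c x \<longrightarrow> P' v = P' x) \<and> (\<forall>l>0. block P' l = {} \<or> conn (block P' l)) \<and>
     (block P 2 = {} \<longrightarrow> block P' 2 = {})"

text \<open>The branch of \<open>p\<close> either joins the block of the neighbour \<open>q\<close>,
  where the arc keeps that block connected, or opens the empty block 3 alone.\<close>

lemma moving_step:
  assumes P': "moving P u c P'" and pcs: "is_pieces f c" and st: "star (block P 0) u c"
    and arc: "(p, q) \<in> arcs" "p \<in> block P' 0" "p \<noteq> u" and Q: "Q = (\<lambda>v. if v \<in> V \<and> c v = c p then l else P' v)"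
    and l: "0 < l" "l = P' q \<or> l = 3 \<and> block P' 3 = {}" "l < 4"
  shows "moving P u c Q" "block Q 0 = block P' 0 - piece c p" "block Q l = block P' l \<union> piece c p"
    "piece c p \<subseteq> block P' 0 - {u}" "l \<noteq> 3 \<Longrightarrow> block Q 3 = block P' 3"
proof -
  have V: "p \<in> V" "q \<in> V" using arcs_V arc by auto
  have uV: "u \<in> V" using st by (auto simp: star_def block_def)
  have lt4: "\<forall>v\<in>V. P' v < 4"
    and fixed: "\<And>v. v \<in> V \<Longrightarrow> P v \<noteq> 0 \<Longrightarrow> P' v = P v" and u: "P' u = 0"
    and const: "\<And>v x. v \<in> V \<Longrightarrow> x \<in> V \<Longrightarrow> c v = c x \<Longrightarrow> P' v = P' x"
    and conns: "\<And>l. 0 < l \<Longrightarrow> block P' l = {} \<or> conn (block P' l)"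
    and two: "block P 2 = {} \<Longrightarrow> block P' 2 = {}"
    using P' unfolding moving_def by blast+
  have "P' p = 0" using arc(2) by (simp add: block_def)
  then have sub0: "piece c p \<subseteq> block P' 0"
    using const[OF _ V(1)] by (auto simp: piece_def block_def)
  have "P p = 0" using fixed[OF V(1)] \<open>P' p = 0\<close> by auto
  then have "p \<in> block P 0 - {u}" using V arc(3) by (simp add: block_def)
  then have sub: "piece c p \<subseteq> block P 0 - {u}"
    using st by (auto simp: star_def)
  then show sub': "piece c p \<subseteq> block P' 0 - {u}" using sub0 by blast
  have blocks: "block Q k = (if k = l then block P' k \<union> piece c p else block P' k - piece c p)" for k
    using Q l(1) by (auto simp: block_def piece_def)
  show b0: "block Q 0 = block P' 0 - piece c p" using blocks l(1) by simp
  show bl: "block Q l = block P' l \<union> piece c p" using blocks by simp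
  have disj: "block P' k - piece c p = block P' k" if "0 < k" for k
    using sub0 that by (auto simp: block_def)
  then show "l \<noteq> 3 \<Longrightarrow> block Q 3 = block P' 3" using blocks[of 3] by auto
  have pc: "conn (piece c p)" using piece_conn[OF pcs V(1)] .
  have conn_l: "conn (block Q l)"
  proof (cases "l = P' q")
    case True
    then have "q \<in> block P' l" using V by (simp add: block_def)
    then have "conn (block P' l)" using conns[OF l(1)] by blast
    then have "conn (piece c p \<union> block P' l)"
      using pc arc(1) \<open>q \<in> block P' l\<close> piece_refl[OF V(1)] by (intro conn_Un_arc) auto
    then show ?thesis by (simp add: bl Un_commute)
  next
    case False
    then show ?thesis using l(2) pc bl by simp
  qed
  have "block Q k = {} \<or> conn (block Q k)" if "0 < k" for k
    using conn_l blocks[of k] disj[OF that] conns[OF that] by (cases "k = l") simp_all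
  moreover have "block Q 2 = {}" if "block P 2 = {}"
  proof -
    have "block P' 2 = {}" using two that .
    moreover from this have "l \<noteq> 2" using l(2) V by (auto simp: block_def)
    ultimately show ?thesis using blocks[of 2] by simp
  qed
  moreover have "Q v = P v" if "v \<in> V" "P v \<noteq> 0" for v
  proof -
    have "v \<notin> piece c p" using sub that by (auto simp: block_def)
    then show ?thesis using fixed[OF that] Q that(1) by (simp add: piece_def)
  qed
  moreover have "Q u = 0"
  proof -
    have "u \<notin> piece c p" using sub by blast
    then show ?thesis using u Q uV by (simp add: piece_def)
  qed
  moreover have "Q v = Q x" if "v \<in> V" "x \<in> V" "c v = c x" for v x
    using const[OF that] that unfolding Q by simp
  moreover have "\<forall>v\<in>V. Q v < 4" using lt4 l(3) Q by simp
  ultimately show "moving P u c Q"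
    unfolding moving_def by blast
qed

text \<open>When a branch was split off, blocks 0 and 3 together are still connected and above
  \<tau>, so that the split can be undone. Otherwise the branches adjacent to other parts have run
  out, and no vertex of block 0 except \<open>u\<close> has a neighbour outside it.\<close>

definition moved :: "(nat \<Rightarrow> nat) \<Rightarrow> nat \<Rightarrow> nat \<Rightarrow> (nat \<Rightarrow> nat) \<Rightarrow> bool \<Rightarrow> bool" where
  "moved P u \<tau> P' done \<longleftrightarrow> labelled P' \<and> u \<in> block P' 0 \<and> block P' 0 \<subseteq> block P 0 \<and>
     block P' 3 \<subseteq> block P 0 - {u} \<and> block P 1 \<subseteq> block P' 1 \<and> block P 2 \<subseteq> block P' 2 \<and>
     (block P 2 = {} \<longrightarrow> block P' 2 = {}) \<and>
     (if done then card (block P' 0) \<le> \<tau> \<and> block P' 3 \<noteq> {} \<and>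
        \<tau> < card (block P' 0 \<union> block P' 3) \<and> conn (block P' 0 \<union> block P' 3)
      else \<tau> < card (block P' 0) \<and> block P' 3 = {} \<and>
        (\<forall>p q. (p, q) \<in> arcs \<longrightarrow> p \<in> block P' 0 \<longrightarrow> p \<noteq> u \<longrightarrow> q \<in> block P' 0))"

lemma moving_final:
  assumes P': "moving P u c P'" and st: "star (block P 0) u c" and P3: "block P 3 = {}"
  shows "labelled P'" "u \<in> block P' 0" "block P' 0 \<subseteq> block P 0" "block P' 3 \<subseteq> block P 0 - {u}"
    "block P 1 \<subseteq> block P' 1" "block P 2 \<subseteq> block P' 2" "conn (block P' 0 \<union> block P' 3)"
proof -
  have lt4: "\<forall>v\<in>V. P' v < 4"
    and fixed: "\<And>v. v \<in> V \<Longrightarrow> P v \<noteq> 0 \<Longrightarrow> P' v = P v" and u: "P' u = 0"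
    and const: "\<And>v x. v \<in> V \<Longrightarrow> x \<in> V \<Longrightarrow> c v = c x \<Longrightarrow> P' v = P' x"
    and conns: "\<And>l. 0 < l \<Longrightarrow> block P' l = {} \<or> conn (block P' l)"
    using P' unfolding moving_def by blast+
  have uV: "u \<in> V" using st by (auto simp: star_def block_def)
  then show "u \<in> block P' 0" using u by (simp add: block_def)
  show sub0: "block P' 0 \<subseteq> block P 0"
  proof
    fix v assume "v \<in> block P' 0"
    then have "v \<in> V" "P' v = 0" by (simp_all add: block_def)
    moreover from this have "P v = 0" using fixed[of v] by (cases "P v = 0") simp_all
    ultimately show "v \<in> block P 0" by (simp add: block_def)
  qed
  have "P v = 0" if "v \<in> V" "P' v = 3" for v
    using fixed[OF that(1)] P3 that by (auto simp: block_def)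
  then show sub3: "block P' 3 \<subseteq> block P 0 - {u}"
    using u by (auto simp: block_def)
  show "block P 1 \<subseteq> block P' 1" "block P 2 \<subseteq> block P' 2"
    using fixed by (auto simp: block_def)
  \<comment> \<open>Labels are constant on pieces, so what was moved away is a union of branches.
    The set \<open>{0}\<close> yields the remaining part, \<open>{0, 3}\<close> the part before the
    last branch was split off.\<close>
  have removed: "conn (block P 0 - {v \<in> block P 0. P' v \<notin> A})" if "0 \<in> A" for A
  proof (rule star_remove[OF st])
    show "{v \<in> block P 0. P' v \<notin> A} \<subseteq> block P 0 - {u}" using u that by auto
    fix x assume x: "x \<in> {v \<in> block P 0. P' v \<notin> A}"
    then have "x \<in> block P 0 - {u}" using u that by auto
    then have "piece c x \<subseteq> block P 0 - {u}" using st unfolding star_def by blast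
    moreover have "P' v = P' x" if "v \<in> piece c x" for v
      using const[of v x] that x by (auto simp: piece_def block_def)
    ultimately show "piece c x \<subseteq> {v \<in> block P 0. P' v \<notin> A}" using x by auto
  qed
  have "block P 0 - {v \<in> block P 0. P' v \<notin> {0}} = block P' 0"
    using sub0 by (auto simp: block_def)
  then have "conn (block P' 0)" using removed[of "{0}"] by simp
  then have "block P' l = {} \<or> conn (block P' l)" for l
    using conns[of l] by (cases "l = 0") auto
  then show "labelled P'"
    using lt4 unfolding labelled_def by blast
  have "block P 0 - {v \<in> block P 0. P' v \<notin> {0, 3}} = block P' 0 \<union> block P' 3"
    using sub0 sub3 by (auto simp: block_def)
  then show "conn (block P' 0 \<union> block P' 3)" using removed[of "{0, 3}"] by simp
qed

text \<open>One pass over the arcs is enough: a processed arc whose first end is still in block 0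
  and differs from \<open>u\<close> has its second end in block 0 too, and later moves take both
  ends or neither.\<close>

lemma wp_move:
  assumes inp: "inp s" and P: "s ''part'' = P" "labelled P" "block P 3 = {}"
    and u: "s ''u'' 0 = u" "u \<in> block P 0" and T: "s ''T'' 0 = \<tau>" "\<tau> < card (block P 0)"
  shows "wp (n * (m + 1)) move (\<lambda>s'. s' ''dn'' 0 \<le> 1 \<and> moved P u \<tau> (s' ''part'') (s' ''dn'' 0 = 1)) s"
    (is "wp ?F _ ?Q s")
proof -
  let ?ind = "indicator ''cls'' (eq (Cell ''part'' (var ''v'')) (Const 0))"
  let ?cnt = "count ''k'' (eq (Cell ''part'' (var ''v'')) (Const 0))"
  let ?b = "Conj (eq (var ''dn'') (Const 0)) (Conj (eq (Cell ''part'' (var ''p'')) (Const 0))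
         (Conj (Neg (eq (var ''p'') (var ''u''))) (Less (Const 0) (Cell ''part'' (var ''q'')))))"
  let ?c = "count ''c'' (eq (Cell ''pc'' (var ''v'')) (Cell ''pc'' (var ''p'')))"
  let ?i = "If (Less (Add (var ''T'') (var ''c'')) (var ''k''))
          (''k'' ::= Sub (var ''k'') (var ''c'') ;; ''a'' ::= Cell ''part'' (var ''q''))
          (''dn'' ::= Const 1 ;; ''k'' ::= Sub (var ''k'') (var ''c'') ;; ''a'' ::= Const 3)"
  let ?u = "update ''part'' (eq (Cell ''pc'' (var ''v'')) (Cell ''pc'' (var ''p''))) (var ''a'')"
  let ?p = "If ?b (?c ;; ?i ;; ?u) Skip"
  let ?M = "block P 0"
  have M: "conn ?M" "?M \<subseteq> V" using P(2) u(2) block_subset by (auto simp: labelled_def)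
  have "wp n ?ind (\<lambda>s'. indicates (s' ''cls'') {v \<in> V. P v = 0}) s"
    by (rule wp_indicator[OF inp]) (auto simp: agree_def P)
  then have "wp ?F (?ind ;; Store ''cls'' (var ''u'') (Const 0) ;; comps ;; ?cnt ;;
      ''dn'' ::= Const 0 ;; for_arcs ?p) ?Q s"
  proof (rule wp_Seq[OF wp_weaken[OF _ time_bounds(1)]])
    fix s1
    assume 1: "indicates (s1 ''cls'') {v \<in> V. P v = 0}" and ag1: "agree (writes ?ind) s s1"
    let ?s2 = "s1(''cls'' := (s1 ''cls'')(u := 0))"
    define f where "f = ?s2 ''cls''"
    have u1: "s1 ''u'' 0 = u" using ag1 u(1) by (simp add: agree_def)
    have f: "\<forall>y\<in>V. f y = (if y = u \<or> y \<notin> ?M then 0 else if y \<in> ?M then 1 else 2)"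
      using 1 by (auto simp: f_def indicates_def block_def)
    have ag2: "agree {''i'', ''v'', ''cls''} s ?s2" using ag1 by (auto simp: agree_def)
    have inp2: "inp ?s2" using inp_agree[OF ag2 _ inp] by simp
    have "wp ?F (comps ;; ?cnt ;; ''dn'' ::= Const 0 ;; for_arcs ?p) ?Q ?s2"
    proof (rule wp_Seq[OF wp_weaken[OF wp_comps[OF inp2] time_bounds(3)]])
      fix s3
      assume 3: "is_pieces (?s2 ''cls'') (s3 ''pc'')" and ag23: "agree (writes comps) ?s2 s3"
      define c where "c = s3 ''pc''"
      have pcs: "is_pieces f c" using 3 by (simp only: f_def c_def)
      have st: "star ?M u c"
        by (rule walk_pieces(1)[OF M(1) order_refl M(2) u(2) pcs _ f]) simp
      have ag3: "agree {''i'', ''v'', ''j'', ''p'', ''q'', ''a'', ''b'', ''cls'', ''pc''} s s3"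
        by (rule agree_trans[OF ag2 ag23]) auto
      have inp3: "inp s3" using inp_agree[OF ag3 _ inp] by simp
      have part3: "s3 ''part'' = P" using ag3 P(1) by (simp add: agree_def)
      have cnt: "wp n ?cnt (\<lambda>s'. s' ''k'' 0 = card {v \<in> V. P v = 0}) s3"
        by (rule wp_count[OF inp3]) (auto simp: agree_def part3)
      show "wp ?F (?cnt ;; ''dn'' ::= Const 0 ;; for_arcs ?p) ?Q s3"
      proof (rule wp_Seq[OF wp_weaken[OF cnt time_bounds(1)]])
        fix s4
        assume 4: "s4 ''k'' 0 = card {v \<in> V. P v = 0}" and ag4: "agree (writes ?cnt) s3 s4"
        let ?s5 = "s4(''dn'' := (s4 ''dn'')(0 := expr_val (Const 0) s4))"
        have same5: "?s5 ''part'' = P" "?s5 ''pc'' = c" "?s5 ''u'' 0 = u" "?s5 ''T'' 0 = \<tau>"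
          "?s5 ''k'' 0 = card ?M" "?s5 ''dn'' 0 = 0"
          using ag3 ag4 4 u(1) T(1) P(1) by (simp_all add: agree_def c_def block_def)
        have ag5: "agree (writes move) s ?s5"
          using ag3 ag4 by (auto simp: agree_def)
        have inp5: "inp ?s5" using inp_agree[OF ag5 _ inp] by simp
        let ?I = "\<lambda>D s'. moving P u c (s' ''part'') \<and> s' ''k'' 0 = card (block (s' ''part'') 0) \<and>
          (s' ''dn'' 0 = 0 \<and> \<tau> < card (block (s' ''part'') 0) \<and> block (s' ''part'') 3 = {} \<and>
             (\<forall>p q. (p, q) \<in> D \<longrightarrow> p \<in> block (s' ''part'') 0 \<longrightarrow> p \<noteq> u \<longrightarrow> q \<in> block (s' ''part'') 0) \<or>
           s' ''dn'' 0 = 1 \<and> card (block (s' ''part'') 0) \<le> \<tau> \<and> block (s' ''part'') 3 \<noteq> {} \<and>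
             \<tau> < card (block (s' ''part'') 0 \<union> block (s' ''part'') 3))"
        \<comment> \<open>Pieces of class 0 are single vertices and those of class 1 lie in block 0,
          so \<open>P\<close> is constant on pieces at the start.\<close>
        have I0: "moving P u c P"
        proof -
          have "P v = P x" if "v \<in> V" "x \<in> V" "c v = c x" for v x
          proof -
            have vx: "v \<in> piece c x" using that by (simp add: piece_def)
            have *: "P y = 0" if y: "y \<in> V" "f y \<noteq> 0" for y
              using bspec[OF f y(1)] y(2) by (auto simp: block_def split: if_splits)
            have "f v = f x" by (rule piece_class[OF pcs that(2) vx])
            moreover have "v = x" if "f x = 0"
              using piece_zero[OF pcs \<open>x \<in> V\<close> that] vx by simp
            ultimately show ?thesis using *[OF that(1)] *[OF that(2)] by (cases "f x = 0") simp_all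
          qed
          moreover have "P u = 0" using u(2) by (simp add: block_def)
          ultimately show ?thesis
            using P(2) unfolding moving_def labelled_def by blast
        qed
        have "wp (m * n) (for_arcs ?p) (?I arcs) ?s5"
        proof (rule wp_for_arcs[where I = ?I, OF inp5])
          fix D p q s6
          assume D: "D \<subseteq> arcs" and arc: "(p, q) \<in> arcs" and I: "?I D s6"
            and pq: "s6 ''p'' 0 = p" "s6 ''q'' 0 = q"
            and ag6: "agree ({''j'', ''p'', ''q''} \<union> writes ?p) ?s5 s6"
          have inp6: "inp s6" using inp_agree[OF ag6 _ inp5] by simp
          have same6: "s6 ''pc'' = c" "s6 ''u'' 0 = u" "s6 ''T'' 0 = \<tau>"
            using ag6 same5 by (auto simp: agree_def)
          have V: "p \<in> V" "q \<in> V" using arcs_V arc by auto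
          define R where "R = s6 ''part''"
          show "wp n ?p (?I (insert (p, q) D)) s6"
          proof (rule wp_If)
            assume "cond_val ?b s6"
            then have b: "s6 ''dn'' 0 = 0" "R p = 0" "p \<noteq> u" "0 < R q"
              using pq same6 by (simp_all add: R_def)
            have R: "moving P u c R" "s6 ''k'' 0 = card (block R 0)" "\<tau> < card (block R 0)"
              "block R 3 = {}"
              "\<And>a b. (a, b) \<in> D \<Longrightarrow> a \<in> block R 0 \<Longrightarrow> a \<noteq> u \<Longrightarrow> b \<in> block R 0"
              using I b(1) unfolding R_def[symmetric] by auto
            have p0: "p \<in> block R 0" using b V by (simp add: block_def)
            have q4: "R q < 4" using R(1) V unfolding moving_def by blast
            have cnt: "wp n ?c (\<lambda>s'. s' ''c'' 0 = card {v \<in> V. c v = c p}) s6"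
              by (rule wp_count[OF inp6]) (auto simp: agree_def same6 pq)
            show "wp n (?c ;; ?i ;; ?u) (?I (insert (p, q) D)) s6"
            proof (rule wp_Seq[OF cnt])
              fix s7
              assume c7: "s7 ''c'' 0 = card {v \<in> V. c v = c p}" and ag7: "agree (writes ?c) s6 s7"
              have inp7: "inp s7" using inp_agree[OF ag7 _ inp6] by simp
              have same7: "s7 ''part'' = R" "s7 ''pc'' = c" "s7 ''T'' 0 = \<tau>" "s7 ''k'' 0 = card (block R 0)"
                "s7 ''p'' 0 = p" "s7 ''q'' 0 = q" "s7 ''dn'' 0 = 0" "s7 ''c'' 0 = card (piece c p)"
                using ag7 same6 R(2) b(1) pq c7 by (simp_all add: agree_def R_def piece_def)
              have i: "wp n ?i (\<lambda>s'. s' ''k'' 0 = card (block R 0) - card (piece c p) \<and>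
                (if \<tau> + card (piece c p) < card (block R 0)
                 then s' ''dn'' 0 = 0 \<and> s' ''a'' 0 = R q else s' ''dn'' 0 = 1 \<and> s' ''a'' 0 = 3)) s7"
                by (intro wp_If wp_assign_seq wp_assign') (auto simp: same7)
              show "wp n (?i ;; ?u) (?I (insert (p, q) D)) s7"
              proof (rule wp_Seq[OF i])
                fix s8
                assume 8: "s8 ''k'' 0 = card (block R 0) - card (piece c p) \<and>
                (if \<tau> + card (piece c p) < card (block R 0)
                 then s8 ''dn'' 0 = 0 \<and> s8 ''a'' 0 = R q else s8 ''dn'' 0 = 1 \<and> s8 ''a'' 0 = 3)"
                  and ag8: "agree (writes ?i) s7 s8"
                have inp8: "inp s8" using inp_agree[OF ag8 _ inp7] by simp
                have same8: "s8 ''part'' = R" "s8 ''pc'' = c" "s8 ''p'' 0 = p"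
                  using ag8 same7 by (simp_all add: agree_def)
                define l where "l = s8 ''a'' 0"
                have l: "0 < l" "l = R q \<or> l = 3 \<and> block R 3 = {}" "l < 4"
                  using 8 b(4) q4 R(4) by (auto simp: l_def split: if_splits)
                define Q where "Q = (\<lambda>v. if v \<in> V \<and> c v = c p then l else R v)"
                note step = moving_step[OF R(1) pcs st arc p0 b(3) Q_def l]
                have upd: "wp n ?u (\<lambda>s'. s' ''part'' = (\<lambda>v. if v \<in> V \<and> c v = c p then l else s8 ''part'' v)) s8"
                  by (rule wp_update[OF inp8]) (auto simp: agree_def same8 l_def)
                show "wp n ?u (?I (insert (p, q) D)) s8"
                proof (rule wp_weaken[OF upd order_refl])
                  fix s9
                  assume 9: "s9 ''part'' = (\<lambda>v. if v \<in> V \<and> c v = c p then l else s8 ''part'' v)"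
                    and ag9: "agree (writes ?u) s8 s9"
                  have Q9: "s9 ''part'' = Q" using 9 unfolding same8(1) Q_def .
                  have same9: "s9 ''k'' = s8 ''k''" "s9 ''dn'' = s8 ''dn''"
                    using ag9 by (auto simp: agree_def)
                  have piece_sub: "piece c p \<subseteq> block R 0" using step(4) by blast
                  have cardQ: "card (block Q 0) = card (block R 0) - card (piece c p)"
                    unfolding step(2) by (rule card_Diff_subset[OF finite_piece piece_sub])
                  have "\<tau> < card (block Q 0) \<and> block Q 3 = {} \<and>
                      (\<forall>x y. (x, y) \<in> insert (p, q) D \<longrightarrow> x \<in> block Q 0 \<longrightarrow> x \<noteq> u \<longrightarrow> y \<in> block Q 0)"
                    if "\<tau> + card (piece c p) < card (block R 0)"
                  proof (intro conjI allI impI)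
                    show "\<tau> < card (block Q 0)" using cardQ that by simp
                    have lq: "l = R q" using 8 that by (simp add: l_def)
                    then have "l \<noteq> 3" using R(4) V by (auto simp: block_def)
                    then show "block Q 3 = {}" using step(5) R(4) by simp
                    fix x y assume xy: "(x, y) \<in> insert (p, q) D" "x \<in> block Q 0" "x \<noteq> u"
                    have "p \<notin> block Q 0" using step(2) piece_refl[OF V(1)] by simp
                    then have "(x, y) \<in> D" "x \<noteq> p" using xy by auto
                    then have y0: "y \<in> block R 0" "(x, y) \<in> arcs"
                      using R(5)[of x y] xy D step(2) by auto
                    \<comment> \<open>If \<open>y\<close> left block 0 with this piece, its
                      neighbour \<open>x\<close> would have left too: neither is \<open>u\<close>,
                      so both are in class 1 and in the same piece.\<close>
                    have "y \<notin> piece c p"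
                    proof
                      assume y: "y \<in> piece c p"
                      have "block R 0 \<subseteq> ?M" by (rule moving_final(3)[OF R(1) st P(3)])
                      moreover have "x \<in> block R 0" using xy(2) step(2) by blast
                      ultimately have in_M: "x \<in> ?M" "y \<in> ?M" using y0(1) by blast+
                      have "y \<noteq> u" using y step(4) by blast
                      then have "f x = 1" "f y = 1"
                        using bspec[OF f, of x] bspec[OF f, of y] in_M xy(3) arcs_V[OF y0(2)] by simp_all
                      then have "x \<in> piece c p"
                        using piece_step[OF pcs y arcs_sym[OF y0(2)]] by simp
                      then show False using xy(2) step(2) by simp
                    qed
                    then show "y \<in> block Q 0" using y0(1) step(2) by simp
                  qed
                  moreover have "card (block Q 0) \<le> \<tau> \<and> block Q 3 \<noteq> {} \<and>
                      \<tau> < card (block Q 0 \<union> block Q 3)"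
                    if "\<not> \<tau> + card (piece c p) < card (block R 0)"
                  proof -
                    have "l = 3" using 8 that by (simp add: l_def)
                    then have "block Q 3 = piece c p" using step(3) R(4) by simp
                    moreover from this have "block Q 0 \<union> block Q 3 = block R 0"
                      using step(2) piece_sub by blast
                    ultimately show ?thesis
                      using cardQ that R(3) piece_refl[OF V(1), of c] by auto
                  qed
                  ultimately show "?I (insert (p, q) D) s9"
                    using step(1) 8 cardQ unfolding Q9 same9
                    by (cases "\<tau> + card (piece c p) < card (block R 0)") simp_all
                qed
              qed
            qed
          next
            assume nb: "\<not> cond_val ?b s6"
            have "q \<in> block R 0" if "s6 ''dn'' 0 = 0" "p \<in> block R 0" "p \<noteq> u"
              using nb that pq same6 V by (auto simp: R_def block_def)
            then show "wp n Skip (?I (insert (p, q) D)) s6"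
              using I unfolding R_def by (intro wp_Skip) auto
          qed simp
        qed (use same5 I0 P(3) T(2) in auto)
        then have "wp ?F (for_arcs ?p) (?I arcs) ?s5"
          using wp_weaken[OF _ time_bounds(3)] by (simp add: mult.commute)
        then have "wp ?F (for_arcs ?p) ?Q ?s5"
        proof (rule wp_weaken[OF _ order_refl])
          fix s6 assume I: "?I arcs s6"
          then have mv: "moving P u c (s6 ''part'')" by blast
          note fin = moving_final[OF mv st P(3)]
          have "block P 2 = {} \<longrightarrow> block (s6 ''part'') 2 = {}" using mv unfolding moving_def by blast
          then show "?Q s6"
            using I fin unfolding moved_def by auto
        qed
        then show "wp ?F (''dn'' ::= Const 0 ;; for_arcs ?p) ?Q s4"
          by (intro wp_assign_seq) simp_all
      qed
    qed
    then show "wp ?F (Store ''cls'' (var ''u'') (Const 0) ;; comps ;; ?cnt ;;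
      ''dn'' ::= Const 0 ;; for_arcs ?p) ?Q s1"
      by (intro wp_Store_seq) (simp_all add: u1)
  qed
  then show ?thesis unfolding move_def .
qed

section \<open>Lower bounds on the optimum\<close>

text \<open>The largest size certified by averaging over four parts, since 24/13 times n/4 is
  6n/13.\<close>

definition target :: nat where
  "target = 6 * n div 13"

text \<open>If one of two complementary parts has at least \<open>target + 1\<close> vertices, the
  other one has at most \<open>target + gap\<close>.\<close>

definition gap :: nat where
  "gap = n - 2 * target - 1"

lemma target_bounds: "13 * target \<le> 6 * n" "6 * n < 13 * target + 13"
  unfolding target_def by presburger+

text \<open>Stated against every feasible partition rather than the minimum, and without fractions,
  so that each lower bound can start from an arbitrary partition \<open>Q\<close>.\<close>

definition good :: "nat \<Rightarrow> bool" where
  "good k \<longleftrightarrow> (\<forall>Q. feasible_partition 4 V E Q \<longrightarrow> 13 * k \<le> 24 * partition_size Q)"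

lemma good_mono: "good k \<Longrightarrow> j \<le> k \<Longrightarrow> good j"
  unfolding good_def by (meson le_trans mult_le_mono2)

context
  fixes Q assumes Q: "feasible_partition 4 V E Q"
begin

lemma feasible_facts: "finite Q" "card Q = 4" "\<Union>Q = V" "disjoint Q"
  using Q card.infinite[of Q] unfolding feasible_partition_def partition_on_def by fastforce+

lemma feasible_conn: "S \<in> Q \<Longrightarrow> conn S"
  using Q by (simp add: feasible_partition_def)

lemma feasible_le: "S \<in> Q \<Longrightarrow> card S \<le> partition_size Q"
  using feasible_facts(1) by (simp add: partition_size_def)

lemma feasible_sum: "(\<Sum>S\<in>Q. card S) = n"
proof -
  have "card (\<Union>Q) = (\<Sum>S\<in>Q. card S)"
    using feasible_facts by (intro card_Union_disjoint) (auto intro: finite_subset[OF _ finite_V])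
  then show ?thesis using feasible_facts(3) by simp
qed

lemma feasible_unique: "S \<in> Q \<Longrightarrow> S' \<in> Q \<Longrightarrow> x \<in> S \<Longrightarrow> x \<in> S' \<Longrightarrow> S = S'"
  using feasible_facts(4) by (auto simp: disjoint_def)

lemma feasible_lower: "n \<le> 4 * partition_size Q"
proof -
  have "(\<Sum>S\<in>Q. card S) \<le> of_nat (card Q) * partition_size Q"
    by (rule sum_bounded_above) (rule feasible_le)
  then show ?thesis using feasible_sum feasible_facts(2) by simp
qed

text \<open>The parts in \<open>A\<close> are bounded only by the size of the partition; the others
  by \<open>k\<close>. All lower bounds that find small parts count n in this way.\<close>

lemma feasible_split:
  assumes "A \<subseteq> Q" "\<And>S. S \<in> Q - A \<Longrightarrow> card S \<le> k"
  shows "n \<le> card A * partition_size Q + (4 - card A) * k"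
proof -
  have fin: "finite A" using assms(1) feasible_facts(1) by (rule finite_subset)
  have "n = (\<Sum>S\<in>A. card S) + (\<Sum>S\<in>Q - A. card S)"
    using sum.subset_diff[OF assms(1) feasible_facts(1), of card] feasible_sum by simp
  also have "\<dots> \<le> of_nat (card A) * partition_size Q + of_nat (card (Q - A)) * k"
    using assms feasible_le by (intro add_mono sum_bounded_above) auto
  also have "card (Q - A) = 4 - card A"
    using card_Diff_subset[OF fin assms(1)] feasible_facts(2) by simp
  finally show ?thesis by simp
qed

end

lemma good_target: "k \<le> target \<Longrightarrow> good k"
proof -
  assume "k \<le> target"
  then have "13 * k \<le> 6 * n" using target_bounds(1) by linarith
  moreover have "n \<le> 4 * partition_size Q" if "feasible_partition 4 V E Q" for Q
    using feasible_lower[OF that] .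
  ultimately show "good k" unfolding good_def by fastforce
qed

text \<open>Substituting n = 2T + 1 + g into 6n < 13T + 13 leaves 6g < T + 7. The weaker multiples
  follow, with n \<ge> 4 excluding T = 0.\<close>

lemma gap_facts:
  assumes "2 * target + 2 \<le> n"
  shows "n = 2 * target + 1 + gap" "1 \<le> gap" "6 * gap \<le> target + 6" "gap \<le> target" "2 * gap \<le> target + 2"
    "2 * gap + gap \<le> target + 3"
proof -
  show 1: "n = 2 * target + 1 + gap" and 2: "1 \<le> gap"
    using assms by (simp_all add: gap_def)
  show 3: "6 * gap \<le> target + 6"
    using 1 target_bounds by linarith
  show "gap \<le> target" "2 * gap \<le> target + 2" "2 * gap + gap \<le> target + 3"
    using 1 2 3 card4 by linarith+
qed

text \<open>The three alternatives are what the arguments with centres deliver, with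
  \<open>gap - 1\<close> as the largest size of a trapped part. The first is the most demanding: it
  needs 61(g - 1) \<le> 11T + 11, whereas 6(g - 1) \<le> T holds.\<close>

lemma gap_arith:
  assumes "2 * target + 2 \<le> n"
    and "target + 1 \<le> s + 2 * (gap - 1) \<or> n \<le> s + 3 * (gap - 1) \<or> n \<le> 2 * s + 2 * (gap - 1)"
  shows "13 * (target + gap) \<le> 24 * s"
proof -
  obtain g where g: "gap = Suc g" using gap_facts(2)[OF assms(1)] by (cases gap) auto
  note facts = gap_facts(1,3)[OF assms(1), unfolded g]
  from assms(2) show ?thesis
    unfolding g diff_Suc_1
  proof (elim disjE)
    assume "target + 1 \<le> s + 2 * g"
    then have "24 * (target + 1) \<le> 24 * (s + 2 * g)" by simp
    then show "13 * (target + Suc g) \<le> 24 * s" using facts(2) by simp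
  next
    assume "n \<le> s + 3 * g"
    then have "24 * n \<le> 24 * (s + 3 * g)" by simp
    then show "13 * (target + Suc g) \<le> 24 * s" using facts by simp
  next
    assume "n \<le> 2 * s + 2 * g"
    then have "12 * n \<le> 12 * (2 * s + 2 * g)" by simp
    then show "13 * (target + Suc g) \<le> 24 * s" using facts by simp
  qed
qed

text \<open>At most two parts contain a centre; every other part is a connected subset of
  \<open>V - {u, w}\<close> and so has fewer than \<open>gap\<close> vertices.\<close>

lemma two_centers_good:
  assumes "2 * target + 2 \<le> n" "u \<in> V" "w \<in> V"
    and "\<And>Z. conn Z \<Longrightarrow> Z \<subseteq> V - {u, w} \<Longrightarrow> card Z < gap"
  shows "good (target + gap)"
  unfolding good_def
proof (intro allI impI)
  fix Q assume Q: "feasible_partition 4 V E Q"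
  obtain S T where S: "S \<in> Q" "u \<in> S" "T \<in> Q" "w \<in> T"
    using assms(2,3) feasible_facts(3)[OF Q] by blast
  have "n \<le> card {S, T} * partition_size Q + (4 - card {S, T}) * (gap - 1)"
  proof (rule feasible_split[OF Q])
    fix R assume R: "R \<in> Q - {S, T}"
    have "R \<subseteq> V - {u, w}"
      using R S feasible_unique[OF Q] feasible_facts(3)[OF Q] by blast
    then show "card R \<le> gap - 1"
      using assms(4)[of R] feasible_conn[OF Q] R by fastforce
  qed (use S in auto)
  then have "n \<le> partition_size Q + 3 * (gap - 1) \<or> n \<le> 2 * partition_size Q + 2 * (gap - 1)"
    by (cases "S = T") simp_all
  then show "13 * (target + gap) \<le> 24 * partition_size Q"
    using gap_arith[OF assms(1)] by blast
qed

text \<open>A part that meets \<open>M\<close> but avoids \<open>u\<close> cannot leave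
  \<open>M\<close>, so it is trapped in a branch. If there are at most two such parts, they cover
  \<open>M\<close> together with the part of \<open>u\<close>; otherwise all three parts without
  \<open>u\<close> are small.\<close>

lemma attached_center_good:
  assumes "2 * target + 2 \<le> n" "M \<subseteq> V" "target < card M" "center M gap u"
    and exhausted: "\<And>p q. (p, q) \<in> arcs \<Longrightarrow> p \<in> M \<Longrightarrow> p \<noteq> u \<Longrightarrow> q \<in> M"
  shows "good (target + gap)"
  unfolding good_def
proof (intro allI impI)
  fix Q assume Q: "feasible_partition 4 V E Q"
  have uV: "u \<in> V" using assms(2,4) by (auto simp: center_def)
  then obtain S where S: "S \<in> Q" "u \<in> S"
    using feasible_facts(3)[OF Q] by blast
  define A where "A = {R \<in> Q - {S}. R \<inter> M \<noteq> {}}"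
  have small: "card R \<le> gap - 1" if "R \<in> A" for R
  proof -
    have R: "R \<in> Q" "R \<noteq> S" "R \<inter> M \<noteq> {}" using that by (auto simp: A_def)
    have u: "u \<notin> R" using R S feasible_unique[OF Q] by blast
    have "R \<inter> M = R"
    proof (rule ccontr)
      assume "R \<inter> M \<noteq> R"
      then obtain p q where "(p, q) \<in> arcs" "p \<in> R \<inter> M" "q \<in> R - R \<inter> M"
        using conn_cut[OF feasible_conn[OF Q R(1)], of "R \<inter> M"] R(3) by blast
      then show False using exhausted u by blast
    qed
    then have "R \<subseteq> M - {u}" using u by blast
    then have "card R < gap"
      using assms(4) feasible_conn[OF Q R(1)] by (simp add: center_def)
    then show ?thesis by linarith
  qed
  have finA: "finite A" "A \<subseteq> Q - {S}" using feasible_facts(1)[OF Q] by (auto simp: A_def)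
  have card3: "card (Q - {S}) = 3" using feasible_facts[OF Q] S by simp
  have "target + 1 \<le> partition_size Q + 2 * (gap - 1) \<or> n \<le> partition_size Q + 3 * (gap - 1)"
  proof (cases "card A \<le> 2")
    case True
    have "M \<subseteq> S \<union> \<Union>A"
    proof
      fix x assume x: "x \<in> M"
      then obtain R where "R \<in> Q" "x \<in> R" using assms(2) feasible_facts(3)[OF Q] by blast
      then show "x \<in> S \<union> \<Union>A" using x by (cases "R = S") (auto simp: A_def)
    qed
    moreover have "S \<union> \<Union>A \<subseteq> V" using S finA feasible_facts(3)[OF Q] by blast
    ultimately have "card M \<le> card (S \<union> \<Union>A)"
      by (intro card_mono) (auto intro: finite_subset[OF _ finite_V])
    also have "\<dots> \<le> card S + card (\<Union>A)" by (rule card_Un_le)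
    also have "card (\<Union>A) \<le> (\<Sum>R\<in>A. card R)" by (rule card_Union_le_sum_card)
    also have "\<dots> \<le> of_nat (card A) * (gap - 1)" by (rule sum_bounded_above) (rule small)
    also have "\<dots> \<le> 2 * (gap - 1)" using True by (intro mult_right_mono) auto
    finally show ?thesis using assms(3) feasible_le[OF Q S(1)] by simp
  next
    case False
    then have "A = Q - {S}"
      using card_seteq[OF _ finA(2)] card3 feasible_facts(1)[OF Q] by simp
    then have "n \<le> card {S} * partition_size Q + (4 - card {S}) * (gap - 1)"
      using S small by (intro feasible_split[OF Q]) auto
    then show ?thesis by simp
  qed
  then show "13 * (target + gap) \<le> 24 * partition_size Q"
    using gap_arith[OF assms(1)] by blast
qed

text \<open>If \<open>c\<close> belongs to \<open>D\<close>, it is dropped, otherwise any element,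
  which weighs no more than \<open>c\<close>. Three applications compare the branches used by a
  feasible partition with the three largest ones.\<close>

lemma greedy_step:
  fixes w :: "'b \<Rightarrow> nat"
  assumes "finite D" "card D \<le> Suc k" "\<And>d. d \<in> D \<Longrightarrow> w d \<le> w c"
  shows "\<exists>D'\<subseteq>D - {c}. card D' \<le> k \<and> sum w D \<le> w c + sum w D'"
proof (cases "D = {}")
  case True
  then show ?thesis by (intro exI[of _ "{}"]) simp
next
  case False
  then obtain d where d: "d \<in> D" "c \<in> D \<longrightarrow> d = c" by blast
  have "sum w D = w d + sum w (D - {d})" using assms(1) d(1) by (rule sum.remove)
  moreover have "w d \<le> w c" using assms(3) d(1) .
  moreover have "card (D - {d}) \<le> k" using assms(1,2) d(1) by simp
  ultimately show ?thesis using d by (intro exI[of _ "D - {d}"]) auto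
qed

text \<open>The largest three components around a cut vertex can absorb any three other parts.\<close>

lemma star_good:
  assumes "is_pieces f c" "x \<in> V" "\<forall>v\<in>V. f v = (if v = x then 0 else 1)"
    and disj: "C1 \<inter> C2 = {}" "C1 \<inter> C3 = {}" "C2 \<inter> C3 = {}" "C1 \<subseteq> V" "C2 \<subseteq> V" "C3 \<subseteq> V"
    and 1: "\<And>y. y \<in> V - {x} \<Longrightarrow> card (piece c y) \<le> card C1"
    and 2: "\<And>y. y \<in> V - {x} \<Longrightarrow> piece c y \<noteq> C1 \<Longrightarrow> card (piece c y) \<le> card C2"
    and 3: "\<And>y. y \<in> V - {x} \<Longrightarrow> piece c y \<noteq> C1 \<Longrightarrow> piece c y \<noteq> C2 \<Longrightarrow> card (piece c y) \<le> card C3"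
  shows "good (card (V - (C1 \<union> C2 \<union> C3)))"
  unfolding good_def
proof (intro allI impI)
  fix Q assume Q: "feasible_partition 4 V E Q"
  obtain S where S: "S \<in> Q" "x \<in> S" using assms(2) feasible_facts(3)[OF Q] by blast
  have "\<exists>y. R \<subseteq> piece c y \<and> y \<in> V - {x}" if R: "R \<in> Q - {S}" for R
  proof -
    have "conn R" using feasible_conn[OF Q] R by blast
    then obtain y where y: "y \<in> R" using conn_nonempty by blast
    have RV: "R \<subseteq> V - {x}" using R S feasible_unique[OF Q] feasible_facts(3)[OF Q] by blast
    have "R \<subseteq> piece c y"
    proof (rule piece_max[OF assms(1) \<open>conn R\<close> _ y])
      show "f z = 1" if "z \<in> R" for z
      proof -
        have "z \<in> V" "z \<noteq> x" using RV that by blast+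
        then show ?thesis using bspec[OF assms(3), of z] by simp
      qed
    qed (use RV in auto)
    then show ?thesis using RV y by blast
  qed
  then obtain h where h: "\<And>R. R \<in> Q - {S} \<Longrightarrow> R \<subseteq> piece c (h R) \<and> h R \<in> V - {x}" by metis
  \<comment> \<open>The branches that contain the parts without \<open>x\<close>; there are at most
    three, and several parts may share one.\<close>
  define D where "D = (\<lambda>R. piece c (h R)) ` (Q - {S})"
  have D: "finite D" "card D \<le> 3"
    using feasible_facts[OF Q] S card_image_le[of "Q - {S}" "\<lambda>R. piece c (h R)"]
    by (simp_all add: D_def)
  have Dy: "\<exists>y. d = piece c y \<and> y \<in> V - {x}" if "d \<in> D" for d
    using that h by (auto simp: D_def)
  have "\<exists>D'\<subseteq>D - {C1}. card D' \<le> 2 \<and> sum card D \<le> card C1 + sum card D'"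
    using D Dy 1 by (intro greedy_step) fastforce+
  then obtain D1 where D1: "D1 \<subseteq> D - {C1}" "card D1 \<le> 2" "sum card D \<le> card C1 + sum card D1"
    by blast
  have fin1: "finite D1" using D1(1) D(1) finite_subset by blast
  have "card d \<le> card C2" if "d \<in> D1" for d
    using Dy[of d] 2 that D1(1) by blast
  then have "\<exists>D'\<subseteq>D1 - {C2}. card D' \<le> 1 \<and> sum card D1 \<le> card C2 + sum card D'"
    using D1(2) fin1 by (intro greedy_step) simp_all
  then obtain D2 where D2: "D2 \<subseteq> D1 - {C2}" "card D2 \<le> 1" "sum card D1 \<le> card C2 + sum card D2"
    by blast
  have fin2: "finite D2" using D2(1) fin1 finite_subset by blast
  have "card d \<le> card C3" if "d \<in> D2" for d
    using Dy[of d] 3 that D1(1) D2(1) by blast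
  then have "\<exists>D'\<subseteq>D2 - {C3}. card D' \<le> 0 \<and> sum card D2 \<le> card C3 + sum card D'"
    using D2(2) fin2 by (intro greedy_step) simp_all
  then obtain D3 where D3: "D3 \<subseteq> D2 - {C3}" "card D3 \<le> 0" "sum card D2 \<le> card C3 + sum card D3"
    by blast
  have "finite D3" using D3(1) fin2 finite_subset by blast
  then have sumD: "sum card D \<le> card C1 + card C2 + card C3" using D1(3) D2(3) D3 by simp
  have fin: "finite C1" "finite C2" "finite C3" using disj finite_subset finite_V by blast+
  have "card (C1 \<union> C2 \<union> C3) = card C1 + card C2 + card C3"
    using disj fin by (simp add: card_Un_disjoint Int_Un_distrib2)
  moreover have "card (V - (C1 \<union> C2 \<union> C3)) = n - card (C1 \<union> C2 \<union> C3)"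
    using disj fin by (intro card_Diff_subset) auto
  \<comment> \<open>The part \<open>S\<close> through \<open>x\<close> must contain everything
    outside these branches.\<close>
  moreover have "V \<subseteq> S \<union> \<Union>D"
  proof
    fix v assume "v \<in> V"
    then obtain R where "R \<in> Q" "v \<in> R" using feasible_facts(3)[OF Q] by blast
    then show "v \<in> S \<union> \<Union>D" using h by (cases "R = S") (auto simp: D_def)
  qed
  then have "n \<le> card (S \<union> \<Union>D)"
  proof (rule card_mono[rotated])
    have "finite S" using S feasible_facts(3)[OF Q] finite_subset[OF _ finite_V] by blast
    moreover have "finite d" if "d \<in> D" for d using Dy[OF that] by auto
    ultimately show "finite (S \<union> \<Union>D)" using D(1) by blast
  qed
  moreover have "card (S \<union> \<Union>D) \<le> card S + card (\<Union>D)" by (rule card_Un_le)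
  moreover have "card (\<Union>D) \<le> sum card D" by (rule card_Union_le_sum_card)
  ultimately show "13 * card (V - (C1 \<union> C2 \<union> C3)) \<le> 24 * partition_size Q"
    using sumD feasible_le[OF Q S(1)] by linarith
qed

end

section \<open>The algorithm\<close>

abbreviation part_is :: "nat \<Rightarrow> cond" where
  "part_is l \<equiv> eq (Cell ''part'' (var ''v'')) (Const l)"

abbreviation in_X :: cond where
  "in_X \<equiv> eq (Cell ''X'' (var ''v'')) (Const 1)"

definition put :: "cond \<Rightarrow> nat \<Rightarrow> prog" where
  "put b l = update ''part'' b (Const l)"

text \<open>Truncated subtraction from 1 exchanges the labels 0 and 1; the other labels are
  kept.\<close>

definition swap :: prog where
  "swap = update ''part'' (Less (Cell ''part'' (var ''v'')) (Const 2))
     (Sub (Const 1) (Cell ''part'' (var ''v'')))"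

text \<open>Both halves have centres here. Classes 1 and 2 keep the branches of different halves
  apart as pieces, while \<open>find\<close> glues across the classes. The glued set becomes part 2,
  and the half still above T, if any, is put into position 0 and shrunk.\<close>

definition bridge :: prog where
  "bridge =
     update ''cls'' (Less (Const 0) (Const 1)) (Add (Cell ''part'' (var ''v'')) (Const 1)) ;;
     Store ''cls'' (var ''u'') (Const 0) ;; Store ''cls'' (var ''w'') (Const 0) ;; comps ;;
     ''th'' ::= var ''g'' ;; find ;;
     If (eq (var ''fl'') (Const 1))
       (put in_X 2 ;; count ''c'' (part_is 0) ;;
        If (Less (var ''T'') (var ''c'')) move
          (swap ;; ''u'' ::= var ''w'' ;; count ''c'' (part_is 0) ;;
           If (Less (var ''T'') (var ''c'')) move Skip)) Skip"

text \<open>The branch with label 3 is provisional. If the enlarged part 1 can be cut, label 2 takes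
  one side and the branch keeps its own part; if not, the branch returns to part 0, and there is a
  bisection with a centre on each side.\<close>

definition shrink :: prog where
  "shrink = move ;;
     If (eq (var ''dn'') (Const 1))
       (splitter 1 (Sub (var ''h'') (var ''T'')) ;;
        If (eq (var ''fl'') (Const 1)) (put in_X 2) (''w'' ::= var ''z'' ;; put (part_is 3) 0 ;; bridge))
       Skip"

text \<open>If only the second half resists, the cut of the first is undone and the halves are
  exchanged, so that the half with the centre is part 0 as \<open>shrink\<close> expects.\<close>

definition halve :: prog where
  "halve = splitter 0 (Sub (var ''h'') (var ''T'')) ;;
     If (eq (var ''fl'') (Const 1))
       (put in_X 2 ;; splitter 1 (Sub (var ''h'') (var ''T'')) ;;
        If (eq (var ''fl'') (Const 1)) (put in_X 3)
          (''u'' ::= var ''z'' ;; put (part_is 2) 0 ;; swap ;; shrink))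
       (''u'' ::= var ''z'' ;; shrink)"

lemma writes_put [simp]: "writes (put b l) = {''i'', ''v'', ''part''}"
  by (simp add: put_def)

lemma writes_swap [simp]: "writes swap = {''i'', ''v'', ''part''}"
  by (simp add: swap_def)

section \<open>Certified labellings\<close>

context graph_input begin

abbreviation work :: nat where
  "work \<equiv> n * (n * (m + 1))"

definition env :: "state \<Rightarrow> bool" where
  "env s \<longleftrightarrow> inp s \<and> s ''T'' 0 = target \<and> s ''g'' 0 = gap"

lemma env_agree:
  assumes "agree A s s'" "env s" "A \<inter> insert ''T'' (insert ''g'' inputs) = {}"
  shows "env s'"
  using inp_agree[OF assms(1)] assms by (auto simp: env_def agree_def)

lemma env_inp: "env s \<Longrightarrow> inp s"
  by (simp add: env_def)

lemma wp_put:
  assumes "env s"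
    and "\<And>y s'. y \<in> V \<Longrightarrow> agree {''i'', ''v'', ''part''} s s' \<Longrightarrow> s' ''v'' 0 = y \<Longrightarrow>
      s' ''part'' y = s ''part'' y \<Longrightarrow> cond_val b s' \<longleftrightarrow> B y"
  shows "wp work (put b l) (\<lambda>s'. env s' \<and> s' ''part'' = (\<lambda>y. if y \<in> V \<and> B y then l else s ''part'' y)) s"
proof -
  have "wp n (put b l) (\<lambda>s'. s' ''part'' = (\<lambda>y. if y \<in> V \<and> B y then l else s ''part'' y)) s"
    unfolding put_def by (rule wp_update[OF env_inp[OF assms(1)]]) (use assms(2) in auto)
  then show ?thesis
    by (rule wp_weaken[OF _ time_bounds(6)]) (use env_agree[OF _ assms(1)] in auto)
qed

lemma wp_swap:
  assumes "env s"
  shows "wp work swap (\<lambda>s'. env s' \<and>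
    s' ''part'' = (\<lambda>y. if y \<in> V \<and> s ''part'' y < 2 then 1 - s ''part'' y else s ''part'' y)) s"
proof -
  have "wp n swap (\<lambda>s'. s' ''part'' =
      (\<lambda>y. if y \<in> V \<and> s ''part'' y < 2 then 1 - s ''part'' y else s ''part'' y)) s"
    unfolding swap_def by (rule wp_update[OF env_inp[OF assms]]) auto
  then show ?thesis
    by (rule wp_weaken[OF _ time_bounds(6)]) (use env_agree[OF _ assms] in auto)
qed

lemma wp_count_part:
  assumes "env s"
  shows "wp work (count ''c'' (part_is l)) (\<lambda>s'. env s' \<and> s' ''c'' 0 = card (block (s ''part'') l)) s"
proof -
  have "wp n (count ''c'' (part_is l)) (\<lambda>s'. s' ''c'' 0 = card {y \<in> V. s ''part'' y = l}) s"
    by (rule wp_count[OF env_inp[OF assms]]) (auto simp: agree_def)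
  then show ?thesis
    by (rule wp_weaken[OF _ time_bounds(6)]) (use env_agree[OF _ assms] in \<open>auto simp: block_def\<close>)
qed

definition sound :: "nat set \<Rightarrow> bool" where
  "sound A \<longleftrightarrow> (A = {} \<or> conn A) \<and> good (card A)"

text \<open>Empty blocks are allowed; they are filled only at the end by splitting other blocks,
  which does not increase any size.\<close>

definition fine :: "(nat \<Rightarrow> nat) \<Rightarrow> bool" where
  "fine P \<longleftrightarrow> (\<forall>v\<in>V. P v < 4) \<and> (\<forall>l. sound (block P l))"

lemma fineI:
  assumes "\<forall>v\<in>V. P v < 4" "sound (block P 0)" "sound (block P 1)" "sound (block P 2)" "sound (block P 3)"
  shows "fine P"
proof -
  have "sound (block P l)" for l
  proof (cases "l < 4")
    case True
    then have "l = 0 \<or> l = 1 \<or> l = 2 \<or> l = 3" by linarith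
    then show ?thesis using assms by blast
  next
    case False
    then have "block P l = {}" using assms(1) by (fastforce simp: block_def)
    then show ?thesis by (simp add: sound_def good_target)
  qed
  then show ?thesis using assms(1) by (simp add: fine_def)
qed

lemma sound_small: "A = {} \<or> conn A \<Longrightarrow> card A \<le> target \<Longrightarrow> sound A"
  by (simp add: sound_def good_target)

lemma card_blocks:
  assumes "\<forall>v\<in>V. P v < 4"
  shows "card (block P 0) + card (block P 1) + card (block P 2) + card (block P 3) = n"
proof -
  have "V = block P 0 \<union> block P 1 \<union> block P 2 \<union> block P 3"
  proof
    show "V \<subseteq> block P 0 \<union> block P 1 \<union> block P 2 \<union> block P 3"
    proof
      fix v assume "v \<in> V"
      moreover from this have "P v = 0 \<or> P v = 1 \<or> P v = 2 \<or> P v = 3"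
        using assms by (auto simp: numeral_eq_Suc less_Suc_eq)
      ultimately show "v \<in> block P 0 \<union> block P 1 \<union> block P 2 \<union> block P 3"
        by (auto simp: block_def)
    qed
  qed (auto simp: block_def)
  then have "n = card (block P 0 \<union> block P 1 \<union> block P 2 \<union> block P 3)"
    by (rule arg_cong)
  moreover have "block P i \<inter> block P j = {}" if "i \<noteq> j" for i j
    using that by (auto simp: block_def)
  ultimately show ?thesis
    by (simp add: card_Un_disjoint Int_Un_distrib2)
qed

section \<open>Bisections and the bridge between two centres\<close>

definition bisection :: "(nat \<Rightarrow> nat) \<Rightarrow> bool" where
  "bisection P \<longleftrightarrow> (\<forall>v\<in>V. P v < 2) \<and> conn (block P 0) \<and> conn (block P 1) \<and>
     target < card (block P 0) \<and> target < card (block P 1)"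

text \<open>Two blocks above T force 2T + 2 \<le> n, the assumption behind all estimates on
  \<open>gap\<close>; what one block leaves to the other is at most T + g.\<close>

lemma bisection_facts:
  assumes "bisection P"
  shows "labelled P" "block P 2 = {}" "block P 3 = {}" "card (block P 0) + card (block P 1) = n"
    "2 * target + 2 \<le> n" "card (block P 0) \<le> target + gap" "card (block P 1) \<le> target + gap"
    "block P 0 \<inter> block P 1 = {}" "block P 0 \<union> block P 1 = V"
proof -
  have lt2: "\<forall>v\<in>V. P v < 2" and c: "conn (block P 0)" "conn (block P 1)"
    and big: "target < card (block P 0)" "target < card (block P 1)"
    using assms by (simp_all add: bisection_def)
  have empty: "block P l = {}" if "2 \<le> l" for l using lt2 that by (fastforce simp: block_def)
  then show e: "block P 2 = {}" "block P 3 = {}" by simp_all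
  have "block P l = {} \<or> conn (block P l)" for l
  proof -
    have "l = 0 \<or> l = 1 \<or> 2 \<le> l" by linarith
    then show ?thesis using c empty by blast
  qed
  moreover have lt4: "\<forall>v\<in>V. P v < 4" using lt2 by fastforce
  ultimately show "labelled P" by (simp add: labelled_def)
  show sum: "card (block P 0) + card (block P 1) = n"
    using card_blocks[OF lt4] e by simp
  then show n: "2 * target + 2 \<le> n" using big by linarith
  show "card (block P 0) \<le> target + gap" "card (block P 1) \<le> target + gap"
    using sum big gap_facts(1)[OF n] by linarith+
  show "block P 0 \<inter> block P 1 = {}" by (auto simp: block_def)
  show "block P 0 \<union> block P 1 = V" using lt2 by (fastforce simp: block_def less_2_cases_iff)
qed

lemma bisection_swap:
  assumes "bisection P" "Q = (\<lambda>y. if y \<in> V \<and> P y < 2 then 1 - P y else P y)"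
  shows "bisection Q" "block Q 0 = block P 1" "block Q 1 = block P 0"
proof -
  have lt2: "\<forall>v\<in>V. P v < 2" using assms by (simp add: bisection_def)
  then show b: "block Q 0 = block P 1" "block Q 1 = block P 0"
    unfolding assms(2) by (fastforce simp: block_def less_2_cases_iff)+
  have "\<forall>v\<in>V. Q v < 2" using lt2 unfolding assms(2) by auto
  then show "bisection Q" using assms(1) b by (simp add: bisection_def)
qed

lemma center_subset: "center H \<theta> z \<Longrightarrow> z \<in> H' \<Longrightarrow> H' \<subseteq> H \<Longrightarrow> center H' \<theta> z"
  unfolding center_def by blast

lemma center_mono: "center H \<theta> z \<Longrightarrow> \<theta> \<le> \<theta>' \<Longrightarrow> center H \<theta>' z"
  unfolding center_def by fastforce

lemma bridge_pieces:
  assumes P: "bisection P" and cen: "center (block P 0) gap u" "center (block P 1) gap w"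
    and pcs: "is_pieces f c"
    and f: "\<forall>y\<in>V. f y = (if y = u \<or> y = w then 0 else P y + 1)"
  shows "star (block P 0) u c" "star (block P 1) w c"
proof -
  have lt2: "\<forall>v\<in>V. P v < 2" and c: "conn (block P 0)" "conn (block P 1)"
    using P by (simp_all add: bisection_def)
  have uw: "u \<in> V" "P u = 0" "w \<in> V" "P w = 1"
    using cen by (auto simp: center_def block_def)
  show "star (block P 0) u c"
    by (rule star_class[OF c(1) block_subset _ pcs, of _ 1])
      (use f uw lt2 in \<open>auto simp: block_def\<close>)
  show "star (block P 1) w c"
    by (rule star_class[OF c(2) block_subset _ pcs, of _ 2])
      (use f uw lt2 in \<open>auto simp: block_def less_2_cases_iff\<close>)
qed

text \<open>Then all connected sets avoiding both centres are below \<open>gap\<close>, the optimum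
  is large, and the two halves themselves are an acceptable answer.\<close>

lemma bridge_none:
  assumes P: "bisection P" and cen: "center (block P 0) gap u" "center (block P 1) gap w"
    and f: "\<forall>y\<in>V. f y = (if y = u \<or> y = w then 0 else P y + 1)" and "bounded f gap"
  shows "fine P"
proof -
  have "{v \<in> V. 0 < f v} = V - {u, w}" using f by auto
  then have "good (target + gap)"
    using bisection_facts(5)[OF P] cen assms(5)
    by (intro two_centers_good[of u w]) (auto simp: center_def block_def bounded_def)
  then have "sound (block P 0)" "sound (block P 1)"
    using P bisection_facts(6,7)[OF P] good_mono by (auto simp: sound_def bisection_def)
  then show ?thesis
    using bisection_facts(1,2,3)[OF P]
    by (intro fineI) (auto simp: labelled_def sound_small)
qed

text \<open>Removing whole branches keeps both halves connected through their centres. A single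
  piece is a branch of one half and hence below \<open>gap\<close>, so \<open>X\<close> is a union
  of two sets below \<open>gap\<close>.\<close>

lemma bridge_found:
  assumes P: "bisection P" and cen: "center (block P 0) gap u" "center (block P 1) gap w"
    and pcs: "is_pieces f c" and f: "\<forall>y\<in>V. f y = (if y = u \<or> y = w then 0 else P y + 1)"
    and seg: "segment f c gap X e" and Q: "Q = (\<lambda>y. if y \<in> V \<and> y \<in> X then 2 else P y)"
  shows "block Q 0 = block P 0 - X" "block Q 1 = block P 1 - X" "block Q 2 = X" "block Q 3 = {}"
    "labelled Q" "u \<in> block Q 0" "w \<in> block Q 1" "gap \<le> card X" "card X + 2 \<le> 2 * gap"
proof -
  note st = bridge_pieces[OF P cen pcs f]
  have lt2: "\<forall>v\<in>V. P v < 2" using P by (simp add: bisection_def)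
  have Xf: "X \<subseteq> {v \<in> V. 0 < f v}" using seg by (simp add: segment_def)
  have X: "X \<subseteq> V - {u, w}" "conn X" "\<And>x. x \<in> X \<Longrightarrow> piece c x \<subseteq> X" "e \<in> X" "gap \<le> card X"
    using seg f by (auto simp: segment_def)
  show "gap \<le> card X" by fact
  show b: "block Q 0 = block P 0 - X" "block Q 1 = block P 1 - X" "block Q 2 = X" "block Q 3 = {}"
    using X(1) lt2 unfolding Q by (auto simp: block_def split: if_splits)
  show "u \<in> block Q 0" "w \<in> block Q 1" using cen X(1) b by (auto simp: center_def)
  have rem: "conn (block P l - X)" if "star (block P l) z c" "z \<notin> X" for l z
  proof -
    have "conn (block P l - X \<inter> block P l)"
    proof (rule star_remove[OF that(1)])
      show "X \<inter> block P l \<subseteq> block P l - {z}" using that(2) by blast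
      fix x assume x: "x \<in> X \<inter> block P l"
      then have "x \<in> block P l - {z}" using that(2) by blast
      then have "piece c x \<subseteq> block P l" using that(1) unfolding star_def by blast
      then show "piece c x \<subseteq> X \<inter> block P l" using X(3) x by blast
    qed
    moreover have "block P l - X \<inter> block P l = block P l - X" by blast
    ultimately show ?thesis by simp
  qed
  have "conn (block Q 0)" "conn (block Q 1)" "conn (block Q 2)"
    using rem[OF st(1)] rem[OF st(2)] X b by auto
  moreover have "\<forall>v\<in>V. Q v < 3" using lt2 unfolding Q by fastforce
  moreover from this have "block Q l = {}" if "3 \<le> l" for l
    using that by (fastforce simp: block_def)
  ultimately have "block Q l = {} \<or> conn (block Q l)" for l
  proof -
    consider "l = 0" | "l = 1" | "l = 2" | "3 \<le> l" by linarith
    then show ?thesis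
      using \<open>conn (block Q 0)\<close> \<open>conn (block Q 1)\<close> \<open>conn (block Q 2)\<close>
        \<open>3 \<le> l \<Longrightarrow> block Q l = {}\<close> by cases auto
  qed
  then show "labelled Q"
    using \<open>\<forall>v\<in>V. Q v < 3\<close> unfolding labelled_def by fastforce
  have eV: "e \<in> V - {u, w}" using X by blast
  \<comment> \<open>The piece added last lies in one half and avoids its centre.\<close>
  have "card (piece c e) < gap"
  proof (cases "e \<in> block P 0")
    case True
    then have "piece c e \<subseteq> block P 0 - {u}" using st(1) eV unfolding star_def by blast
    then show ?thesis using cen(1) piece_conn[OF pcs] eV by (simp add: center_def)
  next
    case False
    then have "e \<in> block P 1 - {w}" using bisection_facts(9)[OF P] eV by blast
    then have "piece c e \<subseteq> block P 1 - {w}" using st(2) unfolding star_def by blast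
    then show ?thesis using cen(2) piece_conn[OF pcs] eV by (simp add: center_def)
  qed
  moreover from this X(5) have "X \<noteq> piece c e" by auto
  then have "card (X - piece c e) < gap" using seg by (auto simp: segment_def)
  moreover have "card X = card (piece c e) + card (X - piece c e)"
  proof -
    have "finite X" using X(1) finite_subset finite_V by blast
    then show ?thesis
      using X(3)[OF X(4)] by (metis card_Diff_subset card_mono finite_piece le_add_diff_inverse)
  qed
  ultimately show "card X + 2 \<le> 2 * gap" by linarith
qed

text \<open>A block 3 is connected and avoids \<open>u\<close>, so it is below \<open>gap\<close>
  and hence at most T. If no branch was split off, the exhausted star makes sizes up to T + g
  acceptable; otherwise block 0 has dropped to T.\<close>

lemma moved_fine:
  assumes n: "2 * target + 2 \<le> n" and cen: "center (block Q 0) gap u"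
    and big: "target < card (block Q 0)" "card (block Q 0) \<le> target + gap"
    and mv: "moved Q u target P' d"
    and sizes: "card (block P' 1) \<le> target \<and> card (block P' 2) \<le> target \<or>
      \<not> d \<and> card (block P' 1) \<le> target + gap \<and> card (block P' 2) \<le> target"
  shows "fine P'"
proof -
  have lab: "labelled P'" and u: "u \<in> block P' 0" "block P' 0 \<subseteq> block Q 0" "block P' 3 \<subseteq> block Q 0 - {u}"
    using mv by (auto simp: moved_def)
  have conns: "block P' l = {} \<or> conn (block P' l)" for l using lab by (simp add: labelled_def)
  have cen': "center (block P' 0) gap u" using center_subset[OF cen u(1,2)] .
  have gt: "good (target + gap)" if "\<not> d"
    using attached_center_good[OF n block_subset _ cen'] mv that by (auto simp: moved_def)
  have "card (block P' 0) \<le> target + gap"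
    using card_mono[OF finite_block u(2)] big(2) by linarith
  then have "sound (block P' 0)"
    using gt conns[of 0] good_mono sound_small mv by (cases d) (auto simp: moved_def sound_def)
  moreover have "sound (block P' 1)" "sound (block P' 2)"
    using sizes conns gt good_mono sound_small unfolding sound_def by blast+
  moreover have "card (block P' 3) \<le> target"
  proof (cases "block P' 3 = {}")
    case False
    then have "card (block P' 3) < gap" using cen conns[of 3] u(3) by (simp add: center_def)
    then show ?thesis using gap_facts(4)[OF n] by linarith
  qed simp
  then have "sound (block P' 3)" using conns sound_small by blast
  ultimately show ?thesis using lab by (intro fineI) (auto simp: labelled_def)
qed

text \<open>Blocks 0 and 3 keep at least T + 1 vertices together and each of blocks 1 and 2 keeps at
  least g. So either of the latter has at most n - (T + 1) - g = T.\<close>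

lemma moved_fine_bridge:
  assumes n: "2 * target + 2 \<le> n" and cen: "center (block Q 0) gap u"
    and big: "target < card (block Q 0)" "card (block Q 0) \<le> target + gap"
    and mv: "moved Q u target P' d" and sides: "gap \<le> card (block Q 1)" "gap \<le> card (block Q 2)"
  shows "fine P'"
proof (rule moved_fine[OF n cen big mv])
  have lab: "\<forall>v\<in>V. P' v < 4" using mv by (auto simp: moved_def labelled_def)
  have "card (block P' 0 \<union> block P' 3) = card (block P' 0) + card (block P' 3)"
    by (rule card_Un_disjoint) (auto simp: block_def)
  then have "target < card (block P' 0) + card (block P' 3)"
    using mv by (cases d) (auto simp: moved_def)
  moreover have "gap \<le> card (block P' 1)" "gap \<le> card (block P' 2)"
    using sides mv card_mono[OF finite_block, of "block Q _" P'] unfolding moved_def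
    by (meson le_trans)+
  ultimately have "card (block P' 1) \<le> target" "card (block P' 2) \<le> target"
    using card_blocks[OF lab] gap_facts(1)[OF n] by linarith+
  then show "card (block P' 1) \<le> target \<and> card (block P' 2) \<le> target \<or>
      \<not> d \<and> card (block P' 1) \<le> target + gap \<and> card (block P' 2) \<le> target" by blast
qed

lemma work_bounds: "n \<le> work" "n * m \<le> work" "n * (m + 1) \<le> work" "0 < work"
  using time_bounds(3,5,6,9) le_trans by blast+

lemma swap_blocks:
  assumes "Q' = (\<lambda>y. if y \<in> V \<and> Q y < 2 then 1 - Q y else Q y)" "\<forall>y\<in>V. Q y < 4"
  shows "block Q' 0 = block Q 1" "block Q' 1 = block Q 0" "2 \<le> l \<Longrightarrow> block Q' l = block Q l"
    "\<forall>y\<in>V. Q' y < 4"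
proof -
  show "block Q' 0 = block Q 1" "block Q' 1 = block Q 0" "2 \<le> l \<Longrightarrow> block Q' l = block Q l"
    unfolding assms(1) by (auto simp: block_def split: if_splits)
  show "\<forall>y\<in>V. Q' y < 4"
    using assms(2) unfolding assms(1) by auto
qed

lemma swap_labelled:
  assumes "Q' = (\<lambda>y. if y \<in> V \<and> Q y < 2 then 1 - Q y else Q y)" "labelled Q"
  shows "labelled Q'"
proof -
  have lt: "\<forall>y\<in>V. Q y < 4" and c: "\<And>l. block Q l = {} \<or> conn (block Q l)"
    using assms(2) by (simp_all add: labelled_def)
  note b = swap_blocks[OF assms(1) lt]
  have "block Q' l = {} \<or> conn (block Q' l)" for l
  proof -
    consider "l = 0" | "l = 1" | "2 \<le> l" by linarith
    then show ?thesis using b(1-3) c by cases metis+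
  qed
  then show ?thesis using b(4) by (simp add: labelled_def)
qed

lemma fine_small:
  assumes "labelled P" "card (block P 0) \<le> target" "card (block P 1) \<le> target"
    "card (block P 2) \<le> target" "card (block P 3) \<le> target"
  shows "fine P"
proof -
  have "sound (block P l)" if "card (block P l) \<le> target" for l
    using assms(1) that by (intro sound_small) (simp_all add: labelled_def)
  then show ?thesis using assms by (intro fineI) (simp_all add: labelled_def)
qed

text \<open>The set \<open>X\<close> is at most T as 2g - 2 \<le> T. If a half minus
  \<open>X\<close> is still above T, moving its branches succeeds because the other half and
  \<open>X\<close> both have at least g vertices; if neither is, the labelling is already
  fine.\<close>

lemma wp_bridge:
  assumes env: "env s" and P: "s ''part'' = P" "bisection P"
    and u: "s ''u'' 0 = u" "center (block P 0) gap u" and w: "s ''w'' 0 = w" "center (block P 1) gap w"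
  shows "wp work bridge (\<lambda>s'. fine (s' ''part'')) s"
    (is "wp _ _ ?Q s")
proof -
  let ?upd = "update ''cls'' (Less (Const 0) (Const 1)) (Add (Cell ''part'' (var ''v'')) (Const 1))"
  let ?move2 = "swap ;; ''u'' ::= var ''w'' ;; count ''c'' (part_is 0) ;;
           If (Less (var ''T'') (var ''c'')) move Skip"
  let ?fin = "If (eq (var ''fl'') (Const 1))
       (put in_X 2 ;; count ''c'' (part_is 0) ;; If (Less (var ''T'') (var ''c'')) move ?move2) Skip"
  note nn = bisection_facts(5)[OF P(2)]
  \<comment> \<open>Stated for an arbitrary half \<open>H\<close> and centre \<open>z\<close>, to
    serve both before and after the exchange of labels.\<close>
  have mv: "wp work move ?Q s'"
    if env': "env s'" and Q: "s' ''part'' = Q" "labelled Q" "block Q 3 = {}"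
      and z: "s' ''u'' 0 = z" "z \<in> block Q 0" and big: "target < card (block Q 0)"
      and H: "block Q 0 \<subseteq> H" "center H gap z" "card H \<le> target + gap"
      and sides: "gap \<le> card (block Q 1)" "gap \<le> card (block Q 2)" "finite H" for s' Q z H
  proof -
    have T: "s' ''T'' 0 = target" using env' by (simp add: env_def)
    have le: "card (block Q 0) \<le> target + gap" using card_mono[OF sides(3) H(1)] H(3) by linarith
    show ?thesis
    proof (rule wp_weaken[OF wp_move[OF env_inp[OF env'] Q z T big] work_bounds(3)])
      fix s'' assume "s'' ''dn'' 0 \<le> 1 \<and> moved Q z target (s'' ''part'') (s'' ''dn'' 0 = 1)"
      then show "?Q s''"
        using moved_fine_bridge[OF nn center_subset[OF H(2) z(2) H(1)] big le _ sides(1,2)] by blast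
    qed
  qed
  have "wp n ?upd (\<lambda>s'. s' ''cls'' = (\<lambda>y. if y \<in> V \<and> True then P y + 1 else s ''cls'' y)) s"
    by (rule wp_update[OF env_inp[OF env]]) (auto simp: agree_def P)
  then show ?thesis
    unfolding bridge_def
  proof (rule wp_Seq[OF wp_weaken[OF _ work_bounds(1)]])
    fix s1
    assume 1: "s1 ''cls'' = (\<lambda>y. if y \<in> V \<and> True then P y + 1 else s ''cls'' y)"
      and ag1: "agree (writes ?upd) s s1"
    let ?s2 = "s1(''cls'' := (s1 ''cls'')(u := 0))"
    let ?s3 = "?s2(''cls'' := (?s2 ''cls'')(w := 0))"
    define f where "f = ?s3 ''cls''"
    have f: "\<forall>y\<in>V. f y = (if y = u \<or> y = w then 0 else P y + 1)"
      using 1 by (simp add: f_def)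
    have uw1: "s1 ''u'' 0 = u" "s1 ''w'' 0 = w" using ag1 u(1) w(1) by (simp_all add: agree_def)
    have ag3: "agree {''i'', ''v'', ''cls''} s ?s3" using ag1 by (auto simp: agree_def)
    have env3: "env ?s3" by (rule env_agree[OF ag3 env]) simp
    have "wp work (comps ;; ''th'' ::= var ''g'' ;; find ;; ?fin) ?Q ?s3"
    proof (rule wp_Seq[OF wp_weaken[OF wp_comps[OF env_inp[OF env3]] work_bounds(2)]])
      fix s4
      assume 4: "is_pieces (?s3 ''cls'') (s4 ''pc'')" and ag4: "agree (writes comps) ?s3 s4"
      have f4: "s4 ''cls'' = f" using ag4 by (auto simp: agree_def f_def)
      have env4: "env s4" by (rule env_agree[OF ag4 env3]) simp
      show "wp work (''th'' ::= var ''g'' ;; find ;; ?fin) ?Q s4"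
      proof (rule wp_Seq[OF wp_assign[OF work_bounds(4)]])
        fix s5
        assume 5: "s5 ''th'' 0 = expr_val (var ''g'') s4" and ag5: "agree (writes (''th'' ::= var ''g'')) s4 s5"
        have env5: "env s5" by (rule env_agree[OF ag5 env4]) simp
        have th: "s5 ''th'' 0 = gap" using 5 env4 by (simp add: env_def)
        have cls5: "s5 ''cls'' = f" using ag5 f4 by (simp add: agree_def)
        define c where "c = s5 ''pc''"
        have "s5 ''pc'' = s4 ''pc''" using ag5 by (simp add: agree_def)
        then have pcs: "is_pieces f c" using 4 by (simp only: f_def c_def)
        have pcs5: "is_pieces (s5 ''cls'') (s5 ''pc'')" using pcs by (simp only: cls5 c_def)
        have gap0: "0 < gap" using gap_facts(2)[OF nn] by simp
        show "wp work (find ;; ?fin) ?Q s5"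
        proof (rule wp_Seq[OF wp_find[OF env_inp[OF env5] pcs5 th gap0]])
          fix s6
          assume 6: "if s6 ''fl'' 0 = 1
            then \<exists>X. segment (s5 ''cls'') (s5 ''pc'') gap X (s6 ''e'' 0) \<and> indicates (s6 ''X'') X
            else s6 ''fl'' 0 = 0 \<and> bounded (s5 ''cls'') gap" and ag6: "agree (writes find) s5 s6"
          have env6: "env s6" by (rule env_agree[OF ag6 env5]) simp
          have same6: "s6 ''part'' = P" "s6 ''u'' 0 = u" "s6 ''w'' 0 = w"
            using ag6 ag5 ag4 ag3 P(1) u(1) w(1) by (simp_all add: agree_def)
          show "wp work ?fin ?Q s6"
          proof (rule wp_If[OF work_bounds(4)])
            assume "cond_val (eq (var ''fl'') (Const 1)) s6"
            then obtain X e where X: "segment f c gap X e" "indicates (s6 ''X'') X"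
              using 6 cls5 by (auto simp: c_def)
            define Q where "Q = (\<lambda>y. if y \<in> V \<and> y \<in> X then 2 else P y)"
            note found = bridge_found[OF P(2) u(2) w(2) pcs f X(1) Q_def]
            have lt4: "\<forall>y\<in>V. Q y < 4" using found(5) by (simp add: labelled_def)
            have "finite X" using X(1) by (auto simp: segment_def intro: finite_subset[OF _ finite_V])
            have cX: "card X \<le> target" using found(9) gap_facts(5)[OF nn] by linarith
            have sum: "card (block Q 0) + card (block Q 1) + card X = n"
              using card_blocks[OF lt4] found(3,4) by simp
            have sub: "block Q 0 \<subseteq> block P 0" "block Q 1 \<subseteq> block P 1" using found(1,2) by auto
            \<comment> \<open>The other side and \<open>X\<close> leave at least (2T + 1 + g) - (T +
              g) - (2g - 2) = T + 3 - 2g vertices, and 3g \<le> T + 3.\<close>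
            have size_bound: "gap \<le> card (block Q i)"
              if "card (block Q j) \<le> target + gap" "i = 0 \<and> j = 1 \<or> i = 1 \<and> j = 0" for i j
              using that sum found(9) gap_facts(1,6)[OF nn] by auto
            have le: "card (block Q 0) \<le> target + gap" "card (block Q 1) \<le> target + gap"
              using card_mono[OF finite_block sub(1)] card_mono[OF finite_block sub(2)]
                bisection_facts(6,7)[OF P(2)] by linarith+
            have sides: "gap \<le> card (block Q 0)" "gap \<le> card (block Q 1)" "gap \<le> card (block Q 2)"
              using size_bound[of 1 0] size_bound[of 0 1] le found(3,8) by auto
            have put: "wp work (put in_X 2) (\<lambda>s'. env s' \<and>
                s' ''part'' = (\<lambda>y. if y \<in> V \<and> y \<in> X then 2 else s6 ''part'' y)) s6"
              by (rule wp_put[OF env6]) (auto simp: agree_def indicatesD[OF X(2)])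
            show "wp work (put in_X 2 ;; count ''c'' (part_is 0) ;;
                If (Less (var ''T'') (var ''c'')) move ?move2) ?Q s6"
            proof (rule wp_Seq[OF put])
              fix s7
              assume 7: "env s7 \<and> s7 ''part'' = (\<lambda>y. if y \<in> V \<and> y \<in> X then 2 else s6 ''part'' y)"
                and ag7: "agree (writes (put in_X 2)) s6 s7"
              have part7: "s7 ''part'' = Q" using 7 unfolding same6(1) Q_def by blast
              show "wp work (count ''c'' (part_is 0) ;; If (Less (var ''T'') (var ''c'')) move ?move2) ?Q s7"
              proof (rule wp_Seq[OF wp_count_part[OF conjunct1[OF 7]]])
                fix s8
                assume 8: "env s8 \<and> s8 ''c'' 0 = card (block (s7 ''part'') 0)"
                  and ag8: "agree (writes (count ''c'' (part_is 0))) s7 s8"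
                have same8: "s8 ''part'' = Q" "s8 ''u'' 0 = u" "s8 ''w'' 0 = w" "s8 ''T'' 0 = target"
                  "s8 ''c'' 0 = card (block Q 0)"
                  using ag8 ag7 8 part7 same6(2,3) by (simp_all add: agree_def env_def)
                show "wp work (If (Less (var ''T'') (var ''c'')) move ?move2) ?Q s8"
                proof (rule wp_If[OF work_bounds(4)])
                  assume "cond_val (Less (var ''T'') (var ''c'')) s8"
                  then show "wp work move ?Q s8"
                    using same8 found(4,5,6) sides(2,3) sub(1) u(2) bisection_facts(6)[OF P(2)] 8
                    by (intro mv[of s8 Q u "block P 0"]) simp_all
                next
                  assume "\<not> cond_val (Less (var ''T'') (var ''c'')) s8"
                  then have small: "card (block Q 0) \<le> target" using same8 by simp
                  define Q' where "Q' = (\<lambda>y. if y \<in> V \<and> Q y < 2 then 1 - Q y else Q y)"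
                  note sw = swap_blocks[OF Q'_def lt4]
                  show "wp work ?move2 ?Q s8"
                  proof (rule wp_Seq[OF wp_swap[OF conjunct1[OF 8]]])
                    fix s9
                    assume 9: "env s9 \<and> s9 ''part'' =
                        (\<lambda>y. if y \<in> V \<and> s8 ''part'' y < 2 then 1 - s8 ''part'' y else s8 ''part'' y)"
                      and ag9: "agree (writes swap) s8 s9"
                    have part9: "s9 ''part'' = Q'" using 9 unfolding same8(1) Q'_def by blast
                    have w9: "s9 ''w'' 0 = w" using ag9 same8(3) by (simp add: agree_def)
                    let ?p = "count ''c'' (part_is 0) ;; If (Less (var ''T'') (var ''c'')) move Skip"
                    show "wp work (''u'' ::= var ''w'' ;; ?p) ?Q s9"
                    proof (rule wp_Seq[OF wp_assign[OF work_bounds(4)]])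
                      fix s10
                      assume 10: "s10 ''u'' 0 = expr_val (var ''w'') s9"
                        and ag10: "agree (writes (''u'' ::= var ''w'')) s9 s10"
                      have env10: "env s10" by (rule env_agree[OF ag10 conjunct1[OF 9]]) simp
                      have part10: "s10 ''part'' = Q'" using ag10 part9 by (simp add: agree_def)
                      show "wp work ?p ?Q s10"
                      proof (rule wp_Seq[OF wp_count_part[OF env10]])
                        fix s11
                        assume 11: "env s11 \<and> s11 ''c'' 0 = card (block (s10 ''part'') 0)"
                          and ag11: "agree (writes (count ''c'' (part_is 0))) s10 s11"
                        have same11: "s11 ''part'' = Q'" "s11 ''u'' 0 = w" "s11 ''T'' 0 = target"
                          "s11 ''c'' 0 = card (block Q 1)"
                          using ag11 11 part10 10 w9 sw(1) by (simp_all add: agree_def env_def)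
                        show "wp work (If (Less (var ''T'') (var ''c'')) move Skip) ?Q s11"
                        proof (rule wp_If[OF work_bounds(4)])
                          assume "cond_val (Less (var ''T'') (var ''c'')) s11"
                          then show "wp work move ?Q s11"
                            using same11 swap_labelled[OF Q'_def found(5)] found(4,7) sides(1,3) sub(2) w(2)
                              bisection_facts(7)[OF P(2)] 11 sw(1,2) sw(3)[of 2] sw(3)[of 3]
                            by (intro mv[of s11 Q' w "block P 1"]) simp_all
                        next
                          assume "\<not> cond_val (Less (var ''T'') (var ''c'')) s11"
                          then have "card (block Q 1) \<le> target" using same11 by simp
                          then have "fine Q'"
                            using small cX sw(1,2) sw(3)[of 2] sw(3)[of 3] found(3,4)
                            by (intro fine_small swap_labelled[OF Q'_def found(5)]) simp_all
                          then show "wp work Skip ?Q s11"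
                            using same11 by (intro wp_Skip work_bounds(4)) simp
                        qed
                      qed
                    qed
                  qed
                qed
              qed
            qed
          next
            assume "\<not> cond_val (eq (var ''fl'') (Const 1)) s6"
            then have "bounded f gap" using 6 cls5 by (auto split: if_splits)
            then show "wp work Skip ?Q s6"
              using bridge_none[OF P(2) u(2) w(2) f] same6 by (intro wp_Skip work_bounds(4)) simp
          qed
        qed
      qed
    qed
    then show "wp work (Store ''cls'' (var ''u'') (Const 0) ;; Store ''cls'' (var ''w'') (Const 0) ;;
        comps ;; ''th'' ::= var ''g'' ;; find ;; ?fin) ?Q s1"
      by (intro wp_Store_seq[OF work_bounds(4)]) (simp add: uw1)
  qed
qed

section \<open>Cutting the halves and shrinking a half with a centre\<close>

lemma put_cut:
  assumes "labelled P" "block P l = H" "X \<subset> H" "conn X" "conn (H - X)" "k \<noteq> l" "k < 4" "block P k = {}"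
    and Q: "Q = (\<lambda>y. if y \<in> V \<and> y \<in> X then k else P y)"
  shows "labelled Q" "block Q l = H - X" "block Q k = X" "\<And>j. j \<noteq> l \<Longrightarrow> j \<noteq> k \<Longrightarrow> block Q j = block P j"
proof -
  have XV: "X \<subseteq> V" using assms(2,3) block_subset by blast
  have PX: "P y = l" if "y \<in> X" for y using that assms(2,3) by (auto simp: block_def)
  show b: "block Q l = H - X"
    using assms(2,6) XV unfolding Q by (auto simp: block_def)
  show bk: "block Q k = X"
    using assms(8) XV unfolding Q by (auto simp: block_def)
  show bj: "block Q j = block P j" if "j \<noteq> l" "j \<noteq> k" for j
    using that PX unfolding Q by (auto simp: block_def)
  have "block Q j = {} \<or> conn (block Q j)" for j
    using b bk bj[of j] assms(1,4,5) by (cases "j = l"; cases "j = k") (simp_all add: labelled_def)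
  moreover have "\<forall>v\<in>V. Q v < 4"
    using assms(1,7) unfolding Q labelled_def by simp
  ultimately show "labelled Q" by (simp add: labelled_def)
qed

text \<open>The threshold \<theta> = card H - T makes \<open>H - X\<close> at most T because
  \<theta> \<le> card X. For \<open>X\<close>, a second side of at least \<theta> gives T directly;
  the glued case gives at most 2\<theta> - 2 \<le> 2g - 2 \<le> T.\<close>

lemma cut_sizes:
  assumes "2 * target + 2 \<le> n" "cut H (card H - target) X Y" "target < card H" "card H \<le> target + gap"
    and "finite H"
  shows "card X \<le> target" "card (H - X) \<le> target"
proof -
  have X: "X \<subseteq> H" "card H - target \<le> card X" "Y \<subseteq> X" using assms(2) by (auto simp: cut_def)
  have fin: "finite X" "finite Y"
    using finite_subset[OF X(1) assms(5)] finite_subset[OF X(3)] by simp_all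
  show "card (H - X) \<le> target"
    using X(2) card_Diff_subset[OF fin(1) X(1)] by linarith
  have "card X = card Y + card (X - Y)"
    using card_Diff_subset[OF fin(2) X(3)] card_mono[OF fin(1) X(3)] by simp
  then show "card X \<le> target"
    using assms(2,3,4) gap_facts(5)[OF assms(1)] unfolding cut_def by linarith
qed

lemma wp_put_X:
  assumes "env s" "indicates (s ''X'') X" "s ''part'' = P"
  shows "wp work (put in_X k) (\<lambda>s'. env s' \<and> s' ''part'' = (\<lambda>y. if y \<in> V \<and> y \<in> X then k else P y)) s"
  unfolding assms(3)[symmetric]
  by (rule wp_put[OF assms(1)]) (auto simp: agree_def indicatesD[OF assms(2)])

lemma wp_put_part:
  assumes "env s" "s ''part'' = P"
  shows "wp work (put (part_is l) k) (\<lambda>s'. env s' \<and> s' ''part'' = (\<lambda>y. if y \<in> V \<and> P y = l then k else P y)) s"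
  unfolding assms(2)[symmetric] by (rule wp_put[OF assms(1)]) auto

lemma wp_half:
  assumes "env s" "block (s ''part'') l = H" "conn H" "target < card H"
  shows "wp work (splitter l (Sub (var ''h'') (var ''T''))) (\<lambda>s'. env s' \<and> (if s' ''fl'' 0 = 1
    then \<exists>X Y. indicates (s' ''X'') X \<and> cut H (card H - target) X Y
    else s' ''fl'' 0 = 0 \<and> center H (card H - target) (s' ''z'' 0))) s"
proof -
  have "wp work (splitter l (Sub (var ''h'') (var ''T''))) (\<lambda>s'. if s' ''fl'' 0 = 1
    then \<exists>X. indicates (s' ''X'') X \<and> cut H (card H - target) X (piece (s' ''pc'') (s' ''e'' 0))
    else s' ''fl'' 0 = 0 \<and> center H (card H - target) (s' ''z'' 0)) s"
    using assms(1,4) by (intro wp_splitter[OF env_inp[OF assms(1)] assms(2,3)]) (auto simp: env_def agree_def)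
  then show ?thesis
  proof (rule wp_weaken[OF _ order_refl])
    fix s'
    assume 1: "if s' ''fl'' 0 = 1
      then \<exists>X. indicates (s' ''X'') X \<and> cut H (card H - target) X (piece (s' ''pc'') (s' ''e'' 0))
      else s' ''fl'' 0 = 0 \<and> center H (card H - target) (s' ''z'' 0)"
      and ag: "agree (writes (splitter l (Sub (var ''h'') (var ''T'')))) s s'"
    have "env s'" by (rule env_agree[OF ag assms(1)]) simp
    then show "env s' \<and> (if s' ''fl'' 0 = 1
      then \<exists>X Y. indicates (s' ''X'') X \<and> cut H (card H - target) X Y
      else s' ''fl'' 0 = 0 \<and> center H (card H - target) (s' ''z'' 0))"
      using 1 by (auto split: if_splits)
  qed
qed

text \<open>Without a split-off branch the exhausted star is certified by \<open>moved_fine\<close>.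
  With one, only block 1 is above T, and it is either cut or has a centre of its own.\<close>

lemma wp_shrink:
  assumes env: "env s" and P: "s ''part'' = P" "bisection P"
    and u: "s ''u'' 0 = u" "center (block P 0) gap u"
  shows "wp work shrink (\<lambda>s'. fine (s' ''part'')) s"
    (is "wp _ _ ?Q s")
proof -
  note facts = bisection_facts[OF P(2)]
  note nn = facts(5)
  have u0: "u \<in> block P 0" using u(2) by (simp add: center_def)
  have big: "target < card (block P 0)" "target < card (block P 1)" using P(2) by (simp_all add: bisection_def)
  have T: "s ''T'' 0 = target" using env by (simp add: env_def)
  let ?sp = "splitter 1 (Sub (var ''h'') (var ''T''))"
  let ?else = "''w'' ::= var ''z'' ;; put (part_is 3) 0 ;; bridge"
  let ?fin = "If (eq (var ''fl'') (Const 1)) (put in_X 2) ?else"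
  show ?thesis
    unfolding shrink_def
  proof (rule wp_Seq[OF wp_weaken[OF wp_move[OF env_inp[OF env] P(1) facts(1,3) u(1) u0 T big(1)] work_bounds(3)]])
    fix s1
    assume 1: "s1 ''dn'' 0 \<le> 1 \<and> moved P u target (s1 ''part'') (s1 ''dn'' 0 = 1)"
      and ag1: "agree (writes move) s s1"
    define R d where "R = s1 ''part''" and "d = (s1 ''dn'' 0 = 1)"
    have mv: "moved P u target R d" using 1 by (simp add: R_def d_def)
    have env1: "env s1" by (rule env_agree[OF ag1 env]) simp
    have labR: "labelled R" and uR: "u \<in> block R 0" and subR: "block R 0 \<subseteq> block P 0"
      "block R 3 \<subseteq> block P 0 - {u}" "block P 1 \<subseteq> block R 1" and R2: "block R 2 = {}"
      using mv facts(2) by (auto simp: moved_def)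
    have lt4: "\<forall>v\<in>V. R v < 4" and connR: "\<And>l. block R l = {} \<or> conn (block R l)"
      using labR by (simp_all add: labelled_def)
    have sum: "card (block R 0) + card (block R 1) + card (block R 3) = n"
      using card_blocks[OF lt4] R2 by simp
    have un: "card (block R 0 \<union> block R 3) = card (block R 0) + card (block R 3)"
      by (rule card_Un_disjoint) (auto simp: block_def)
    have more: "target < card (block R 0) + card (block R 3)"
      using mv un by (cases d) (auto simp: moved_def)
    \<comment> \<open>Blocks 0 and 3 together are still above T, so at most n - (T + 1) vertices are
      left.\<close>
    then have b1: "card (block R 1) \<le> target + gap"
      using sum gap_facts(1)[OF nn] by linarith
    have big1: "target < card (block R 1)"
      using big(2) card_mono[OF finite_block subR(3)] by linarith
    show "wp work (If (eq (var ''dn'') (Const 1)) (?sp ;; ?fin) Skip) ?Q s1"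
    proof (rule wp_If[OF work_bounds(4)])
      assume "\<not> cond_val (eq (var ''dn'') (Const 1)) s1"
      then have "\<not> d" by (simp add: d_def)
      then have "fine R"
        using b1 R2 by (intro moved_fine[OF nn u(2) big(1) facts(6) mv]) simp
      then show "wp work Skip ?Q s1" by (intro wp_Skip work_bounds(4)) (simp add: R_def)
    next
      assume "cond_val (eq (var ''dn'') (Const 1)) s1"
      then have d: d by (simp add: d_def)
      then have R0: "card (block R 0) \<le> target" "conn (block R 0 \<union> block R 3)"
        using mv by (simp_all add: moved_def)
      have H: "conn (block R 1)" using big1 connR[of 1] by auto
      have R3: "card (block R 3) \<le> target"
      proof (cases "block R 3 = {}")
        case False
        then have "card (block R 3) < gap" using u(2) connR[of 3] subR(2) by (simp add: center_def)
        then show ?thesis using gap_facts(4)[OF nn] by linarith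
      qed simp
      have half: "block (s1 ''part'') 1 = block R 1" by (simp add: R_def)
      show "wp work (?sp ;; ?fin) ?Q s1"
      proof (rule wp_Seq[OF wp_half[OF env1 half H big1]])
        fix s2
        assume 2: "env s2 \<and> (if s2 ''fl'' 0 = 1
          then \<exists>X Y. indicates (s2 ''X'') X \<and> cut (block R 1) (card (block R 1) - target) X Y
          else s2 ''fl'' 0 = 0 \<and> center (block R 1) (card (block R 1) - target) (s2 ''z'' 0))"
          and ag2: "agree (writes ?sp) s1 s2"
        have env2: "env s2" using 2 by blast
        have same2: "s2 ''part'' = R" "s2 ''u'' 0 = u"
          using ag1 ag2 u(1) by (simp_all add: agree_def R_def)
        show "wp work ?fin ?Q s2"
        proof (rule wp_If[OF work_bounds(4)])
          assume "cond_val (eq (var ''fl'') (Const 1)) s2"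
          then obtain X Y where X: "indicates (s2 ''X'') X" and cut: "cut (block R 1) (card (block R 1) - target) X Y"
            using 2 by auto
          have c: "X \<subset> block R 1" "conn X" "conn (block R 1 - X)" using cut by (auto simp: cut_def)
          note pc = put_cut[OF labR refl c _ _ R2 refl, simplified]
          note sz = cut_sizes[OF nn cut big1 b1 finite_block]
          have "fine (\<lambda>y. if y \<in> V \<and> y \<in> X then 2 else R y)"
            by (rule fine_small[OF pc(1)]) (use pc(2,3) pc(4)[of 0] pc(4)[of 3] sz R0(1) R3 in simp_all)
          then show "wp work (put in_X 2) ?Q s2"
            by (intro wp_weaken[OF wp_put_X[OF env2 X same2(1)] order_refl]) simp
        next
          assume "\<not> cond_val (eq (var ''fl'') (Const 1)) s2"
          then have cen: "center (block R 1) (card (block R 1) - target) (s2 ''z'' 0)"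
            using 2 by (simp split: if_splits)
          have cen': "center (block R 1) gap (s2 ''z'' 0)"
            by (rule center_mono[OF cen]) (use b1 in simp)
          show "wp work ?else ?Q s2"
          proof (rule wp_Seq[OF wp_assign[OF work_bounds(4)]])
            fix s3
            assume 3: "s3 ''w'' 0 = expr_val (var ''z'') s2" and ag3: "agree (writes (''w'' ::= var ''z'')) s2 s3"
            have env3: "env s3" by (rule env_agree[OF ag3 env2]) simp
            have same3: "s3 ''part'' = R" "s3 ''u'' 0 = u" "s3 ''w'' 0 = s2 ''z'' 0"
              using ag3 same2 3 by (simp_all add: agree_def)
            \<comment> \<open>Returning the branch of label 3 to block 0 restores a bisection; its
              block 0 lies inside the original one and keeps the centre \<open>u\<close>.\<close>
            define Q where "Q = (\<lambda>y. if y \<in> V \<and> R y = 3 then 0 else R y)"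
            have "block Q 0 = block R 0 \<union> block R 3" "block Q 1 = block R 1"
              by (auto simp: Q_def block_def)
            moreover have "Q v < 2" if "v \<in> V" for v
            proof -
              have "R v < 4" "R v \<noteq> 2" using lt4 R2 that by (auto simp: block_def)
              then show ?thesis using that by (simp add: Q_def)
            qed
            ultimately have Q: "bisection Q" "block Q 1 = block R 1"
              and Q0: "block Q 0 = block R 0 \<union> block R 3"
              using R0(2) H more un big1 by (simp_all add: bisection_def)
            have cenQ: "center (block Q 0) gap u"
              by (rule center_subset[OF u(2)]) (use Q0 uR subR in auto)
            show "wp work (put (part_is 3) 0 ;; bridge) ?Q s3"
            proof (rule wp_Seq[OF wp_put_part[OF env3 same3(1)]])
              fix s4
              assume 4: "env s4 \<and> s4 ''part'' = (\<lambda>y. if y \<in> V \<and> R y = 3 then 0 else R y)"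
                and ag4: "agree (writes (put (part_is 3) 0)) s3 s4"
              have part4: "s4 ''part'' = Q" using 4 unfolding Q_def by blast
              have uw: "s4 ''u'' 0 = u" "s4 ''w'' 0 = s2 ''z'' 0"
                using ag4 same3 by (simp_all add: agree_def)
              show "wp work bridge ?Q s4"
                by (rule wp_bridge[OF conjunct1[OF 4] part4 Q(1) uw(1) cenQ uw(2)]) (use Q(2) cen' in simp)
            qed
          qed
        qed
      qed
    qed
  qed
qed

lemma wp_halve:
  assumes env: "env s" and P: "s ''part'' = P" "bisection P"
  shows "wp work halve (\<lambda>s'. fine (s' ''part'')) s"
    (is "wp _ _ ?Q s")
proof -
  note facts = bisection_facts[OF P(2)]
  note nn = facts(5)
  have c: "conn (block P 0)" "conn (block P 1)" and big: "target < card (block P 0)" "target < card (block P 1)"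
    and lt2: "\<forall>v\<in>V. P v < 2"
    using P(2) by (simp_all add: bisection_def)
  let ?sp = "\<lambda>l. splitter l (Sub (var ''h'') (var ''T''))"
  let ?back = "''u'' ::= var ''z'' ;; put (part_is 2) 0 ;; swap ;; shrink"
  let ?fin = "If (eq (var ''fl'') (Const 1)) (put in_X 3) ?back"
  have half: "block (s ''part'') 0 = block P 0" by (simp add: P(1))
  show ?thesis
    unfolding halve_def
  proof (rule wp_Seq[OF wp_half[OF env half c(1) big(1)]])
    fix s1
    assume 1: "env s1 \<and> (if s1 ''fl'' 0 = 1
      then \<exists>X Y. indicates (s1 ''X'') X \<and> cut (block P 0) (card (block P 0) - target) X Y
      else s1 ''fl'' 0 = 0 \<and> center (block P 0) (card (block P 0) - target) (s1 ''z'' 0))"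
      and ag1: "agree (writes (?sp 0)) s s1"
    have env1: "env s1" using 1 by blast
    have part1: "s1 ''part'' = P" using ag1 P(1) by (simp add: agree_def)
    show "wp work (If (eq (var ''fl'') (Const 1)) (put in_X 2 ;; ?sp 1 ;; ?fin) (''u'' ::= var ''z'' ;; shrink)) ?Q s1"
    proof (rule wp_If[OF work_bounds(4)])
      assume "\<not> cond_val (eq (var ''fl'') (Const 1)) s1"
      then have cen: "center (block P 0) (card (block P 0) - target) (s1 ''z'' 0)"
        using 1 by (simp split: if_splits)
      have cen': "center (block P 0) gap (s1 ''z'' 0)"
        by (rule center_mono[OF cen]) (use facts(6) in simp)
      show "wp work (''u'' ::= var ''z'' ;; shrink) ?Q s1"
      proof (rule wp_Seq[OF wp_assign[OF work_bounds(4)]])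
        fix s2
        assume 2: "s2 ''u'' 0 = expr_val (var ''z'') s1" and ag2: "agree (writes (''u'' ::= var ''z'')) s1 s2"
        have env2: "env s2" by (rule env_agree[OF ag2 env1]) simp
        have same2: "s2 ''part'' = P" "s2 ''u'' 0 = s1 ''z'' 0"
          using ag2 part1 2 by (simp_all add: agree_def)
        show "wp work shrink ?Q s2" by (rule wp_shrink[OF env2 same2(1) P(2) same2(2) cen'])
      qed
    next
      assume "cond_val (eq (var ''fl'') (Const 1)) s1"
      then obtain X Y where X: "indicates (s1 ''X'') X" and cut: "cut (block P 0) (card (block P 0) - target) X Y"
        using 1 by auto
      have cX: "X \<subset> block P 0" "conn X" "conn (block P 0 - X)" using cut by (auto simp: cut_def)
      define R where "R = (\<lambda>y. if y \<in> V \<and> y \<in> X then 2 else P y)"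
      note pc = put_cut[OF facts(1) refl cX _ _ facts(2) R_def, simplified]
      note sz = cut_sizes[OF nn cut big(1) facts(6) finite_block]
      have R: "block R 1 = block P 1" "block R 3 = {}" using pc(4)[of 1] pc(4)[of 3] facts(3) by simp_all
      show "wp work (put in_X 2 ;; ?sp 1 ;; ?fin) ?Q s1"
      proof (rule wp_Seq[OF wp_put_X[OF env1 X part1]])
        fix s2
        assume 2: "env s2 \<and> s2 ''part'' = (\<lambda>y. if y \<in> V \<and> y \<in> X then 2 else P y)"
        have env2: "env s2" using 2 by blast
        have part2: "s2 ''part'' = R" using 2 unfolding R_def by blast
        then have half2: "block (s2 ''part'') 1 = block P 1" using R(1) by simp
        show "wp work (?sp 1 ;; ?fin) ?Q s2"
        proof (rule wp_Seq[OF wp_half[OF env2 half2 c(2) big(2)]])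
          fix s3
          assume 3: "env s3 \<and> (if s3 ''fl'' 0 = 1
            then \<exists>X Y. indicates (s3 ''X'') X \<and> cut (block P 1) (card (block P 1) - target) X Y
            else s3 ''fl'' 0 = 0 \<and> center (block P 1) (card (block P 1) - target) (s3 ''z'' 0))"
            and ag3: "agree (writes (?sp 1)) s2 s3"
          have env3: "env s3" using 3 by blast
          have part3: "s3 ''part'' = R" using ag3 part2 by (simp add: agree_def)
          show "wp work ?fin ?Q s3"
          proof (rule wp_If[OF work_bounds(4)])
            assume "cond_val (eq (var ''fl'') (Const 1)) s3"
            then obtain X' Y' where X': "indicates (s3 ''X'') X'"
              and cut': "cut (block P 1) (card (block P 1) - target) X' Y'"
              using 3 by auto
            have cX': "X' \<subset> block P 1" "conn X'" "conn (block P 1 - X')" using cut' by (auto simp: cut_def)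
            note pc' = put_cut[OF pc(1) R(1) cX' _ _ R(2) refl, simplified]
            note sz' = cut_sizes[OF nn cut' big(2) facts(7) finite_block]
            have "fine (\<lambda>y. if y \<in> V \<and> y \<in> X' then 3 else R y)"
              by (rule fine_small[OF pc'(1)])
                (use pc'(2,3) pc'(4)[of 0] pc'(4)[of 2] pc(2,3) sz sz' in simp_all)
            then show "wp work (put in_X 3) ?Q s3"
              by (intro wp_weaken[OF wp_put_X[OF env3 X' part3] order_refl]) simp
          next
            assume "\<not> cond_val (eq (var ''fl'') (Const 1)) s3"
            then have cen: "center (block P 1) (card (block P 1) - target) (s3 ''z'' 0)"
              using 3 by (simp split: if_splits)
            have cen': "center (block P 1) gap (s3 ''z'' 0)"
              by (rule center_mono[OF cen]) (use facts(7) in simp)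
            show "wp work ?back ?Q s3"
            proof (rule wp_Seq[OF wp_assign[OF work_bounds(4)]])
              fix s4
              assume 4: "s4 ''u'' 0 = expr_val (var ''z'') s3"
                and ag4: "agree (writes (''u'' ::= var ''z'')) s3 s4"
              have env4: "env s4" by (rule env_agree[OF ag4 env3]) simp
              have part4: "s4 ''part'' = R" and u4: "s4 ''u'' 0 = s3 ''z'' 0"
                using ag4 part3 4 by (simp_all add: agree_def)
              show "wp work (put (part_is 2) 0 ;; swap ;; shrink) ?Q s4"
              proof (rule wp_Seq[OF wp_put_part[OF env4 part4]])
                fix s5
                assume 5: "env s5 \<and> s5 ''part'' = (\<lambda>y. if y \<in> V \<and> R y = 2 then 0 else R y)"
                  and ag5: "agree (writes (put (part_is 2) 0)) s4 s5"
                \<comment> \<open>Label 2 was given exactly to \<open>X\<close>, which came from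
                  block 0, so this undoes the cut.\<close>
                have "(if y \<in> V \<and> R y = 2 then 0 else R y) = P y" for y
                  using lt2 cX(1) by (auto simp: R_def block_def)
                then have part5: "s5 ''part'' = P" using 5 by simp
                show "wp work (swap ;; shrink) ?Q s5"
                proof (rule wp_Seq[OF wp_swap[OF conjunct1[OF 5]]])
                  fix s6
                  assume 6: "env s6 \<and> s6 ''part'' = (\<lambda>y. if y \<in> V \<and> s5 ''part'' y < 2
                      then 1 - s5 ''part'' y else s5 ''part'' y)"
                    and ag6: "agree (writes swap) s5 s6"
                  define Q where "Q = (\<lambda>y. if y \<in> V \<and> P y < 2 then 1 - P y else P y)"
                  note sw = bisection_swap[OF P(2) Q_def]
                  have part6: "s6 ''part'' = Q" using 6 unfolding part5 Q_def by blast
                  have u6: "s6 ''u'' 0 = s3 ''z'' 0" using ag6 ag5 u4 by (simp add: agree_def)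
                  show "wp work shrink ?Q s6"
                    by (rule wp_shrink[OF conjunct1[OF 6] part6 sw(1) u6]) (use sw(2) cen' in simp)
                qed
              qed
            qed
          qed
        qed
      qed
    qed
  qed
qed

end

text \<open>Setting the class of the chosen branch to 0 excludes it from later calls of
  \<open>best\<close>, while the labels \<open>pc\<close> stay valid. If no branch is left, the
  block remains empty.\<close>

definition pick :: "nat \<Rightarrow> prog" where
  "pick l = best ;;
     If (Less (Const 0) (var ''bs''))
       (put (eq (Cell ''pc'' (var ''v'')) (Cell ''pc'' (var ''by''))) l ;;
        update ''cls'' (eq (Cell ''pc'' (var ''v'')) (Cell ''pc'' (var ''by''))) (Const 0)) Skip"

definition claw :: prog where
  "claw = update ''cls'' (Less (Const 0) (Const 1)) (Const 1) ;;
     Store ''cls'' (var ''z'') (Const 0) ;; comps ;; pick 1 ;; pick 2 ;; pick 3"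

text \<open>One side of the cut has at least T + 1 vertices. If the other side is above T too, this
  is a bisection; otherwise the large side is divided at the piece glued last.\<close>

definition split_up :: prog where
  "split_up = splitter 0 (Add (var ''T'') (Const 1)) ;;
     If (eq (var ''fl'') (Const 1))
       (put in_X 1 ;; count ''c'' (part_is 1) ;;
        If (Less (Add (var ''T'') (var ''c'')) (var ''n'')) halve
          (put (eq (Cell ''pc'' (var ''v'')) (Cell ''pc'' (var ''e''))) 2))
       claw"

lemma writes_pick [simp]:
  "writes (pick l) = {''i'', ''v'', ''c'', ''i2'', ''v2'', ''bs'', ''by'', ''part'', ''cls''}"
  by (auto simp: pick_def)

section \<open>A centre of the whole graph and the first split\<close>

context graph_input begin

text \<open>Links the classes to the labelling between two picks: class 1 marks the unassigned
  vertices other than \<open>x\<close>, and branches are assigned only as a whole.\<close>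

definition eligible :: "(nat \<Rightarrow> nat) \<Rightarrow> nat \<Rightarrow> (nat \<Rightarrow> nat) \<Rightarrow> (nat \<Rightarrow> nat) \<Rightarrow> bool" where
  "eligible c x R f \<longleftrightarrow> (\<forall>y\<in>V. f y = 1 \<longleftrightarrow> R y = 0 \<and> y \<noteq> x) \<and>
     (\<forall>y\<in>V - {x}. R y = 0 \<longrightarrow> piece c y \<subseteq> block R 0 - {x})"

lemma wp_pick:
  assumes env: "env s" and c: "s ''pc'' = c" and R: "s ''part'' = R" and el: "eligible c x R (s ''cls'')" and l: "0 < l"
  shows "wp work (pick l) (\<lambda>s'. env s' \<and> s' ''pc'' = c \<and> (\<exists>C.
    (C = {} \<or> (\<exists>y\<in>V - {x}. C = piece c y)) \<and> C \<subseteq> block R 0 - {x} \<and>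
    s' ''part'' = (\<lambda>y. if y \<in> V \<and> y \<in> C then l else R y) \<and> eligible c x (s' ''part'') (s' ''cls'') \<and>
    (\<forall>y\<in>V - {x}. R y = 0 \<longrightarrow> card (piece c y) \<le> card C))) s"
    (is "wp _ _ ?Q s")
proof -
  let ?b = "eq (Cell ''pc'' (var ''v'')) (Cell ''pc'' (var ''by''))"
  let ?u = "update ''cls'' ?b (Const 0)"
  define f where "f = s ''cls''"
  have f: "\<forall>y\<in>V. f y = 1 \<longleftrightarrow> R y = 0 \<and> y \<noteq> x"
    and closed: "\<And>y. y \<in> V - {x} \<Longrightarrow> R y = 0 \<Longrightarrow> piece c y \<subseteq> block R 0 - {x}"
    using el by (auto simp: eligible_def f_def)
  have nn: "n * n \<le> work" using time_bounds(4,5) le_trans by blast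
  show ?thesis
    unfolding pick_def
  proof (rule wp_Seq[OF wp_weaken[OF wp_best[OF env_inp[OF env]] nn]])
    fix s1
    assume 1: "(\<forall>y\<in>V. s ''cls'' y = 1 \<longrightarrow> card (piece (s ''pc'') y) \<le> s1 ''bs'' 0) \<and>
      (s1 ''bs'' 0 = 0 \<or> s1 ''by'' 0 \<in> V \<and> s ''cls'' (s1 ''by'' 0) = 1 \<and>
        s1 ''bs'' 0 = card (piece (s ''pc'') (s1 ''by'' 0)))"
      and ag1: "agree (writes best) s s1"
    have env1: "env s1" by (rule env_agree[OF ag1 env]) simp
    have same1: "s1 ''pc'' = c" "s1 ''part'' = R" "s1 ''cls'' = f"
      using ag1 c R by (simp_all add: agree_def f_def)
    have max: "card (piece c y) \<le> s1 ''bs'' 0" if "y \<in> V - {x}" "R y = 0" for y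
      using 1 that f by (simp add: c f_def)
    show "wp work (If (Less (Const 0) (var ''bs'')) (put ?b l ;; ?u) Skip) ?Q s1"
    proof (rule wp_If[OF work_bounds(4)])
      assume "cond_val (Less (Const 0) (var ''bs'')) s1"
      then have bs: "0 < s1 ''bs'' 0" by simp
      define y where "y = s1 ''by'' 0"
      have y: "y \<in> V - {x}" "R y = 0" "s1 ''bs'' 0 = card (piece c y)"
        using 1 bs f by (auto simp: c f_def y_def)
      note sub = closed[OF y(1,2)]
      have put: "wp work (put ?b l) (\<lambda>s'. env s' \<and>
          s' ''part'' = (\<lambda>v. if v \<in> V \<and> c v = c y then l else s1 ''part'' v)) s1"
        by (rule wp_put[OF env1]) (auto simp: agree_def same1 y_def)
      show "wp work (put ?b l ;; ?u) ?Q s1"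
      proof (rule wp_Seq[OF put])
        fix s2
        assume 2: "env s2 \<and> s2 ''part'' = (\<lambda>v. if v \<in> V \<and> c v = c y then l else s1 ''part'' v)"
          and ag2: "agree (writes (put ?b l)) s1 s2"
        define R' where "R' = (\<lambda>v. if v \<in> V \<and> v \<in> piece c y then l else R v)"
        have part2: "s2 ''part'' = R'" using 2 same1(2) by (auto simp: R'_def piece_def)
        have same2: "s2 ''pc'' = c" "s2 ''cls'' = f" "s2 ''by'' 0 = y"
          using ag2 same1 by (simp_all add: agree_def y_def)
        have env2: "env s2" using 2 by blast
        have "wp n ?u (\<lambda>s'. s' ''cls'' = (\<lambda>v. if v \<in> V \<and> c v = c y then 0 else s2 ''cls'' v)) s2"
          by (rule wp_update[OF env_inp[OF env2]]) (auto simp: agree_def same2)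
        then show "wp work ?u ?Q s2"
        proof (rule wp_weaken[OF _ work_bounds(1)])
          fix s3
          assume 3: "s3 ''cls'' = (\<lambda>v. if v \<in> V \<and> c v = c y then 0 else s2 ''cls'' v)"
            and ag3: "agree (writes ?u) s2 s3"
          have env3: "env s3" by (rule env_agree[OF ag3 env2]) simp
          have same3: "s3 ''pc'' = c" "s3 ''part'' = R'"
            using ag3 same2 part2 by (simp_all add: agree_def)
          have "eligible c x R' (s3 ''cls'')"
            unfolding eligible_def
          proof (intro conjI ballI impI)
            fix v assume v: "v \<in> V"
            show "s3 ''cls'' v = 1 \<longleftrightarrow> R' v = 0 \<and> v \<noteq> x"
              using bspec[OF f v] l v unfolding 3 same2(2) R'_def by (auto simp: piece_def)
          next
            fix v assume v: "v \<in> V - {x}" "R' v = 0"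
            have nv: "v \<notin> piece c y" "R v = 0" using v l by (auto simp: R'_def split: if_splits)
            have "z \<in> block R' 0 - {x}" if z: "z \<in> piece c v" for z
            proof -
              have "z \<in> block R 0 - {x}" using closed[OF v(1) nv(2)] z by blast
              moreover have "z \<notin> piece c y" using z nv(1) v(1) by (auto simp: piece_def)
              ultimately show ?thesis by (auto simp: R'_def block_def)
            qed
            then show "piece c v \<subseteq> block R' 0 - {x}" by blast
          qed
          then show "?Q s3"
            using env3 same3 y(1) sub max unfolding y(3)
            by (intro conjI exI[of _ "piece c y"]) (auto simp: R'_def)
        qed
      qed
    next
      assume "\<not> cond_val (Less (Const 0) (var ''bs'')) s1"
      then have "s1 ''bs'' 0 = 0" by simp
      then show "wp work Skip ?Q s1"
        using env1 same1 max el by (intro wp_Skip work_bounds(4) conjI exI[of _ "{}"]) (auto simp: f_def)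
    qed
  qed
qed

text \<open>The chosen branches are at most T by the centre property. The rest may be large, but it
  is connected through \<open>x\<close> and certified by \<open>star_good\<close>.\<close>

lemma claw_fine:
  assumes cen: "center V (target + 1) x" and c: "is_pieces f c" "\<forall>v\<in>V. f v = (if v = x then 0 else 1)"
    and P: "\<forall>v\<in>V. P v = 0"
    and C: "\<And>C. C \<in> {C1, C2, C3} \<Longrightarrow> C = {} \<or> (\<exists>y\<in>V - {x}. C = piece c y)"
    and R: "R1 = (\<lambda>y. if y \<in> V \<and> y \<in> C1 then 1 else P y)" "R2 = (\<lambda>y. if y \<in> V \<and> y \<in> C2 then 2 else R1 y)"
      "R3 = (\<lambda>y. if y \<in> V \<and> y \<in> C3 then 3 else R2 y)"
    and sub: "C2 \<subseteq> block R1 0 - {x}" "C3 \<subseteq> block R2 0 - {x}"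
    and 1: "\<forall>y\<in>V - {x}. P y = 0 \<longrightarrow> card (piece c y) \<le> card C1"
    and 2: "\<forall>y\<in>V - {x}. R1 y = (0::nat) \<longrightarrow> card (piece c y) \<le> card C2"
    and 3: "\<forall>y\<in>V - {x}. R2 y = (0::nat) \<longrightarrow> card (piece c y) \<le> card C3"
  shows "fine R3"
proof -
  have xV: "x \<in> V" using cen by (simp add: center_def)
  have CV: "C \<subseteq> V - {x}" "C = {} \<or> conn C" "\<And>y. y \<in> C \<Longrightarrow> piece c y = C" if CC: "C \<in> {C1, C2, C3}" for C
  proof -
    have "C \<subseteq> V - {x} \<and> (C = {} \<or> conn C) \<and> (\<forall>y\<in>C. piece c y = C)"
    proof (cases "C = {}")
      case False
      then obtain y where y: "y \<in> V" "y \<noteq> x" "C = piece c y" using C[OF CC] by auto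
      have "x \<notin> piece c y"
      proof
        assume "x \<in> piece c y"
        from piece_class[OF c(1) y(1) this] show False using c(2) xV y(1,2) by simp
      qed
      then show ?thesis using y piece_conn[OF c(1) y(1)] piece_subset piece_eq by blast
    qed simp
    then show "C \<subseteq> V - {x}" "C = {} \<or> conn C" "\<And>y. y \<in> C \<Longrightarrow> piece c y = C" by blast+
  qed
  have disj: "C1 \<inter> C2 = {}" "C1 \<inter> C3 = {}" "C2 \<inter> C3 = {}"
  proof -
    have "v \<notin> C1" if "v \<in> V" "R1 v = 0" for v using that by (simp add: R(1) split: if_splits)
    moreover have "v \<notin> C2 \<and> R1 v = 0" if "v \<in> V" "R2 v = 0" for v
      using that by (simp add: R(2) split: if_splits)
    ultimately show "C1 \<inter> C2 = {}" "C1 \<inter> C3 = {}" "C2 \<inter> C3 = {}"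
      using sub by (auto simp: block_def)
  qed
  have V: "C1 \<subseteq> V" "C2 \<subseteq> V" "C3 \<subseteq> V" using CV(1) by blast+
  have small: "card C \<le> target" if "C \<in> {C1, C2, C3}" for C
  proof (cases "C = {}")
    case False
    then have "card C < target + 1" using cen CV(1,2)[OF that] by (simp add: center_def)
    then show ?thesis by simp
  qed simp
  have good0: "good (card (V - (C1 \<union> C2 \<union> C3)))"
  proof (rule star_good[OF c(1) xV c(2) disj V])
    fix y assume y: "y \<in> V - {x}"
    show "card (piece c y) \<le> card C1" using 1 P y by blast
    assume n1: "piece c y \<noteq> C1"
    then have R1: "R1 y = 0" using CV(3)[of C1 y] P y by (auto simp: R(1))
    then show "card (piece c y) \<le> card C2" using 2 y by blast
    assume "piece c y \<noteq> C2"
    then have "R2 y = 0" using CV(3)[of C2 y] R1 by (auto simp: R(2))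
    then show "card (piece c y) \<le> card C3" using 3 y by blast
  qed
  have st: "star V x c"
    by (rule star_class[OF connected order_refl xV c(1), of 1]) (use c(2) xV in auto)
  have "conn (V - (C1 \<union> C2 \<union> C3))"
  proof (rule star_remove[OF st])
    show "C1 \<union> C2 \<union> C3 \<subseteq> V - {x}" using CV(1) by blast
    fix y assume "y \<in> C1 \<union> C2 \<union> C3"
    then show "piece c y \<subseteq> C1 \<union> C2 \<union> C3" using CV(3) by blast
  qed
  moreover have b: "block R3 0 = V - (C1 \<union> C2 \<union> C3)" "block R3 1 = C1" "block R3 2 = C2" "block R3 3 = C3"
    using V disj P unfolding R by (auto simp: block_def split: if_splits)
  ultimately have "sound (block R3 0)" using good0 by (simp add: sound_def)
  moreover have "sound (block R3 1)" "sound (block R3 2)" "sound (block R3 3)"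
    unfolding b using CV(2) small by (auto intro!: sound_small)
  moreover have "\<forall>v\<in>V. R3 v < 4" using P unfolding R by simp
  ultimately show ?thesis by (intro fineI)
qed

lemma wp_claw:
  assumes env: "env s" and P: "s ''part'' = P" "\<forall>v\<in>V. P v = 0" and x: "s ''z'' 0 = x" "center V (target + 1) x"
  shows "wp work claw (\<lambda>s'. fine (s' ''part'')) s"
    (is "wp _ _ ?Q s")
proof -
  let ?upd = "update ''cls'' (Less (Const 0) (Const 1)) (Const 1)"
  have "wp n ?upd (\<lambda>s'. s' ''cls'' = (\<lambda>y. if y \<in> V \<and> True then 1 else s ''cls'' y)) s"
    by (rule wp_update[OF env_inp[OF env]]) (auto simp: agree_def P)
  then show ?thesis
    unfolding claw_def
  proof (rule wp_Seq[OF wp_weaken[OF _ work_bounds(1)]])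
    fix s1
    assume 1: "s1 ''cls'' = (\<lambda>y. if y \<in> V \<and> True then 1 else s ''cls'' y)"
      and ag1: "agree (writes ?upd) s s1"
    let ?s2 = "s1(''cls'' := (s1 ''cls'')(x := 0))"
    define f where "f = ?s2 ''cls''"
    have f: "\<forall>v\<in>V. f v = (if v = x then 0 else 1)" using 1 by (simp add: f_def)
    have x1: "s1 ''z'' 0 = x" using ag1 x(1) by (simp add: agree_def)
    have ag2: "agree {''i'', ''v'', ''cls''} s ?s2" using ag1 by (auto simp: agree_def)
    have env2: "env ?s2" by (rule env_agree[OF ag2 env]) simp
    have "wp work (comps ;; pick 1 ;; pick 2 ;; pick 3) ?Q ?s2"
    proof (rule wp_Seq[OF wp_weaken[OF wp_comps[OF env_inp[OF env2]] work_bounds(2)]])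
      fix s3
      assume 3: "is_pieces (?s2 ''cls'') (s3 ''pc'')" and ag3: "agree (writes comps) ?s2 s3"
      have env3: "env s3" by (rule env_agree[OF ag3 env2]) simp
      define c where "c = s3 ''pc''"
      have pcs: "is_pieces f c" using 3 by (simp only: f_def c_def)
      have cls3: "s3 ''cls'' = f" using ag3 by (simp add: agree_def f_def)
      have part3: "s3 ''part'' = P" using ag3 ag2 P(1) by (simp add: agree_def)
      have xV: "x \<in> V" using x(2) by (simp add: center_def)
      have "star V x c"
        by (rule star_class[OF connected order_refl xV pcs, of 1]) (use f xV in auto)
      moreover have "block P 0 = V" using P(2) by (auto simp: block_def)
      ultimately have el: "eligible c x P (s3 ''cls'')"
        using f P(2) unfolding eligible_def cls3 star_def by simp
      show "wp work (pick 1 ;; pick 2 ;; pick 3) ?Q s3"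
      proof (rule wp_Seq[OF wp_pick[OF env3 c_def[symmetric] part3 el]])
        fix s4
        assume "env s4 \<and> s4 ''pc'' = c \<and> (\<exists>C. (C = {} \<or> (\<exists>y\<in>V - {x}. C = piece c y)) \<and>
          C \<subseteq> block P 0 - {x} \<and> s4 ''part'' = (\<lambda>y. if y \<in> V \<and> y \<in> C then 1 else P y) \<and>
          eligible c x (s4 ''part'') (s4 ''cls'') \<and>
          (\<forall>y\<in>V - {x}. P y = 0 \<longrightarrow> card (piece c y) \<le> card C))"
        then obtain C1 where 4: "env s4" "s4 ''pc'' = c" "C1 = {} \<or> (\<exists>y\<in>V - {x}. C1 = piece c y)"
          "s4 ''part'' = (\<lambda>y. if y \<in> V \<and> y \<in> C1 then 1 else P y)"
          "eligible c x (s4 ''part'') (s4 ''cls'')"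
          "\<forall>y\<in>V - {x}. P y = 0 \<longrightarrow> card (piece c y) \<le> card C1" by blast
        define R1 where "R1 = s4 ''part''"
        show "wp work (pick 2 ;; pick 3) ?Q s4"
        proof (rule wp_Seq[OF wp_pick[OF 4(1,2) refl 4(5)]])
          fix s5
          assume "env s5 \<and> s5 ''pc'' = c \<and> (\<exists>C. (C = {} \<or> (\<exists>y\<in>V - {x}. C = piece c y)) \<and>
            C \<subseteq> block (s4 ''part'') 0 - {x} \<and> s5 ''part'' = (\<lambda>y. if y \<in> V \<and> y \<in> C then 2 else s4 ''part'' y) \<and>
            eligible c x (s5 ''part'') (s5 ''cls'') \<and>
            (\<forall>y\<in>V - {x}. s4 ''part'' y = 0 \<longrightarrow> card (piece c y) \<le> card C))"
          then obtain C2 where 5: "env s5" "s5 ''pc'' = c" "C2 = {} \<or> (\<exists>y\<in>V - {x}. C2 = piece c y)"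
            "s5 ''part'' = (\<lambda>y. if y \<in> V \<and> y \<in> C2 then 2 else R1 y)"
            "eligible c x (s5 ''part'') (s5 ''cls'')"
            "\<forall>y\<in>V - {x}. R1 y = 0 \<longrightarrow> card (piece c y) \<le> card C2" "C2 \<subseteq> block R1 0 - {x}"
            unfolding R1_def[symmetric] by blast
          define R2 where "R2 = s5 ''part''"
          show "wp work (pick 3) ?Q s5"
          proof (rule wp_weaken[OF wp_pick[OF 5(1,2) refl 5(5)] order_refl])
            fix s6
            assume "env s6 \<and> s6 ''pc'' = c \<and> (\<exists>C. (C = {} \<or> (\<exists>y\<in>V - {x}. C = piece c y)) \<and>
              C \<subseteq> block (s5 ''part'') 0 - {x} \<and> s6 ''part'' = (\<lambda>y. if y \<in> V \<and> y \<in> C then 3 else s5 ''part'' y) \<and>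
              eligible c x (s6 ''part'') (s6 ''cls'') \<and>
              (\<forall>y\<in>V - {x}. s5 ''part'' y = 0 \<longrightarrow> card (piece c y) \<le> card C))"
            then obtain C3 where 6: "C3 = {} \<or> (\<exists>y\<in>V - {x}. C3 = piece c y)"
              "s6 ''part'' = (\<lambda>y. if y \<in> V \<and> y \<in> C3 then 3 else R2 y)"
              "\<forall>y\<in>V - {x}. R2 y = 0 \<longrightarrow> card (piece c y) \<le> card C3" "C3 \<subseteq> block R2 0 - {x}"
              unfolding R2_def[symmetric] by blast
            show "?Q s6"
              by (rule claw_fine[OF x(2) pcs f P(2) _ 4(4)[folded R1_def] 5(4)[folded R2_def] 6(2) 5(7) 6(4) 4(6) 5(6) 6(3)])
                (use 4(3) 5(3) 6(1) in auto)
          qed simp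
        qed simp
      qed simp
    qed
    then show "wp work (Store ''cls'' (var ''z'') (Const 0) ;; comps ;; pick 1 ;; pick 2 ;; pick 3) ?Q s1"
      by (intro wp_Store_seq[OF work_bounds(4)]) (simp add: x1)
  qed
qed

lemma wp_split_up:
  assumes env: "env s" and P: "s ''part'' = P" "\<forall>v\<in>V. P v = 0"
  shows "wp work split_up (\<lambda>s'. fine (s' ''part'')) s"
    (is "wp _ _ ?Q s")
proof -
  let ?sp = "splitter 0 (Add (var ''T'') (Const 1))"
  let ?last = "put (eq (Cell ''pc'' (var ''v'')) (Cell ''pc'' (var ''e''))) 2"
  let ?i = "If (Less (Add (var ''T'') (var ''c'')) (var ''n'')) halve ?last"
  have V0: "block (s ''part'') 0 = V" using P by (auto simp: block_def)
  have lab: "labelled P" "block P 0 = V" "\<And>l. 0 < l \<Longrightarrow> block P l = {}"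
  proof -
    show b: "block P 0 = V" "\<And>l. 0 < l \<Longrightarrow> block P l = {}"
      using P(2) by (auto simp: block_def)
    have "block P l = {} \<or> conn (block P l)" for l
      using b connected by (cases "l = 0") simp_all
    then show "labelled P" using P(2) by (simp add: labelled_def)
  qed
  have le: "target + 1 \<le> n" using target_bounds(1) card4 by linarith
  have sp: "wp work ?sp (\<lambda>s'. if s' ''fl'' 0 = 1
    then \<exists>X. indicates (s' ''X'') X \<and> cut V (target + 1) X (piece (s' ''pc'') (s' ''e'' 0))
    else s' ''fl'' 0 = 0 \<and> center V (target + 1) (s' ''z'' 0)) s"
    using env le by (intro wp_splitter[OF env_inp[OF env] V0 connected]) (auto simp: env_def agree_def)
  show ?thesis
    unfolding split_up_def
  proof (rule wp_Seq[OF sp])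
    fix s1
    assume 1: "if s1 ''fl'' 0 = 1
      then \<exists>X. indicates (s1 ''X'') X \<and> cut V (target + 1) X (piece (s1 ''pc'') (s1 ''e'' 0))
      else s1 ''fl'' 0 = 0 \<and> center V (target + 1) (s1 ''z'' 0)" and ag1: "agree (writes ?sp) s s1"
    have env1: "env s1" by (rule env_agree[OF ag1 env]) simp
    have part1: "s1 ''part'' = P" using ag1 P(1) by (simp add: agree_def)
    show "wp work (If (eq (var ''fl'') (Const 1)) (put in_X 1 ;; count ''c'' (part_is 1) ;; ?i) claw) ?Q s1"
    proof (rule wp_If[OF work_bounds(4)])
      assume "\<not> cond_val (eq (var ''fl'') (Const 1)) s1"
      then have "center V (target + 1) (s1 ''z'' 0)" using 1 by (simp split: if_splits)
      then show "wp work claw ?Q s1" by (rule wp_claw[OF env1 part1 P(2) refl])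
    next
      assume "cond_val (eq (var ''fl'') (Const 1)) s1"
      then obtain X where X: "indicates (s1 ''X'') X"
        and cut: "cut V (target + 1) X (piece (s1 ''pc'') (s1 ''e'' 0))" using 1 by auto
      define c e Y where "c = s1 ''pc''" and "e = s1 ''e'' 0" and "Y = piece c e"
      have cX: "X \<subset> V" "conn X" "conn (V - X)" "target + 1 \<le> card X" "Y \<subseteq> X"
        using cut by (auto simp: cut_def Y_def c_def e_def)
      have alt: "card X + (target + 1) \<le> n \<or> card Y < target + 1 \<and> card (X - Y) < target + 1 \<and> conn Y \<and> conn (X - Y)"
        using cut by (simp add: cut_def Y_def c_def e_def)
      have finX: "finite X" using cX(1) finite_subset[OF _ finite_V] by blast
      have cVX: "card (V - X) = n - card X"
        using cX(1) finX by (intro card_Diff_subset) auto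
      define R where "R = (\<lambda>y. if y \<in> V \<and> y \<in> X then 1 else P y)"
      note pc = put_cut[OF lab(1,2) cX(1-3) _ _ lab(3) R_def, simplified]
      show "wp work (put in_X 1 ;; count ''c'' (part_is 1) ;; ?i) ?Q s1"
      proof (rule wp_Seq[OF wp_put_X[OF env1 X part1]])
        fix s2
        assume 2: "env s2 \<and> s2 ''part'' = (\<lambda>y. if y \<in> V \<and> y \<in> X then 1 else P y)"
          and ag2: "agree (writes (put in_X 1)) s1 s2"
        have env2: "env s2" using 2 by blast
        have part2: "s2 ''part'' = R" using 2 unfolding R_def by blast
        show "wp work (count ''c'' (part_is 1) ;; ?i) ?Q s2"
        proof (rule wp_Seq[OF wp_count_part[OF env2]])
          fix s3
          assume 3: "env s3 \<and> s3 ''c'' 0 = card (block (s2 ''part'') 1)"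
            and ag3: "agree (writes (count ''c'' (part_is 1))) s2 s3"
          have env3: "env s3" using 3 by blast
          have same3: "s3 ''part'' = R" "s3 ''pc'' = c" "s3 ''e'' 0 = e" "s3 ''c'' 0 = card X"
            "s3 ''T'' 0 = target" "s3 ''n'' 0 = n"
            using ag2 ag3 3 part2 pc(3) by (simp_all add: agree_def c_def e_def env_def inp_def)
          show "wp work ?i ?Q s3"
          proof (rule wp_If[OF work_bounds(4)])
            assume "cond_val (Less (Add (var ''T'') (var ''c'')) (var ''n'')) s3"
            then have "target + card X < n" using same3 by simp
            moreover have "\<forall>v\<in>V. R v < 2" using P(2) by (simp add: R_def)
            ultimately have "bisection R"
              using pc(2,3) cX(2-4) cVX by (simp add: bisection_def)
            then show "wp work halve ?Q s3" by (rule wp_halve[OF env3 same3(1)])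
          next
            assume "\<not> cond_val (Less (Add (var ''T'') (var ''c'')) (var ''n'')) s3"
            then have big: "n \<le> target + card X" using same3 by simp
            \<comment> \<open>By \<open>big\<close>, the other side is too small for the first
              alternative of \<open>alt\<close>, so \<open>X\<close> consists of two connected sets
              of at most T vertices.\<close>
            then have sz: "card Y \<le> target" "card (X - Y) \<le> target" "conn Y" "conn (X - Y)"
              using alt by auto
            have "Y \<subset> X"
              using cX(4,5) sz(1) by (cases "Y = X") auto
            note pc' = put_cut[OF pc(1) pc(3) this sz(3,4) _ _ _ refl, of 2, simplified]
            have "block R 2 = {}" using pc(4)[of 2] lab(3) by simp
            note pc'' = pc'[OF this]
            have R3: "block R 3 = {}" using pc(4)[of 3] lab(3) by simp
            have "fine (\<lambda>y. if y \<in> V \<and> y \<in> Y then 2 else R y)"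
              by (rule fine_small[OF pc''(1)])
                (use pc''(2,3) pc''(4)[of 0] pc''(4)[of 3] pc(2) R3 sz(1,2) big cVX in simp_all)
            moreover have "(\<lambda>y. if y \<in> V \<and> y \<in> Y then 2 else R y) = (\<lambda>y. if y \<in> V \<and> c y = c e then 2 else s3 ''part'' y)"
              by (auto simp: Y_def piece_def same3(1))
            moreover have "wp work ?last (\<lambda>s'. env s' \<and>
                s' ''part'' = (\<lambda>y. if y \<in> V \<and> c y = c e then 2 else s3 ''part'' y)) s3"
              by (rule wp_put[OF env3]) (auto simp: agree_def same3)
            ultimately show "wp work ?last ?Q s3"
              by (elim wp_weaken[OF _ order_refl]) simp
          qed
        qed
      qed
    qed
  qed
qed

end

text \<open>An arc inside some part shows that the part has two vertices. The branch of
  \<open>y\<close> at \<open>x\<close> is split off; the rest keeps \<open>x\<close> and stays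
  connected through it.\<close>

definition occupy :: "nat \<Rightarrow> prog" where
  "occupy l = count ''c'' (part_is l) ;;
     If (eq (var ''c'') (Const 0))
       (find_arc (eq (Cell ''part'' (var ''p'')) (Cell ''part'' (var ''q''))) ;;
        ''a'' ::= Cell ''part'' (var ''x'') ;;
        indicator ''cls'' (eq (Cell ''part'' (var ''v'')) (var ''a'')) ;;
        Store ''cls'' (var ''x'') (Const 0) ;; comps ;;
        put (eq (Cell ''pc'' (var ''v'')) (Cell ''pc'' (var ''y''))) l) Skip"

text \<open>Without division, T is found by counting up while 13(T + 1) \<le> 6n, in at most n
  rounds.\<close>

definition partitioner :: prog where
  "partitioner =
     ''T'' ::= Const 0 ;;
     While (Neg (Less (scale 6 (var ''n'')) (scale 13 (Add (var ''T'') (Const 1)))))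
       (''T'' ::= Add (var ''T'') (Const 1)) ;;
     ''g'' ::= Sub (Sub (var ''n'') (Add (var ''T'') (var ''T''))) (Const 1) ;;
     split_up ;; occupy 0 ;; occupy 1 ;; occupy 2 ;; occupy 3"

section \<open>Filling empty parts and assembling the algorithm\<close>

context graph_input begin

text \<open>With one label empty, at most three blocks hold at least four vertices, so some
  connected block has two vertices and therefore an arc.\<close>

lemma occupy_arc:
  assumes "fine P" "block P l = {}" "l < 4"
  obtains p q where "(p, q) \<in> arcs" "P p = P q"
proof -
  have lt4: "\<forall>v\<in>V. P v < 4" using assms(1) by (simp add: fine_def)
  have "\<exists>j. 2 \<le> card (block P j)"
  proof (rule ccontr)
    assume "\<not> (\<exists>j. 2 \<le> card (block P j))"
    then have le: "card (block P j) \<le> 1" for j by (simp add: not_le) (metis less_Suc_eq_le numeral_2_eq_2)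
    have "l = 0 \<or> l = 1 \<or> l = 2 \<or> l = 3" using assms(3) by linarith
    then have "card (block P 0) = 0 \<or> card (block P 1) = 0 \<or> card (block P 2) = 0 \<or> card (block P 3) = 0"
      using assms(2) by auto
    then show False
      using card_blocks[OF lt4] card4 le[of 0] le[of 1] le[of 2] le[of 3] by linarith
  qed
  then obtain j where j: "2 \<le> card (block P j)" by blast
  then have ne: "block P j \<noteq> {}" by auto
  then have c: "conn (block P j)" using assms(1) by (auto simp: fine_def sound_def)
  obtain a where a: "a \<in> block P j" using ne by blast
  have "card {a} \<noteq> card (block P j)" using j by simp
  then have "{a} \<noteq> block P j" by metis
  then obtain p q where "(p, q) \<in> arcs" "p \<in> {a}" "q \<in> block P j - {a}"
    using conn_cut[OF c, of "{a}"] a by blast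
  then show ?thesis using that a by (auto simp: block_def)
qed

text \<open>Every new block is contained in an old one, so all size certificates carry over by
  monotonicity.\<close>

lemma occupy_fine:
  assumes P: "fine P" "block P l = {}" "l < 4" and arc: "(x, y) \<in> arcs" "P x = P y"
    and c: "is_pieces f c" "\<forall>v\<in>V. f v = (if v \<noteq> x \<and> P v = P x then 1 else 0)"
    and Q: "Q = (\<lambda>v. if v \<in> V \<and> v \<in> piece c y then l else P v)"
  shows "fine Q" "block Q l \<noteq> {}" "block P j \<noteq> {} \<Longrightarrow> block Q j \<noteq> {}"
proof -
  have V: "x \<in> V" "y \<in> V" "x \<noteq> y" using arcs_V[OF arc(1)] by auto
  let ?H = "block P (P x)"
  have lab: "labelled P" and sound: "\<And>j. sound (block P j)"
    using P(1) by (simp_all add: fine_def labelled_def sound_def)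
  have xH: "x \<in> ?H" using V by (simp add: block_def)
  then have H: "conn ?H" using sound[of "P x"] by (auto simp: sound_def)
  have st: "star ?H x c"
    by (rule star_class[OF H block_subset xH c(1), of 1]) (use c(2) V in \<open>auto simp: block_def\<close>)
  have "y \<in> ?H - {x}" using V arc(2) by (simp add: block_def)
  then have sub: "piece c y \<subseteq> ?H - {x}" using st unfolding star_def by blast
  have rest: "conn (?H - piece c y)"
    by (rule star_remove[OF st sub]) (use piece_eq in blast)
  have neq: "l \<noteq> P x" using P(2) xH by auto
  have ps: "piece c y \<subset> ?H" using sub xH by blast
  note pc = put_cut[OF lab refl ps piece_conn[OF c(1) V(2)] rest neq P(3,2) Q]
  have g: "sound (block Q j)" if "block Q j \<subseteq> block P i" for i j
    using that pc(1) sound[of i] good_mono card_mono[OF finite_block that]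
    by (auto simp: sound_def labelled_def)
  have subs: "\<exists>i. block Q j \<subseteq> block P i" for j
  proof -
    consider "j = P x" | "j = l" | "j \<noteq> P x" "j \<noteq> l" by blast
    then show ?thesis
    proof cases
      case 1
      then show ?thesis using pc(2) by (intro exI[of _ "P x"]) simp
    next
      case 2
      then show ?thesis using pc(3) ps by (intro exI[of _ "P x"]) simp
    next
      case 3
      then show ?thesis using pc(4) by (intro exI[of _ j]) simp
    qed
  qed
  then have "sound (block Q j)" for j using g by blast
  then show "fine Q" using pc(1) by (simp add: fine_def labelled_def)
  show "block Q l \<noteq> {}" using pc(3) piece_refl[OF V(2)] by blast
  show "block P j \<noteq> {} \<Longrightarrow> block Q j \<noteq> {}"
    using pc(2) pc(4)[of j] P(2) ps by (cases "j = P x"; cases "j = l") auto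
qed

lemma wp_occupy:
  assumes env: "env s" and P: "s ''part'' = P" "fine P" "l < 4"
  shows "wp work (occupy l) (\<lambda>s'. env s' \<and> fine (s' ''part'') \<and> block (s' ''part'') l \<noteq> {} \<and>
    (\<forall>j. block P j \<noteq> {} \<longrightarrow> block (s' ''part'') j \<noteq> {})) s"
    (is "wp _ _ ?Q s")
  unfolding occupy_def
proof (rule wp_Seq[OF wp_count_part[OF env]])
  let ?find = "find_arc (eq (Cell ''part'' (var ''p'')) (Cell ''part'' (var ''q'')))"
  let ?ind = "indicator ''cls'' (eq (Cell ''part'' (var ''v'')) (var ''a''))"
  let ?put = "put (eq (Cell ''pc'' (var ''v'')) (Cell ''pc'' (var ''y''))) l"
  fix s1
  assume 1: "env s1 \<and> s1 ''c'' 0 = card (block (s ''part'') l)"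
    and ag1: "agree (writes (count ''c'' (part_is l))) s s1"
  have env1: "env s1" using 1 by blast
  have part1: "s1 ''part'' = P" using ag1 P(1) by (simp add: agree_def)
  show "wp work (If (eq (var ''c'') (Const 0))
       (?find ;; ''a'' ::= Cell ''part'' (var ''x'') ;; ?ind ;; Store ''cls'' (var ''x'') (Const 0) ;;
        comps ;; ?put) Skip) ?Q s1"
  proof (rule wp_If[OF work_bounds(4)])
    assume "\<not> cond_val (eq (var ''c'') (Const 0)) s1"
    then have "block P l \<noteq> {}" using 1 P(1) by auto
    then show "wp work Skip ?Q s1"
      using env1 part1 P(2) by (intro wp_Skip work_bounds(4)) simp
  next
    assume "cond_val (eq (var ''c'') (Const 0)) s1"
    then have empty: "block P l = {}" using 1 P(1) by simp
    have find: "wp m ?find (\<lambda>s'. if s' ''f'' 0 = 1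
        then (s' ''x'' 0, s' ''y'' 0) \<in> arcs \<and> P (s' ''x'' 0) = P (s' ''y'' 0)
        else s' ''f'' 0 = 0 \<and> (\<forall>u v. (u, v) \<in> arcs \<longrightarrow> \<not> P u = P v)) s1"
      by (rule wp_find_arc[OF env_inp[OF env1]]) (auto simp: agree_def part1)
    show "wp work (?find ;; ''a'' ::= Cell ''part'' (var ''x'') ;; ?ind ;;
        Store ''cls'' (var ''x'') (Const 0) ;; comps ;; ?put) ?Q s1"
    proof (rule wp_Seq[OF wp_weaken[OF find time_bounds(7)]])
      fix s2
      assume 2: "if s2 ''f'' 0 = 1
        then (s2 ''x'' 0, s2 ''y'' 0) \<in> arcs \<and> P (s2 ''x'' 0) = P (s2 ''y'' 0)
        else s2 ''f'' 0 = 0 \<and> (\<forall>u v. (u, v) \<in> arcs \<longrightarrow> \<not> P u = P v)"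
        and ag2: "agree (writes ?find) s1 s2"
      define x y where "x = s2 ''x'' 0" and "y = s2 ''y'' 0"
      obtain p q where "(p, q) \<in> arcs" "P p = P q" using occupy_arc[OF P(2) empty P(3)] .
      then have arc: "(x, y) \<in> arcs" "P x = P y"
        using 2 by (auto simp: x_def y_def split: if_splits)
      have env2: "env s2" by (rule env_agree[OF ag2 env1]) simp
      have part2: "s2 ''part'' = P" using ag2 part1 by (simp add: agree_def)
      show "wp work (''a'' ::= Cell ''part'' (var ''x'') ;; ?ind ;;
        Store ''cls'' (var ''x'') (Const 0) ;; comps ;; ?put) ?Q s2"
      proof (rule wp_Seq[OF wp_assign[OF work_bounds(4)]])
        fix s3
        assume 3: "s3 ''a'' 0 = expr_val (Cell ''part'' (var ''x'')) s2"
          and ag3: "agree (writes (''a'' ::= Cell ''part'' (var ''x''))) s2 s3"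
        have env3: "env s3" by (rule env_agree[OF ag3 env2]) simp
        have same3: "s3 ''part'' = P" "s3 ''x'' 0 = x" "s3 ''y'' 0 = y" "s3 ''a'' 0 = P x"
          using ag3 part2 3 by (simp_all add: agree_def x_def y_def)
        have ind: "wp n ?ind (\<lambda>s'. indicates (s' ''cls'') {v \<in> V. P v = P x}) s3"
          by (rule wp_indicator[OF env_inp[OF env3]]) (auto simp: agree_def same3)
        show "wp work (?ind ;; Store ''cls'' (var ''x'') (Const 0) ;; comps ;; ?put) ?Q s3"
        proof (rule wp_Seq[OF wp_weaken[OF ind work_bounds(1)]])
          fix s4
          assume 4: "indicates (s4 ''cls'') {v \<in> V. P v = P x}" and ag4: "agree (writes ?ind) s3 s4"
          let ?s5 = "s4(''cls'' := (s4 ''cls'')(x := 0))"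
          define f where "f = ?s5 ''cls''"
          have f: "\<forall>v\<in>V. f v = (if v \<noteq> x \<and> P v = P x then 1 else 0)"
            using 4 by (auto simp: f_def indicates_def)
          have x4: "s4 ''x'' 0 = x" using ag4 same3 by (simp add: agree_def)
          have ag5: "agree {''i'', ''v'', ''cls''} s3 ?s5" using ag4 by (auto simp: agree_def)
          have env5: "env ?s5" by (rule env_agree[OF ag5 env3]) simp
          have "wp work (comps ;; ?put) ?Q ?s5"
          proof (rule wp_Seq[OF wp_weaken[OF wp_comps[OF env_inp[OF env5]] work_bounds(2)]])
            fix s6
            assume 6: "is_pieces (?s5 ''cls'') (s6 ''pc'')" and ag6: "agree (writes comps) ?s5 s6"
            have env6: "env s6" by (rule env_agree[OF ag6 env5]) simp
            define c where "c = s6 ''pc''"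
            have pcs: "is_pieces f c" using 6 by (simp only: f_def c_def)
            have same6: "s6 ''part'' = P" "s6 ''y'' 0 = y"
              using ag6 ag5 same3 by (simp_all add: agree_def)
            define Q where "Q = (\<lambda>v. if v \<in> V \<and> v \<in> piece c y then l else P v)"
            note occ = occupy_fine[OF P(2) empty P(3) arc pcs f Q_def]
            have Q': "Q = (\<lambda>v. if v \<in> V \<and> c v = c y then l else s6 ''part'' v)"
              by (auto simp: Q_def piece_def same6)
            have "wp work ?put (\<lambda>s'. env s' \<and>
                s' ''part'' = (\<lambda>v. if v \<in> V \<and> c v = c y then l else s6 ''part'' v)) s6"
              by (rule wp_put[OF env6]) (auto simp: agree_def same6 c_def)
            then show "wp work ?put ?Q s6"
              unfolding Q'[symmetric] by (rule wp_weaken[OF _ order_refl]) (use occ in simp)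
          qed
          then show "wp work (Store ''cls'' (var ''x'') (Const 0) ;; comps ;; ?put) ?Q s4"
            by (intro wp_Store_seq[OF work_bounds(4)]) (simp add: x4)
        qed
      qed
    qed
  qed
qed

lemma wp_target:
  assumes "inp s"
  shows "wp work (While (Neg (Less (scale 6 (var ''n'')) (scale 13 (Add (var ''T'') (Const 1)))))
       (''T'' ::= Add (var ''T'') (Const 1))) (\<lambda>s'. s' ''T'' 0 = target) (s(''T'' := (s ''T'')(0 := 0)))"
    (is "wp _ (While ?b ?p) _ ?s")
proof -
  let ?I = "\<lambda>s'. s' ''n'' 0 = n \<and> s' ''T'' 0 \<le> target"
  have "wp (n * 1) (While ?b ?p) (\<lambda>s'. ?I s' \<and> \<not> cond_val ?b s') ?s"
  proof (rule wp_While[where \<mu> = "\<lambda>s'. target - s' ''T'' 0"])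
    show "target - ?s ''T'' 0 \<le> n" using target_bounds(1) by simp
    show "?I ?s" using assms by (simp add: inp_def)
    fix s' assume I: "?I s'" and b: "cond_val ?b s'"
    have "13 * (s' ''T'' 0 + 1) \<le> 6 * n" using I b by simp
    also have "\<dots> < 13 * (target + 1)" using target_bounds(2) by simp
    finally have "s' ''T'' 0 < target" by simp
    then show "wp 1 ?p (\<lambda>s''. ?I s'' \<and> target - s'' ''T'' 0 < target - s' ''T'' 0) s'"
      using I by (intro wp_assign') auto
  qed simp_all
  then have "wp n (While ?b ?p) (\<lambda>s'. ?I s' \<and> \<not> cond_val ?b s') ?s" by simp
  then show ?thesis
  proof (rule wp_weaken[OF _ work_bounds(1)])
    fix s' assume *: "?I s' \<and> \<not> cond_val ?b s'"
    have "13 * target \<le> 6 * n" by (rule target_bounds(1))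
    also have "\<dots> < 13 * (s' ''T'' 0 + 1)" using * by simp
    finally have "target < s' ''T'' 0 + 1" by simp
    then show "s' ''T'' 0 = target" using * by simp
  qed
qed

lemma wp_partitioner:
  assumes inp: "inp s" and part: "\<forall>v\<in>V. s ''part'' v = 0"
  shows "wp work partitioner (\<lambda>s'. fine (s' ''part'') \<and> (\<forall>l<4. block (s' ''part'') l \<noteq> {})) s"
    (is "wp _ _ ?Q s")
proof -
  let ?loop = "While (Neg (Less (scale 6 (var ''n'')) (scale 13 (Add (var ''T'') (Const 1)))))
       (''T'' ::= Add (var ''T'') (Const 1))"
  let ?g = "''g'' ::= Sub (Sub (var ''n'') (Add (var ''T'') (var ''T''))) (Const 1)"
  let ?s1 = "s(''T'' := (s ''T'')(0 := 0))"
  have "wp work (?loop ;; ?g ;; split_up ;; occupy 0 ;; occupy 1 ;; occupy 2 ;; occupy 3) ?Q ?s1"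
  proof (rule wp_Seq[OF wp_target[OF inp]])
    fix s2
    assume T: "s2 ''T'' 0 = target" and ag2: "agree (writes ?loop) ?s1 s2"
    have ag2': "agree {''T''} s s2" using ag2 by (auto simp: agree_def)
    have inp2: "inp s2" by (rule inp_agree[OF ag2' _ inp]) simp
    have n2: "s2 ''n'' 0 = n" using inp2 by (simp add: inp_def)
    show "wp work (?g ;; split_up ;; occupy 0 ;; occupy 1 ;; occupy 2 ;; occupy 3) ?Q s2"
    proof (rule wp_Seq[OF wp_assign[OF work_bounds(4)]])
      fix s3
      assume g: "s3 ''g'' 0 = expr_val (Sub (Sub (var ''n'') (Add (var ''T'') (var ''T''))) (Const 1)) s2"
        and ag3: "agree (writes ?g) s2 s3"
      have "inp s3" by (rule inp_agree[OF ag3 _ inp2]) simp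
      moreover have "s3 ''T'' 0 = target" using ag3 T by (simp add: agree_def)
      ultimately have env3: "env s3" using g T n2 by (simp add: env_def gap_def mult_2)
      have part3: "\<forall>v\<in>V. s3 ''part'' v = 0" using ag2' ag3 part by (simp add: agree_def)
      show "wp work (split_up ;; occupy 0 ;; occupy 1 ;; occupy 2 ;; occupy 3) ?Q s3"
      proof (rule wp_Seq[OF wp_split_up[OF env3 refl part3]])
        fix s4
        assume 4: "fine (s4 ''part'')" and ag4: "agree (writes split_up) s3 s4"
        have env4: "env s4"
          by (rule env_agree[OF ag4 env3])
            (simp add: split_up_def halve_def shrink_def bridge_def claw_def)
        show "wp work (occupy 0 ;; occupy 1 ;; occupy 2 ;; occupy 3) ?Q s4"
        proof (rule wp_Seq[OF wp_occupy[OF env4 refl 4]])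
          fix s5 assume 5: "env s5 \<and> fine (s5 ''part'') \<and> block (s5 ''part'') 0 \<noteq> {} \<and>
            (\<forall>j. block (s4 ''part'') j \<noteq> {} \<longrightarrow> block (s5 ''part'') j \<noteq> {})"
          then have 5: "env s5" "fine (s5 ''part'')" "block (s5 ''part'') 0 \<noteq> {}" by blast+
          show "wp work (occupy 1 ;; occupy 2 ;; occupy 3) ?Q s5"
          proof (rule wp_Seq[OF wp_occupy[OF 5(1) refl 5(2)]])
            fix s6 assume "env s6 \<and> fine (s6 ''part'') \<and> block (s6 ''part'') 1 \<noteq> {} \<and>
              (\<forall>j. block (s5 ''part'') j \<noteq> {} \<longrightarrow> block (s6 ''part'') j \<noteq> {})"
            then have 6: "env s6" "fine (s6 ''part'')" "block (s6 ''part'') 0 \<noteq> {}" "block (s6 ''part'') 1 \<noteq> {}"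
              using 5(3) by blast+
            show "wp work (occupy 2 ;; occupy 3) ?Q s6"
            proof (rule wp_Seq[OF wp_occupy[OF 6(1) refl 6(2)]])
              fix s7 assume "env s7 \<and> fine (s7 ''part'') \<and> block (s7 ''part'') 2 \<noteq> {} \<and>
                (\<forall>j. block (s6 ''part'') j \<noteq> {} \<longrightarrow> block (s7 ''part'') j \<noteq> {})"
              then have 7: "env s7" "fine (s7 ''part'')" "block (s7 ''part'') 0 \<noteq> {}"
                "block (s7 ''part'') 1 \<noteq> {}" "block (s7 ''part'') 2 \<noteq> {}"
                using 6(3,4) by blast+
              show "wp work (occupy 3) ?Q s7"
              proof (rule wp_weaken[OF wp_occupy[OF 7(1) refl 7(2)] order_refl])
                fix s8 assume "env s8 \<and> fine (s8 ''part'') \<and> block (s8 ''part'') 3 \<noteq> {} \<and>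
                  (\<forall>j. block (s7 ''part'') j \<noteq> {} \<longrightarrow> block (s8 ''part'') j \<noteq> {})"
                then have 8: "fine (s8 ''part'')" "block (s8 ''part'') 0 \<noteq> {}"
                  "block (s8 ''part'') 1 \<noteq> {}" "block (s8 ''part'') 2 \<noteq> {}" "block (s8 ''part'') 3 \<noteq> {}"
                  using 7(3-5) by blast+
                have "block (s8 ''part'') l \<noteq> {}" if "l < 4" for l
                proof -
                  have "l = 0 \<or> l = 1 \<or> l = 2 \<or> l = 3" using that by linarith
                  then show ?thesis using 8(2-5) by blast
                qed
                then show "?Q s8" using 8(1) by blast
              qed simp
            qed simp
          qed simp
        qed simp
      qed
    qed
  qed
  then show ?thesis
    unfolding partitioner_def by (intro wp_assign_seq[OF work_bounds(4)]) simp
qed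

lemma output_parts_block: "output_parts 4 V s = block (s ''part'') ` {..<4}"
  by (simp add: output_parts_def block_def)

lemma fine_feasible:
  assumes "fine P" "\<forall>l<4. block P l \<noteq> {}"
  shows "feasible_partition 4 V E (block P ` {..<4})"
    and "real (partition_size (block P ` {..<4})) \<le> 24 / 13 * real (OPT 4 V E)"
proof -
  let ?B = "block P ` {..<4}"
  have lt4: "\<forall>v\<in>V. P v < 4" and sound: "\<And>l. sound (block P l)" using assms(1) by (auto simp: fine_def)
  have disj: "block P i \<inter> block P j = {}" if "i \<noteq> j" for i j
    using that by (auto simp: block_def)
  have "inj_on (block P) {..<4}"
    using assms(2) disj by (intro inj_onI) (metis Int_absorb lessThan_iff)
  then have "card ?B = 4" by (simp add: card_image)
  moreover have "partition_on V ?B"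
    unfolding partition_on_def disjoint_def
  proof (intro conjI ballI impI)
    show "\<Union>?B = V" using lt4 by (auto simp: block_def)
    show "{} \<notin> ?B" using assms(2) by auto
    fix S S' assume "S \<in> ?B" "S' \<in> ?B" "S \<noteq> S'"
    then obtain i j where ij: "S = block P i" "S' = block P j" "i \<noteq> j" by blast
    show "S \<inter> S' = {}" unfolding ij(1,2) by (rule disj[OF ij(3)])
  qed
  moreover have "conn S" if "S \<in> ?B" for S
    using that assms(2) sound by (auto simp: sound_def)
  ultimately show feas: "feasible_partition 4 V E ?B" by (simp add: feasible_partition_def)
  let ?A = "{partition_size Q | Q. feasible_partition 4 V E Q}"
  have "?A \<subseteq> partition_size ` Pow (Pow V)"
    by (auto simp: feasible_partition_def partition_on_def)
  then have "finite ?A" by (rule finite_subset) simp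
  \<comment> \<open>The partition just built shows that the minimum is attained, so
    \<open>good\<close> can be applied to an optimal partition.\<close>
  moreover have "?A \<noteq> {}" using feas by blast
  ultimately have "OPT 4 V E \<in> ?A" unfolding OPT_def by (rule Min_in)
  then obtain Q where Q: "feasible_partition 4 V E Q" "OPT 4 V E = partition_size Q" by blast
  have "partition_size ?B \<in> card ` ?B"
    unfolding partition_size_def by (rule Max_in) (auto simp: lessThan_empty_iff)
  then obtain l where "partition_size ?B = card (block P l)" by auto
  moreover have "13 * card (block P l) \<le> 24 * partition_size Q"
    using sound[of l] Q(1) by (simp add: sound_def good_def)
  ultimately have "13 * partition_size ?B \<le> 24 * OPT 4 V E" using Q(2) by simp
  then have "real (13 * partition_size ?B) \<le> real (24 * OPT 4 V E)" by (rule of_nat_mono)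
  then show "real (partition_size ?B) \<le> 24 / 13 * real (OPT 4 V E)" by simp
qed

lemma inp_input_state: "inp (input_state vs es)"
  by (auto simp: inp_def input_state_def list_array_def length_vs length_es)

end

theorem theorem9:
  "\<exists>(p :: prog) (C :: nat). \<forall>(V :: nat set) (E :: nat set set) vs es.
     simple_graph V E \<and> induced_connected E V \<and> card V \<ge> 4 \<and> presents vs es V E \<longrightarrow>
     (\<exists>t s. run p (input_state vs es) t s \<and>
            t \<le> C * ((card V)\<^sup>2 * card E) \<and>
            feasible_partition 4 V E (output_parts 4 V s) \<and>
            real (partition_size (output_parts 4 V s)) \<le> 24 / 13 * real (OPT 4 V E))"
proof (rule exI[of _ partitioner], rule exI[of _ "2 * weight partitioner"], intro allI impI)
  fix V :: "nat set" and E :: "nat set set" and vs es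
  assume *: "simple_graph V E \<and> induced_connected E V \<and> card V \<ge> 4 \<and> presents vs es V E"
  interpret graph_input vs es V E
    using * by unfold_locales auto
  have "\<forall>v\<in>V. input_state vs es ''part'' v = 0"
    by (simp add: input_state_def)
  from wp_partitioner[OF inp_input_state this]
  obtain t s where t: "run partitioner (input_state vs es) t s"
      "t \<le> weight partitioner * (card V * (card V * (card E + 1)))"
    and s: "fine (s ''part'')" "\<forall>l<4. block (s ''part'') l \<noteq> {}"
    unfolding wp_def by blast
  \<comment> \<open>There is at least one edge, so the summand 1 costs only a factor 2.\<close>
  have "card E + 1 \<le> 2 * card E" using m_pos by linarith
  then have "card V * (card V * (card E + 1)) \<le> card V * (card V * (2 * card E))"
    by (intro mult_le_mono2)
  then have "weight partitioner * (card V * (card V * (card E + 1))) \<le>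
      weight partitioner * (card V * (card V * (2 * card E)))"
    by (rule mult_le_mono2)
  also have "\<dots> = 2 * weight partitioner * ((card V)\<^sup>2 * card E)"
    by (simp only: power2_eq_square mult_ac)
  finally have "t \<le> 2 * weight partitioner * ((card V)\<^sup>2 * card E)"
    using t(2) by linarith
  then show "\<exists>t s. run partitioner (input_state vs es) t s \<and>
            t \<le> 2 * weight partitioner * ((card V)\<^sup>2 * card E) \<and>
            feasible_partition 4 V E (output_parts 4 V s) \<and>
            real (partition_size (output_parts 4 V s)) \<le> 24 / 13 * real (OPT 4 V E)"
    using t(1) fine_feasible[OF s] unfolding output_parts_block by blast
qed

end
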